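(* Suppose that $\mathcal T=(V,E)$ is a directed tree for which there exists $\omega\in V$ such that $\operatorname{card}(\operatorname{Chi}(\omega))\ge2$ and $\operatorname{card}(\operatorname{Chi}(v))=1$ for every $v\in V\setminus\{\omega\}$. Let $S_{\boldsymbol\lambda}\in\boldsymbol B(\ell^2(V))$ be a weighted shift on $\mathcal T$ with nonzero weights $\boldsymbol\lambda=\{\lambda_v\}_{v\in V^\circ}$. Then the following assertions are valid. (i) If $\omega$ is the root of $\mathcal T$, then $S_{\boldsymbol\lambda}$ is subnormal if and only if $\{\|S_{\boldsymbol\lambda}^ne_v\|^2\}_{n=0}^\infty$ is a Stieltjes moment sequence for every $v\in\operatorname{Chi}(\omega)$ and $$\sum_{v\in\operatorname{Chi}(\omega)}|\lambda_v|^2\int_0^\infty\frac1s\,d\mu_v(s)\le1.$$ (ii) If $\mathcal T$ has a root and $\omega\ne\mathrm{root}$, then $S_{\boldsymbol\lambda}$ is subnormal if and only if any one of the following two equivalent conditions holds: (ii-a) $S_{\boldsymbol\lambda_\rightarrow(\omega)}$ is subnormal, $$\sum_{v\in\operatorname{Chi}(\omega)}|\lambda_v|^2\int_0^\infty\frac1s\,d\mu_v(s)=1,\qquad(1)$$ $$\frac1{\big|\prod_{j=0}^{k-1}\lambda_{\operatorname{par}^j(\omega)}\big|^2}=\sum_{v\in\operatorname{Chi}(\omega)}|\lambda_v|^2\int_0^\infty\frac1{s^{k+1}}\,d\mu_v(s)\qquad(2)$$ for all integers $k$ with $1\le k\le\kappa-1$, and $$\frac1{\big|\prod_{j=0}^{\kappa-1}\lambda_{\operatorname{par}^j(\omega)}\big|^2}\ge\sum_{v\in\operatorname{Chi}(\omega)}|\lambda_v|^2\int_0^\infty\frac1{s^{\kappa+1}}\,d\mu_v(s),$$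 where $\kappa$ is the unique positive integer such that $\operatorname{par}^\kappa(\omega)=\mathrm{root}$; (ii-b) $\{\|S_{\boldsymbol\lambda}^ne_{\mathrm{root}}\|^2\}_{n=0}^\infty$ and $\{\|S_{\boldsymbol\lambda}^ne_v\|^2\}_{n=0}^\infty$ are Stieltjes moment sequences for all $v\in\operatorname{Chi}(\omega)$. (iii) If $\mathcal T$ is rootless, then $S_{\boldsymbol\lambda}$ is subnormal if and only if any one of the following two equivalent conditions holds: (iii-a) $S_{\boldsymbol\lambda_\rightarrow(\omega)}$ is subnormal, equality (1) holds, and equality (2) holds for all integers $k\ge1$; (iii-b) $\{\|S_{\boldsymbol\lambda}^ne_{\operatorname{par}^k(\omega)}\|^2\}_{n=0}^\infty$ and $\{\|S_{\boldsymbol\lambda}^ne_v\|^2\}_{n=0}^\infty$ are Stieltjes moment sequences for infinitely many integers $k\ge1$ and for all $v\in\operatorname{Chi}(\omega)$.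
   Context: A directed tree $\mathcal T=(V,E)$ consists of a nonempty set $V$ (of arbitrary cardinality) of vertices and a set $E\subseteq V\times V\setminus\{(v,v):v\in V\}$ of edges such that: (1) any two distinct vertices $u,v$ are joined by an undirected path, i.e. there are $v_1=u,\dots,v_n=v$ in $V$ ($n\ge 2$) with $(v_j,v_{j+1})\in E$ or $(v_{j+1},v_j)\in E$ for each $j<n$; (2) there is no circuit, i.e. no finite sequence of distinct vertices $u_1,\dots,u_n$ ($n\ge2$) with $(u_j,u_{j+1})\in E$ for $j<n$ and $(u_n,u_1)\in E$; (3) every vertex $v$ that is not a root has a unique vertex $\operatorname{par}(v)$ (its parent) with $(\operatorname{par}(v),v)\in E$; a root is a vertex $v$ for which there is no $u$ with $(u,v)\in E$. A directed tree has at most one root, denoted $\mathrm{root}$ when it exists; it is rootless if there is none. $V^\circ$ is $V$ with the root removed (and $V^\circ=V$ if $\mathcal T$ is rootless). $\operatorname{Chi}(u)=\{v\in V:(u,v)\in E\}$. $\operatorname{par}^j$ is the $j$-fold composition of $\operatorname{par}$, $\operatorname{par}^0$ being the identity. $\operatorname{Des}(u)$ is the set of $v\in V$ with $\operatorname{par}^n(v)=u$ for some $n\ge0$; $\mathcal T_{\operatorname{Des}(u)}=(\operatorname{Des}(u),E\cap(\operatorname{Des}(u)\times\operatorname{Des}(u)))$ is a directed tree with root $u$. $\ell^2(V)$ is the Hilbert space of square summable complex functions on $V$, with orthonormal basis $\{e_u\}_{u\in V}$, $e_u$ being the indicator function of $\{u\}$. For $\boldsymbol\lambda=\{\lambda_v\}_{v\in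 V^\circ}\subseteq\mathbb C$ and $f\colon V\to\mathbb C$ put $(\Lambda f)(v)=\lambda_v f(\operatorname{par}(v))$ for $v\in V^\circ$ and $(\Lambda f)(\mathrm{root})=0$. The weighted shift $S_{\boldsymbol\lambda}$ is the operator in $\ell^2(V)$ with domain $\{f\in\ell^2(V):\Lambda f\in\ell^2(V)\}$ and $S_{\boldsymbol\lambda}f=\Lambda f$. $S_{\boldsymbol\lambda_\rightarrow(\omega)}$ denotes the weighted shift on $\mathcal T_{\operatorname{Des}(\omega)}$ with weights $\{\lambda_v\}_{v\in\operatorname{Des}(\omega)\setminus\{\omega\}}$; it is the restriction of $S_{\boldsymbol\lambda}$ to $\ell^2(\operatorname{Des}(\omega))$. $\boldsymbol B(\mathcal H)$ denotes the bounded operators on $\mathcal H$ with domain $\mathcal H$. $A\in\boldsymbol B(\mathcal H)$ is subnormal if it is the restriction to $\mathcal H$ of a bounded normal operator on a complex Hilbert space containing $\mathcal H$. A real sequence $\{t_n\}_{n=0}^\infty$ is a Stieltjes moment sequence if there is a positive Borel measure $\mu$ on $[0,\infty)$ (a representing measure) with $t_n=\int_0^\infty s^n\,d\mu(s)$ for all $n\ge0$. If $S_{\boldsymbol\lambda}$ is bounded and $\{\|S_{\boldsymbol\lambda}^ne_w\|^2\}_{n=0}^\infty$ is a Stieltjes moment sequence, its representing measure is unique; it is denoted $\mu_w$. (Subnormality of $S_{\boldsymbol\lambda_\rightarrow(\omega)}$ guarantees that $\mu_v$ exists for every $v\in\operatorname{Chi}(\omega)$.) Conventions: $\int_0^\infty$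 means $\int_{[0,\infty)}$ and $\frac10=\infty$. *)

theory Defs
  imports "HOL-Analysis.Analysis"
begin

section \<open>Complex Hilbert spaces, bounded and subnormal operators\<close>

text \<open>Hilbert spaces are given by a carrier set and explicit operations, since they have to be
  existentially quantified (in the definition of subnormality) and since \<open>\<ell>\<^sup>2(V)\<close> is needed for
  varying subsets \<open>V\<close> of one type. The inner product is linear in its first argument.\<close>

record 'k hilb =
  hset :: "'k set"
  hzero :: 'k
  hadd :: "'k \<Rightarrow> 'k \<Rightarrow> 'k"
  hscale :: "complex \<Rightarrow> 'k \<Rightarrow> 'k"
  hinner :: "'k \<Rightarrow> 'k \<Rightarrow> complex"

definition hnorm :: "'k hilb \<Rightarrow> 'k \<Rightarrow> real" where
  "hnorm H x = sqrt (Re (hinner H x x))"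

definition hdist :: "'k hilb \<Rightarrow> 'k \<Rightarrow> 'k \<Rightarrow> real" where
  "hdist H x y = hnorm H (hadd H x (hscale H (- 1) y))"

locale complex_hilbert_space =
  fixes H :: "'k hilb"
  assumes zero_closed: "hzero H \<in> hset H"
    and add_closed: "\<lbrakk>x \<in> hset H; y \<in> hset H\<rbrakk> \<Longrightarrow> hadd H x y \<in> hset H"
    and scale_closed: "x \<in> hset H \<Longrightarrow> hscale H c x \<in> hset H"
    and add_assoc: "\<lbrakk>x \<in> hset H; y \<in> hset H; z \<in> hset H\<rbrakk>
      \<Longrightarrow> hadd H (hadd H x y) z = hadd H x (hadd H y z)"
    and add_comm: "\<lbrakk>x \<in> hset H; y \<in> hset H\<rbrakk> \<Longrightarrow> hadd H x y = hadd H y x"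
    and add_zero: "x \<in> hset H \<Longrightarrow> hadd H x (hzero H) = x"
    and add_minus: "x \<in> hset H \<Longrightarrow> hadd H x (hscale H (- 1) x) = hzero H"
    and scale_add_right: "\<lbrakk>x \<in> hset H; y \<in> hset H\<rbrakk>
      \<Longrightarrow> hscale H c (hadd H x y) = hadd H (hscale H c x) (hscale H c y)"
    and scale_add_left: "x \<in> hset H
      \<Longrightarrow> hscale H (c + d) x = hadd H (hscale H c x) (hscale H d x)"
    and scale_scale: "x \<in> hset H \<Longrightarrow> hscale H c (hscale H d x) = hscale H (c * d) x"
    and scale_one: "x \<in> hset H \<Longrightarrow> hscale H 1 x = x"
    and inner_add: "\<lbrakk>x \<in> hset H; y \<in> hset H; z \<in> hset H\<rbrakk>
      \<Longrightarrow> hinner H (hadd H x y) z = hinner H x z + hinner H y z"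
    and inner_scale: "\<lbrakk>x \<in> hset H; y \<in> hset H\<rbrakk>
      \<Longrightarrow> hinner H (hscale H c x) y = c * hinner H x y"
    and inner_commute: "\<lbrakk>x \<in> hset H; y \<in> hset H\<rbrakk> \<Longrightarrow> hinner H x y = cnj (hinner H y x)"
    and inner_nonneg: "x \<in> hset H \<Longrightarrow> 0 \<le> Re (hinner H x x)"
    and inner_eq_zeroD: "\<lbrakk>x \<in> hset H; hinner H x x = 0\<rbrakk> \<Longrightarrow> x = hzero H"
    and complete: "\<lbrakk>\<And>n. X n \<in> hset H;
        \<And>\<epsilon>. 0 < \<epsilon> \<Longrightarrow> \<exists>N. \<forall>m\<ge>N. \<forall>n\<ge>N. hdist H (X m) (X n) < \<epsilon>\<rbrakk>
      \<Longrightarrow> \<exists>x\<in>hset H. (\<lambda>n. hdist H (X n) x) \<longlonglongrightarrow> 0"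

definition linear_map :: "'h hilb \<Rightarrow> 'k hilb \<Rightarrow> ('h \<Rightarrow> 'k) \<Rightarrow> bool" where
  "linear_map H K A \<longleftrightarrow>
    (\<forall>x\<in>hset H. A x \<in> hset K) \<and>
    (\<forall>x\<in>hset H. \<forall>y\<in>hset H. A (hadd H x y) = hadd K (A x) (A y)) \<and>
    (\<forall>c. \<forall>x\<in>hset H. A (hscale H c x) = hscale K c (A x))"

definition bounded_operator :: "'k hilb \<Rightarrow> ('k \<Rightarrow> 'k) \<Rightarrow> bool" where
  "bounded_operator H A \<longleftrightarrow>
    linear_map H H A \<and> (\<exists>C. \<forall>x\<in>hset H. hnorm H (A x) \<le> C * hnorm H x)"

definition is_adjoint :: "'k hilb \<Rightarrow> ('k \<Rightarrow> 'k) \<Rightarrow> ('k \<Rightarrow> 'k) \<Rightarrow> bool" where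
  "is_adjoint H A B \<longleftrightarrow> (\<forall>x\<in>hset H. \<forall>y\<in>hset H. hinner H (A x) y = hinner H x (B y))"

definition normal_operator :: "'k hilb \<Rightarrow> ('k \<Rightarrow> 'k) \<Rightarrow> bool" where
  "normal_operator H N \<longleftrightarrow> bounded_operator H N \<and>
    (\<exists>N'. bounded_operator H N' \<and> is_adjoint H N N' \<and> (\<forall>x\<in>hset H. N (N' x) = N' (N x)))"

definition isometric_embedding :: "'h hilb \<Rightarrow> 'k hilb \<Rightarrow> ('h \<Rightarrow> 'k) \<Rightarrow> bool" where
  "isometric_embedding H K J \<longleftrightarrow> linear_map H K J \<and>
    (\<forall>x\<in>hset H. \<forall>y\<in>hset H. hinner K (J x) (J y) = hinner H x y)"

text \<open>The bounded normal operator \<open>N\<close> in the Hilbert space \<open>K\<close> extends \<open>A\<close>, where the inclusion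
  of \<open>H\<close> in \<open>K\<close> is the isometric embedding \<open>J\<close>.\<close>

definition normal_extension ::
  "'h hilb \<Rightarrow> ('h \<Rightarrow> 'h) \<Rightarrow> 'k hilb \<Rightarrow> ('k \<Rightarrow> 'k) \<Rightarrow> ('h \<Rightarrow> 'k) \<Rightarrow> bool" where
  "normal_extension H A K N J \<longleftrightarrow>
    complex_hilbert_space K \<and> normal_operator K N \<and> isometric_embedding H K J \<and>
    (\<forall>x\<in>hset H. N (J x) = J (A x))"

text \<open>HOL cannot quantify existentially over the type of the elements of \<open>K\<close>. The type used here
  is large enough for this to be no restriction: by the theorem \<open>subnormalI\<close> below, a normal
  extension in a Hilbert space over any type whatsoever yields one over this type.\<close>

definition subnormal :: "'h hilb \<Rightarrow> ('h \<Rightarrow> 'h) \<Rightarrow> bool" where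
  "subnormal H A \<longleftrightarrow> bounded_operator H A \<and>
    (\<exists>(K :: ('h \<times> nat \<Rightarrow> complex) hilb) N J. normal_extension H A K N J)"


subsection \<open>Independence of the type of the extension space\<close>

context complex_hilbert_space
begin

lemma inner_zero_left: "x \<in> hset H \<Longrightarrow> hinner H (hzero H) x = 0"
  by (metis add_cancel_right_right add_zero inner_add zero_closed)

lemma inner_zero_right: "x \<in> hset H \<Longrightarrow> hinner H x (hzero H) = 0"
  by (metis complex_cnj_zero inner_commute inner_zero_left zero_closed)

lemma inner_self_real: "x \<in> hset H \<Longrightarrow> hinner H x x = complex_of_real (Re (hinner H x x))"
  by (metis Reals_cnj_iff inner_commute of_real_Re)

lemma inner_scale_right:
  "\<lbrakk>x \<in> hset H; y \<in> hset H\<rbrakk> \<Longrightarrow> hinner H x (hscale H c y) = cnj c * hinner H x y"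
  by (metis complex_cnj_mult inner_commute inner_scale scale_closed)

lemma inner_add_right:
  "\<lbrakk>x \<in> hset H; y \<in> hset H; z \<in> hset H\<rbrakk>
    \<Longrightarrow> hinner H x (hadd H y z) = hinner H x y + hinner H x z"
  by (metis complex_cnj_add inner_commute inner_add add_closed)

lemma hnorm_nonneg: "x \<in> hset H \<Longrightarrow> 0 \<le> hnorm H x"
  by (simp add: hnorm_def inner_nonneg)

lemma cauchy_schwarz:
  assumes x: "x \<in> hset H" and y: "y \<in> hset H"
  shows "cmod (hinner H x y) \<le> hnorm H x * hnorm H y"
proof (cases "Re (hinner H y y) = 0")
  case True
  then have "hinner H y y = 0" using inner_self_real[OF y] by simp
  then have "y = hzero H" using inner_eq_zeroD[OF y] by simp
  then show ?thesis using inner_zero_right[OF x] hnorm_nonneg x y by simp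
next
  case False
  define b where "b = Re (hinner H y y)"
  define a where "a = Re (hinner H x x)"
  define w where "w = hinner H x y"
  define c where "c = - w / complex_of_real b"
  have b: "b > 0" using False inner_nonneg[OF y] b_def by simp
  have yy: "hinner H y y = complex_of_real b" using inner_self_real[OF y] b_def by simp
  have xx: "hinner H x x = complex_of_real a" using inner_self_real[OF x] a_def by simp
  have yx: "hinner H y x = cnj w" using inner_commute[OF y x] w_def by simp
  let ?z = "hadd H x (hscale H c y)"
  have cy: "hscale H c y \<in> hset H" using y scale_closed by blast
  have z: "?z \<in> hset H" using x cy add_closed by blast
  have "hinner H ?z ?z = hinner H x x + cnj c * w + c * cnj w + c * cnj c * hinner H y y"
    using x y cy z yx
    by (simp add: inner_add inner_add_right inner_scale inner_scale_right flip: w_def)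
      (simp add: algebra_simps)
  also have "\<dots> = complex_of_real a - w * cnj w / complex_of_real b"
    using b by (simp add: xx yy c_def field_simps)
  also have "w * cnj w = complex_of_real ((cmod w)\<^sup>2)"
    using complex_norm_square[of w] by simp
  finally have "Re (hinner H ?z ?z) = a - (cmod w)\<^sup>2 / b"
    by (simp flip: of_real_divide)
  with inner_nonneg[OF z] have "(cmod w)\<^sup>2 \<le> a * b" using b by (simp add: field_simps)
  then have "cmod w \<le> sqrt (a * b)" by (simp add: real_le_rsqrt)
  then show ?thesis by (simp add: hnorm_def real_sqrt_mult w_def a_def b_def)
qed

lemma closed_subspace_hilbert:
  assumes M: "M \<subseteq> hset H" and z: "hzero H \<in> M"
    and a: "\<And>x y. x \<in> M \<Longrightarrow> y \<in> M \<Longrightarrow> hadd H x y \<in> M"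
    and s: "\<And>c x. x \<in> M \<Longrightarrow> hscale H c x \<in> M"
    and cl: "\<And>X x. (\<And>n. X n \<in> M) \<Longrightarrow> x \<in> hset H \<Longrightarrow> (\<lambda>n. hdist H (X n) x) \<longlonglongrightarrow> 0 \<Longrightarrow> x \<in> M"
  shows "complex_hilbert_space (H\<lparr>hset := M\<rparr>)"
proof -
  have d: "hdist (H\<lparr>hset := M\<rparr>) = hdist H"
    by (simp add: fun_eq_iff hdist_def hnorm_def)
  have inM: "x \<in> hset H" if "x \<in> M" for x using M that by blast
  show ?thesis
  proof (unfold_locales, unfold d, simp_all add: z a s inM)
    fix X :: "nat \<Rightarrow> 'k"
    assume X: "\<And>n. X n \<in> M"
      and C: "\<And>\<epsilon>. 0 < \<epsilon> \<Longrightarrow> \<exists>N. \<forall>m\<ge>N. \<forall>n\<ge>N. hdist H (X m) (X n) < \<epsilon>"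
    obtain x where "x \<in> hset H" "(\<lambda>n. hdist H (X n) x) \<longlonglongrightarrow> 0"
      using complete[of X] X C inM by blast
    then show "\<exists>x\<in>M. (\<lambda>n. hdist H (X n) x) \<longlonglongrightarrow> 0" using cl X by blast
  qed (auto intro: add_assoc add_comm add_zero add_minus scale_add_right scale_add_left
      scale_scale scale_one inner_add inner_scale inner_commute inner_nonneg inner_eq_zeroD inM)
qed

end

definition transport :: "('k \<Rightarrow> 'l) \<Rightarrow> 'k hilb \<Rightarrow> 'l hilb" where
  "transport \<phi> K = (let \<psi> = inv_into (hset K) \<phi> in
    \<lparr>hset = \<phi> ` hset K, hzero = \<phi> (hzero K),
     hadd = (\<lambda>x y. \<phi> (hadd K (\<psi> x) (\<psi> y))),
     hscale = (\<lambda>c x. \<phi> (hscale K c (\<psi> x))),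
     hinner = (\<lambda>x y. hinner K (\<psi> x) (\<psi> y))\<rparr>)"

lemma transport_simps:
  assumes "inj_on \<phi> (hset K)"
  shows "hset (transport \<phi> K) = \<phi> ` hset K"
    and "hzero (transport \<phi> K) = \<phi> (hzero K)"
    and "\<lbrakk>x \<in> hset K; y \<in> hset K\<rbrakk> \<Longrightarrow> hadd (transport \<phi> K) (\<phi> x) (\<phi> y) = \<phi> (hadd K x y)"
    and "x \<in> hset K \<Longrightarrow> hscale (transport \<phi> K) c (\<phi> x) = \<phi> (hscale K c x)"
    and "\<lbrakk>x \<in> hset K; y \<in> hset K\<rbrakk> \<Longrightarrow> hinner (transport \<phi> K) (\<phi> x) (\<phi> y) = hinner K x y"
    and "x \<in> hset K \<Longrightarrow> hnorm (transport \<phi> K) (\<phi> x) = hnorm K x"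
  using assms by (simp_all add: transport_def Let_def hnorm_def)

lemma transport_hilbert:
  fixes K :: "'k hilb" and \<phi> :: "'k \<Rightarrow> 'l"
  assumes K: "complex_hilbert_space K" and inj: "inj_on \<phi> (hset K)"
  shows "complex_hilbert_space (transport \<phi> K)"
proof -
  interpret complex_hilbert_space K by fact
  note [simp] = transport_simps[OF inj] zero_closed add_closed scale_closed
  have d [simp]: "hdist (transport \<phi> K) (\<phi> x) (\<phi> y) = hdist K x y"
    if "x \<in> hset K" "y \<in> hset K" for x y using that by (simp add: hdist_def)
  show ?thesis
  proof (unfold_locales; clarsimp simp del: d)
    fix X :: "nat \<Rightarrow> 'l" assume X: "\<And>n. X n \<in> \<phi> ` hset K"
      and C: "\<And>\<epsilon>. 0 < \<epsilon> \<Longrightarrow> \<exists>N. \<forall>m\<ge>N. \<forall>n\<ge>N. hdist (transport \<phi> K) (X m) (X n) < \<epsilon>"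
    have "\<forall>n. \<exists>y. y \<in> hset K \<and> X n = \<phi> y" using X by blast
    then obtain Y where Y: "\<And>n. Y n \<in> hset K" "\<And>n. X n = \<phi> (Y n)" by metis
    then obtain y where "y \<in> hset K" "(\<lambda>n. hdist K (Y n) y) \<longlonglongrightarrow> 0"
      using complete[of Y] C by auto
    then show "\<exists>x\<in>hset K. (\<lambda>n. hdist (transport \<phi> K) (X n) (\<phi> x)) \<longlonglongrightarrow> 0"
      using Y by (intro bexI[of _ y]) simp_all
  qed (auto simp: add_assoc add_zero add_minus scale_add_right scale_add_left
      scale_scale scale_one inner_add inner_scale inner_nonneg inner_eq_zeroD
      intro: add_comm inner_commute arg_cong[of _ _ \<phi>])
qed

theorem subnormalI:
  fixes H :: "'h hilb" and K :: "'k hilb"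
  assumes A: "bounded_operator H A" and ext: "normal_extension H A K N J"
  shows "subnormal H A"
proof -
  interpret complex_hilbert_space K using ext by (simp add: normal_extension_def)
  note [simp] = zero_closed add_closed scale_closed
  obtain N' where N': "bounded_operator K N'" "is_adjoint K N N'"
    and comm: "\<And>x. x \<in> hset K \<Longrightarrow> N (N' x) = N' (N x)" and N: "bounded_operator K N"
    using ext by (auto simp: normal_extension_def normal_operator_def)
  have NJ: "\<And>x. x \<in> hset H \<Longrightarrow> N (J x) = J (A x)"
    and J: "isometric_embedding H K J" using ext by (auto simp: normal_extension_def)
  have [simp]: "\<And>x. x \<in> hset H \<Longrightarrow> A x \<in> hset H" "\<And>x. x \<in> hset H \<Longrightarrow> J x \<in> hset K"
    "\<And>x. x \<in> hset K \<Longrightarrow> N x \<in> hset K" "\<And>x. x \<in> hset K \<Longrightarrow> N' x \<in> hset K"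
    using A N N'(1) J by (auto simp: bounded_operator_def isometric_embedding_def linear_map_def)
  have adj: "hinner K (N x) y = hinner K x (N' y)"
    if "x \<in> hset K" "y \<in> hset K" for x y using N'(2) that by (simp add: is_adjoint_def)
  have adj': "hinner K (N' x) y = hinner K x (N y)"
    if "x \<in> hset K" "y \<in> hset K" for x y
    using adj[OF that(2,1)] inner_commute that by (metis \<open>\<And>x. x \<in> hset K \<Longrightarrow> N x \<in> hset K\<close>
        \<open>\<And>x. x \<in> hset K \<Longrightarrow> N' x \<in> hset K\<close>)
  define g where "g h j = (N' ^^ j) (J h)" for h :: 'h and j
  have g [simp]: "g h j \<in> hset K" if "h \<in> hset H" for h j
    unfolding g_def using that by (induction j) simp_all
  have N'g: "N' (g h j) = g h (Suc j)" for h j by (simp add: g_def)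
  have Ng: "N (g h j) = g (A h) j" if "h \<in> hset H" for h j
  proof (induction j)
    case 0 then show ?case using that by (simp add: g_def NJ)
  next
    case (Suc j)
    then show ?case using comm[OF g[OF that, of j]] that by (simp add: N'g[symmetric])
  qed
  define P where "P = {y \<in> hset K. \<forall>h\<in>hset H. \<forall>j. hinner K (g h j) y = 0}"
  define M where "M = {x \<in> hset K. \<forall>y\<in>P. hinner K x y = 0}"
  have PK: "y \<in> hset K" if "y \<in> P" for y using that by (simp add: P_def)
  have MK: "x \<in> hset K" if "x \<in> M" for x using that by (simp add: M_def)
  have "N y \<in> P" "N' y \<in> P" if "y \<in> P" for y
    using that by (auto simp: P_def N'g Ng simp flip: adj adj')
  then have NM [simp]: "N x \<in> M" "N' x \<in> M" if "x \<in> M" for x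
    using that PK by (auto simp: M_def adj adj')
  have JM [simp]: "J h \<in> M" if "h \<in> hset H" for h
    using that g[OF that, of 0] by (auto simp: M_def P_def g_def dest!: bspec[OF _ that] spec[of _ 0])
  define L where "L = K\<lparr>hset := M\<rparr>"
  have L: "complex_hilbert_space L" unfolding L_def
  proof (rule closed_subspace_hilbert)
    fix X x assume X: "\<And>n. X n \<in> M" and x: "x \<in> hset K" and lim: "(\<lambda>n. hdist K (X n) x) \<longlonglongrightarrow> 0"
    have "hinner K x y = 0" if y: "y \<in> P" for y
    proof -
      have "cmod (hinner K x y) \<le> hdist K (X n) x * hnorm K y" for n
      proof -
        have Xn: "X n \<in> hset K" "hinner K (X n) y = 0" using X[of n] y by (auto simp: M_def)
        have "hinner K (hadd K (X n) (hscale K (- 1) x)) y = - hinner K x y"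
          using Xn x PK[OF y] by (simp add: inner_add inner_scale)
        then show ?thesis
          using cauchy_schwarz[of "hadd K (X n) (hscale K (- 1) x)" y] Xn x PK[OF y]
          by (simp add: hdist_def)
      qed
      moreover have "(\<lambda>n. hdist K (X n) x * hnorm K y) \<longlonglongrightarrow> 0" using lim by (simp add: tendsto_mult_left_zero)
      ultimately have "cmod (hinner K x y) \<le> 0"
        using LIMSEQ_le_const by blast
      then show ?thesis by simp
    qed
    then show "x \<in> M" using x by (simp add: M_def)
  qed (auto simp: M_def PK inner_zero_left inner_add inner_scale)
  have [simp]: "hset L = M" "hadd L = hadd K" "hscale L = hscale K" "hinner L = hinner K"
    "hnorm L = hnorm K"
    by (auto simp: L_def hnorm_def)
  define \<phi> :: "'k \<Rightarrow> 'h \<times> nat \<Rightarrow> complex"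
    where "\<phi> x = (\<lambda>(h, j). if h \<in> hset H then hinner K (g h j) x else 0)" for x
  have inj: "inj_on \<phi> (hset L)"
  proof (rule inj_onI)
    fix x y assume "x \<in> hset L" "y \<in> hset L" and eq: "\<phi> x = \<phi> y"
    then have xy: "x \<in> M" "y \<in> M" by simp_all
    let ?z = "hadd K x (hscale K (- 1) y)"
    have z: "?z \<in> M"
      using complex_hilbert_space.add_closed[OF L] complex_hilbert_space.scale_closed[OF L] xy
      by simp
    have "hinner K (g h j) ?z = 0" if "h \<in> hset H" for h j
      using fun_cong[OF eq, of "(h, j)"] that xy MK
      by (simp add: \<phi>_def inner_add_right inner_scale_right)
    then have "?z \<in> P" using z MK by (simp add: P_def)
    with z have "hinner K ?z ?z = 0" unfolding M_def by blast
    then have z0: "?z = hzero K" using inner_eq_zeroD[OF MK[OF z]] by blast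
    have "x = hadd K x (hadd K (hscale K (- 1) y) y)"
      using MK[OF xy(1)] MK[OF xy(2)] by (metis add_comm add_minus add_zero scale_closed)
    also have "\<dots> = hadd K ?z y" using MK[OF xy(1)] MK[OF xy(2)] by (simp add: add_assoc)
    also have "\<dots> = y" using z0 MK[OF xy(2)] by (metis add_comm add_zero zero_closed)
    finally show "x = y" .
  qed
  define \<psi> where "\<psi> = inv_into M \<phi>"
  have \<psi> [simp]: "\<psi> (\<phi> x) = x" if "x \<in> M" for x using inj that by (simp add: \<psi>_def)
  note L_ops = L[THEN complex_hilbert_space.add_closed] L[THEN complex_hilbert_space.scale_closed]
  note [simp] = transport_simps[OF inj] L_ops[simplified]
  let ?T = "transport \<phi> L"
  have op: "bounded_operator ?T (\<lambda>x. \<phi> (B (\<psi> x)))"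
    if B: "bounded_operator K B" and BM: "\<And>x. x \<in> M \<Longrightarrow> B x \<in> M" for B
  proof -
    obtain C where "\<And>x. x \<in> hset K \<Longrightarrow> hnorm K (B x) \<le> C * hnorm K x"
      using B by (auto simp: bounded_operator_def)
    then have "\<forall>x\<in>M. hnorm ?T (\<phi> (B x)) \<le> C * hnorm ?T (\<phi> x)"
      using BM MK by simp
    then have "\<exists>C. \<forall>x\<in>hset ?T. hnorm ?T (\<phi> (B (\<psi> x))) \<le> C * hnorm ?T x" by auto
    then show ?thesis
      using B BM MK by (auto simp: bounded_operator_def linear_map_def)
  qed
  have "normal_extension H A ?T (\<lambda>x. \<phi> (N (\<psi> x))) (\<lambda>h. \<phi> (J h))"
    unfolding normal_extension_def normal_operator_def
  proof (intro conjI exI[of _ "\<lambda>x. \<phi> (N' (\<psi> x))"])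
    show "complex_hilbert_space ?T" using transport_hilbert[OF L inj] .
    show "is_adjoint ?T (\<lambda>x. \<phi> (N (\<psi> x))) (\<lambda>x. \<phi> (N' (\<psi> x)))"
      using adj MK by (auto simp: is_adjoint_def)
    show "isometric_embedding H ?T (\<lambda>h. \<phi> (J h))"
      using J by (auto simp: isometric_embedding_def linear_map_def)
  qed (use op N N'(1) comm MK NJ in auto)
  then show ?thesis using A by (auto simp: subnormal_def)
qed


section \<open>Directed trees\<close>

definition is_root :: "'v set \<Rightarrow> ('v \<times> 'v) set \<Rightarrow> 'v \<Rightarrow> bool" where
  "is_root V E v \<longleftrightarrow> v \<in> V \<and> (\<nexists>u. (u, v) \<in> E)"

definition directed_tree :: "'v set \<Rightarrow> ('v \<times> 'v) set \<Rightarrow> bool" where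
  "directed_tree V E \<longleftrightarrow>
    V \<noteq> {} \<and> E \<subseteq> V \<times> V - Id \<and>
    (\<forall>u\<in>V. \<forall>v\<in>V. u \<noteq> v \<longrightarrow>
      (\<exists>p. 2 \<le> length p \<and> set p \<subseteq> V \<and> hd p = u \<and> last p = v \<and>
        (\<forall>j. Suc j < length p \<longrightarrow> (p ! j, p ! Suc j) \<in> E \<or> (p ! Suc j, p ! j) \<in> E))) \<and>
    \<not> (\<exists>p. 2 \<le> length p \<and> distinct p \<and>
        (\<forall>j. Suc j < length p \<longrightarrow> (p ! j, p ! Suc j) \<in> E) \<and> (last p, hd p) \<in> E) \<and>
    (\<forall>v\<in>V. \<not> is_root V E v \<longrightarrow> (\<exists>!u. (u, v) \<in> E))"

definition rootless :: "'v set \<Rightarrow> ('v \<times> 'v) set \<Rightarrow> bool" where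
  "rootless V E \<longleftrightarrow> \<not> (\<exists>v. is_root V E v)"

definition root_of :: "'v set \<Rightarrow> ('v \<times> 'v) set \<Rightarrow> 'v" where
  "root_of V E = (THE v. is_root V E v)"

definition nonroots :: "'v set \<Rightarrow> ('v \<times> 'v) set \<Rightarrow> 'v set" where
  "nonroots V E = {v \<in> V. \<not> is_root V E v}"

definition Chi :: "('v \<times> 'v) set \<Rightarrow> 'v \<Rightarrow> 'v set" where
  "Chi E u = {v. (u, v) \<in> E}"

text \<open>The parent of a root is an unspecified value, hence the explicit requirement in
  \<open>par_power\<close> that the iterated parent be defined.\<close>

definition par :: "('v \<times> 'v) set \<Rightarrow> 'v \<Rightarrow> 'v" where
  "par E v = (THE u. (u, v) \<in> E)"

definition par_power :: "'v set \<Rightarrow> ('v \<times> 'v) set \<Rightarrow> nat \<Rightarrow> 'v \<Rightarrow> 'v \<Rightarrow> bool" where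
  "par_power V E n v u \<longleftrightarrow> (\<forall>j<n. (par E ^^ j) v \<in> nonroots V E) \<and> (par E ^^ n) v = u"

definition Des :: "'v set \<Rightarrow> ('v \<times> 'v) set \<Rightarrow> 'v \<Rightarrow> 'v set" where
  "Des V E u = {v \<in> V. \<exists>n. par_power V E n v u}"

definition Des_edges :: "'v set \<Rightarrow> ('v \<times> 'v) set \<Rightarrow> 'v \<Rightarrow> ('v \<times> 'v) set" where
  "Des_edges V E u = E \<inter> (Des V E u \<times> Des V E u)"

definition root_distance :: "'v set \<Rightarrow> ('v \<times> 'v) set \<Rightarrow> 'v \<Rightarrow> nat" where
  "root_distance V E v = (THE k. 0 < k \<and> par_power V E k v (root_of V E))"


section \<open>Weighted shifts\<close>

text \<open>Functions on \<open>V\<close> are represented by functions on the whole type that vanish off \<open>V\<close>; thus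
  \<open>\<ell>\<^sup>2(W)\<close> is literally a subspace of \<open>\<ell>\<^sup>2(V)\<close> for \<open>W \<subseteq> V\<close>.\<close>

definition ell2 :: "'v set \<Rightarrow> ('v \<Rightarrow> complex) hilb" where
  "ell2 V =
    \<lparr>hset = {f. (\<forall>v. v \<notin> V \<longrightarrow> f v = 0) \<and> (\<lambda>v. (cmod (f v))\<^sup>2) summable_on V},
     hzero = (\<lambda>v. 0),
     hadd = (\<lambda>f g v. f v + g v),
     hscale = (\<lambda>c f v. c * f v),
     hinner = (\<lambda>f g. \<Sum>\<^sub>\<infinity>v\<in>V. f v * cnj (g v))\<rparr>"

definition unit_vec :: "'v \<Rightarrow> 'v \<Rightarrow> complex" where
  "unit_vec u = (\<lambda>v. if v = u then 1 else 0)"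

definition wshift :: "'v set \<Rightarrow> ('v \<times> 'v) set \<Rightarrow> ('v \<Rightarrow> complex) \<Rightarrow> ('v \<Rightarrow> complex) \<Rightarrow> 'v \<Rightarrow> complex"
  where "wshift V E lam f = (\<lambda>v. if v \<in> nonroots V E then lam v * f (par E v) else 0)"

definition wshift_domain :: "'v set \<Rightarrow> ('v \<times> 'v) set \<Rightarrow> ('v \<Rightarrow> complex) \<Rightarrow> ('v \<Rightarrow> complex) set"
  where "wshift_domain V E lam = {f \<in> hset (ell2 V). wshift V E lam f \<in> hset (ell2 V)}"

definition shift_moments :: "'v set \<Rightarrow> ('v \<times> 'v) set \<Rightarrow> ('v \<Rightarrow> complex) \<Rightarrow> 'v \<Rightarrow> nat \<Rightarrow> real" where
  "shift_moments V E lam w n = (hnorm (ell2 V) ((wshift V E lam ^^ n) (unit_vec w)))\<^sup>2"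


section \<open>Stieltjes moment sequences\<close>

definition represents :: "real measure \<Rightarrow> (nat \<Rightarrow> real) \<Rightarrow> bool" where
  "represents M t \<longleftrightarrow> sets M = sets (restrict_space borel {0..}) \<and>
    (\<forall>n. has_bochner_integral M (\<lambda>s. s ^ n) (t n))"

definition stieltjes_moment_sequence :: "(nat \<Rightarrow> real) \<Rightarrow> bool" where
  "stieltjes_moment_sequence t \<longleftrightarrow> (\<exists>M. represents M t)"

definition shift_measure :: "'v set \<Rightarrow> ('v \<times> 'v) set \<Rightarrow> ('v \<Rightarrow> complex) \<Rightarrow> 'v \<Rightarrow> real measure" where
  "shift_measure V E lam w = (THE M. represents M (shift_moments V E lam w))"

text \<open>The sum over the children \<open>v\<close> of \<open>u\<close> of \<open>|\<lambda>\<^sub>v|\<^sup>2 \<integral> s\<^sup>-\<^sup>m d\<mu>\<^sub>v(s)\<close>, with values in \<open>[0,\<infinity>]\<close>;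
  in \<^typ>\<open>ennreal\<close>, \<open>1 / 0 = \<infinity>\<close>.\<close>

definition inverse_moment_sum ::
  "'v set \<Rightarrow> ('v \<times> 'v) set \<Rightarrow> ('v \<Rightarrow> complex) \<Rightarrow> 'v \<Rightarrow> nat \<Rightarrow> ennreal" where
  "inverse_moment_sum V E lam u m =
    (\<Sum>\<^sub>\<infinity>v\<in>Chi E u. ennreal ((cmod (lam v))\<^sup>2) *
      (\<integral>\<^sup>+ s. 1 / ennreal (s ^ m) \<partial>shift_measure V E lam v))"

end

theory Submission
  imports Defs "HOL-Probability.Probability"
begin

text \<open>If \<open>N\<close> is a normal extension of \<open>S\<close>, then \<open>\<parallel>S\<^sup>n f\<parallel>\<^sup>2 = \<parallel>N\<^sup>n f\<parallel>\<^sup>2\<close>, and the second differences of the rescaled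
  sequence are again of this form, with \<open>f - c\<^sup>-\<^sup>1 N* N f\<close> in place of \<open>f\<close>; so Hausdorff's theorem provides
  moment measures \<open>\<mu>\<^sub>u\<close> at all vertices. As these are unique, \<open>\<parallel>S\<^sup>n\<^sup>+\<^sup>1 e\<^sub>u\<parallel>\<^sup>2 = \<Sum>|\<lambda>\<^sub>v|\<^sup>2 \<parallel>S\<^sup>n e\<^sub>v\<parallel>\<^sup>2\<close> becomes
  \<open>s d\<mu>\<^sub>u = \<Sum>|\<lambda>\<^sub>v|\<^sup>2 d\<mu>\<^sub>v\<close> (sums over the children \<open>v\<close> of \<open>u\<close>), which expresses the negative moments at the
  branching vertex by those along the path above it and yields all the (in)equalities. Conversely, given
  these, put \<open>\<kappa>\<^sub>n\<^sub>,\<^sub>v = |\<lambda>\<^sub>v|\<^sup>2 s\<^sup>n\<^sup>-\<^sup>1 d\<mu>\<^sub>v\<close> for \<open>n \<in> \<int>\<close> and \<open>v\<close> a child of \<open>\<omega>\<close>. Then \<open>f(n, v, s) \<mapsto> f(n - 1, v, s)\<close> is normal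
  on \<open>L\<^sup>2(\<Oplus> \<kappa>\<^sub>n\<^sub>,\<^sub>v)\<close>, with adjoint \<open>f(n, v, s) \<mapsto> s f(n + 1, v, s)\<close>, and extends \<open>S\<close> once \<open>e\<^sub>w\<close> is
  identified with a multiple of the indicator function of the levels occupied by \<open>w\<close>; an atom at \<open>s = 0\<close>
  makes up for a strict inequality at the root.\<close>

text \<open>The measures \<kappa> are forced. If moving a function down one level is to give it the
  squared norm \<open>\<integral> s |f|\<^sup>2\<close>, each level must be \<open>s\<close> times
  the one above it, so levels above \<omega> carry negative powers of \<open>s\<close>. All branches
  of a level \<open>- k\<close> together stand for the single vertex \<open>par^k(\<omega>)\<close>;
  their total mass, the right-hand side of (2), must therefore be the squared norm of the right
  multiple of its basis vector, which is the left-hand side. A deficit of mass can only be filled by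
  an atom at \<open>s = 0\<close>. The shifted function vanishes there, so the image of
  \<open>S f\<close> must vanish on that level too, and this happens at the root alone; hence an
  inequality at the root and equalities elsewhere. The necessity proof mirrors this:
  \<open>s d\<mu>\<close> of a parent has no atom at 0, so the measure of an only child has none
  either, and only the topmost measure may lose mass. Since \<open>V\<close> may be uncountable,
  sums over children and levels are integrals over counting measures. Uniqueness of the \<mu> rests
  on the geometric growth of moments of a bounded operator.\<close>

section \<open>Representing measures\<close>

lemma represents_space: "represents M t \<Longrightarrow> space M = {0..}"
  using sets_eq_imp_space_eq[of M "restrict_space borel {0..}"]
  by (simp add: represents_def space_restrict_space)

lemma represents_measurable:
  assumes "represents M t" "f \<in> borel_measurable borel"
  shows "f \<in> borel_measurable M"
proof -
  have "sets M = sets (restrict_space borel {0..})" using assms by (simp add: represents_def)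
  then show ?thesis
    using measurable_restrict_space1[OF assms(2), of "{0..}"] measurable_cong_sets by blast
qed

lemma represents_integrable: "represents M t \<Longrightarrow> integrable M (\<lambda>s. s ^ n)"
  and represents_integral: "represents M t \<Longrightarrow> (\<integral>s. s ^ n \<partial>M) = t n"
  by (auto simp: represents_def has_bochner_integral_iff)

lemma represents_nn_integral:
  assumes "represents M t"
  shows "(\<integral>\<^sup>+s. ennreal (s ^ n) \<partial>M) = ennreal (t n)"
proof -
  have "AE s in M. 0 \<le> s ^ n"
    using represents_space[OF assms] by (intro AE_I2) simp
  then show ?thesis
    using nn_integral_eq_integral[OF represents_integrable[OF assms]]
      represents_integral[OF assms] by metis
qed

text \<open>Lets moments be checked as nonnegative integrals, where sums and integrals may be
  interchanged freely; integrability then follows from finiteness of the values.\<close>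

lemma representsI:
  assumes M: "sets M = sets (restrict_space borel {0..})"
    and "\<And>n. (\<integral>\<^sup>+s. ennreal (s ^ n) \<partial>M) = ennreal (t n)" and "\<And>n. 0 \<le> t n"
  shows "represents M t"
proof -
  have sp: "space M = {0..}"
    using sets_eq_imp_space_eq[OF M] by (simp add: space_restrict_space)
  have "(\<lambda>s::real. s ^ n) \<in> borel_measurable M" for n
    using measurable_restrict_space1[of "\<lambda>s::real. s ^ n" borel borel "{0..}"]
      measurable_cong_sets[OF M refl] by auto
  moreover have "AE s in M. 0 \<le> s ^ n" for n using sp by (intro AE_I2) simp
  ultimately show ?thesis using assms unfolding represents_def
    by (blast intro: has_bochner_integral_nn_integral)
qed

lemma represents_finite: "represents M t \<Longrightarrow> finite_measure M"
  using represents_nn_integral[of M t 0] by (intro finite_measureI) (simp add: nn_integral_const)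

text \<open>Chebyshev's inequality for the power \<open>n\<close>: for \<open>c < d\<close> the set
  \<open>{d..}\<close> has measure at most \<open>a * (c / d) ^ n\<close> for every
  \<open>n\<close>, hence is null.\<close>

lemma represents_AE_le:
  fixes c :: real
  assumes M: "represents M t" and bd: "\<And>n. t n \<le> a * c ^ n" and c: "0 \<le> c"
  shows "AE s in M. s \<le> c"
proof -
  interpret finite_measure M using M by (rule represents_finite)
  note [measurable] = represents_measurable[OF M]
  have sp: "space M = {0..}" using M by (rule represents_space)
  have ne: "AE s in M. \<not> d \<le> s" if "c < d" for d
  proof -
    have d: "0 < d" using c that by simp
    have mb: "measure M {s\<in>space M. d \<le> s} \<le> a * (c / d) ^ n" for n
    proof -
      let ?A = "{s\<in>space M. d \<le> s}"
      have A: "?A \<in> sets M" by measurable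
      have "d ^ n * measure M ?A = (\<integral>s. d ^ n * indicator ?A s \<partial>M)"
        using A by simp
      also have "\<dots> \<le> (\<integral>s. s ^ n \<partial>M)"
      proof (rule integral_mono[OF _ represents_integrable[OF M]])
        show "integrable M (\<lambda>s. d ^ n * indicator ?A s)"
          using A by (intro integrable_mult_right integrable_real_indicator) (auto simp: emeasure_eq_measure)
        show "d ^ n * indicator ?A s \<le> s ^ n" if "s \<in> space M" for s
          using that d sp by (cases "s \<in> ?A") (auto simp: power_mono)
      qed
      also have "\<dots> \<le> a * c ^ n" using represents_integral[OF M] bd by simp
      finally show ?thesis using d by (simp add: field_simps power_divide)
    qed
    have "(\<lambda>n. a * (c / d) ^ n) \<longlonglongrightarrow> a * 0"
      using that c d by (intro tendsto_intros LIMSEQ_realpow_zero) auto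
    then have "measure M {s\<in>space M. d \<le> s} \<le> 0"
      using mb by (intro LIMSEQ_le_const[of _ 0 "measure M {s\<in>space M. d \<le> s}"]) auto
    then have "emeasure M {s\<in>space M. d \<le> s} = 0"
      using measure_nonneg[of M "{s\<in>space M. d \<le> s}"] by (simp add: emeasure_eq_measure)
    then show ?thesis by (subst AE_iff_measurable[OF _ refl]) auto
  qed
  have "AE s in M. \<forall>k. \<not> c + 1 / real (Suc k) \<le> s" unfolding AE_all_countable using ne by simp
  then show ?thesis
  proof eventually_elim
    case (elim s)
    show ?case
    proof (rule ccontr)
      assume "\<not> s \<le> c"
      then obtain k where "1 / real (Suc k) < s - c"
        using reals_Archimedean[of "s - c"] by (auto simp: inverse_eq_divide)
      then show False using elim[rule_format, of k] by simp
    qed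
  qed
qed

text \<open>Both measures live on \<open>{0..c}\<close>, where polynomials are uniformly dense in
  the continuous functions. So they agree on bounded continuous functions, and then, through a limit
  of ramps, on the half-lines \<open>{x<..}\<close>.\<close>

lemma represents_unique:
  fixes c :: real
  assumes M: "represents M t" and N: "represents N t"
    and bd: "\<And>n. t n \<le> a * c ^ n" and c: "0 \<le> c"
  shows "M = N"
proof -
  have cont: "(\<integral>s. f s \<partial>M) = (\<integral>s. f s \<partial>N)" if f: "continuous_on UNIV f" and
    fb: "\<And>x. \<bar>f x\<bar> \<le> 1" for f :: "real \<Rightarrow> real"
  proof -
    have [simp]: "f \<in> borel_measurable M" "f \<in> borel_measurable N"
      using f M N by (auto intro!: represents_measurable borel_measurable_continuous_onI)
    have le_e: "\<bar>(\<integral>s. f s \<partial>M) - (\<integral>s. f s \<partial>N)\<bar> \<le> e" if e: "0 < e" for e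
    proof -
      have t0: "0 \<le> t 0" by (subst represents_integral[OF M, of 0, symmetric]) simp
      \<comment> \<open>Replacing \<open>f\<close> by the polynomial changes each of the two
        integrals by at most \<open>d * t 0\<close>; the summand 1 keeps the denominator positive
        when \<open>t 0 = 0\<close>.\<close>
      define d where "d = e / (2 * (t 0 + 1))"
      have d: "0 < d" using e t0 by (simp add: d_def)
      obtain g where g: "real_polynomial_function g" "\<And>x. x \<in> {0..c} \<Longrightarrow> \<bar>f x - g x\<bar> < d"
        using Stone_Weierstrass_real_polynomial_function[of "{0..c}" f d] d
          continuous_on_subset[OF f] by auto
      then obtain b m where b: "g = (\<lambda>x. \<Sum>i\<le>m. b i * x ^ i)"
        using real_polynomial_function_iff_sum by auto
      have near: "\<bar>(\<integral>s. f s \<partial>L) - (\<Sum>i\<le>m. b i * t i)\<bar> \<le> d * t 0" if L: "represents L t" for L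
      proof -
        interpret L: finite_measure L using L by (rule represents_finite)
        note [simp] = represents_integrable[OF L] represents_integral[OF L]
        have fm: "f \<in> borel_measurable L"
          using f L by (auto intro!: represents_measurable borel_measurable_continuous_onI)
        have fi: "integrable L f" using fm fb by (intro L.integrable_const_bound[of _ 1]) auto
        have gi: "integrable L g" unfolding b by simp
        have "(\<Sum>i\<le>m. b i * t i) = (\<integral>s. g s \<partial>L)" unfolding b by simp
        then have "\<bar>(\<integral>s. f s \<partial>L) - (\<Sum>i\<le>m. b i * t i)\<bar> = \<bar>\<integral>s. f s - g s \<partial>L\<bar>"
          using fi gi by simp
        also have "\<dots> \<le> (\<integral>s. \<bar>f s - g s\<bar> \<partial>L)" by simp
        also have "\<dots> \<le> (\<integral>s. d * s ^ 0 \<partial>L)"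
        proof (rule integral_mono_AE)
          show "AE s in L. \<bar>f s - g s\<bar> \<le> d * s ^ 0"
            using represents_AE_le[OF L bd c] AE_space
            by eventually_elim (use g(2) represents_space[OF L] in \<open>auto intro: less_imp_le\<close>)
        qed (use fi gi in auto)
        also have "\<dots> = d * t 0" by (simp del: power_0)
        finally show ?thesis .
      qed
      have "2 * (d * t 0) \<le> e" using t0 e by (simp add: d_def field_simps)
      then show ?thesis using near[OF M] near[OF N] by linarith
    qed
    have "\<bar>(\<integral>s. f s \<partial>M) - (\<integral>s. f s \<partial>N)\<bar> \<le> 0"
    proof (rule field_le_epsilon)
      fix e :: real assume "0 < e"
      then show "\<bar>(\<integral>s. f s \<partial>M) - (\<integral>s. f s \<partial>N)\<bar> \<le> 0 + e" using le_e[of e] by linarith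
    qed
    then show ?thesis by linarith
  qed
  have em: "emeasure L {s\<in>space L. x < s} = ennreal (measure L {s\<in>space L. x < s})"
    if "represents L t" for L x
    using finite_measure.emeasure_eq_measure[OF represents_finite[OF that]] .
  have lim: "(\<lambda>k. \<integral>s. min 1 (real k * max 0 (s - x)) \<partial>L) \<longlonglongrightarrow> measure L {s\<in>space L. x < s}"
    if L: "represents L t" for L x
  proof -
    interpret L: finite_measure L using L by (rule represents_finite)
    note [measurable] = represents_measurable[OF L]
    have "(\<lambda>k. \<integral>s. min 1 (real k * max 0 (s - x)) \<partial>L) \<longlonglongrightarrow> (\<integral>s. indicator {s\<in>space L. x < s} s \<partial>L)"
    proof (rule integral_dominated_convergence[where w="\<lambda>_. 1"])
      show "AE s in L. (\<lambda>k. min 1 (real k * max 0 (s - x))) \<longlonglongrightarrow> indicator {s\<in>space L. x < s} s"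
      proof (rule AE_I2)
        fix s assume s: "s \<in> space L"
        show "(\<lambda>k. min 1 (real k * max 0 (s - x))) \<longlonglongrightarrow> indicator {s\<in>space L. x < s} s"
        proof (cases "x < s")
          case True
          obtain K where K: "1 / (s - x) < real K" using reals_Archimedean2 by blast
          have "min 1 (real k * max 0 (s - x)) = 1" if "K \<le> k" for k
          proof -
            have "1 / (s - x) < real k" using K that by linarith
            then show ?thesis using True by (simp add: field_simps)
          qed
          then show ?thesis using s True
            by (intro tendsto_eventually) (auto simp: eventually_sequentially)
        qed simp
      qed
    qed auto
    then show ?thesis by simp
  qed
  have eq: "emeasure M {s\<in>space M. x < s} = emeasure N {s\<in>space N. x < s}" for x
  proof -
    have "(\<integral>s. min 1 (real k * max 0 (s - x)) \<partial>M) = (\<integral>s. min 1 (real k * max 0 (s - x)) \<partial>N)" for k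
      by (intro cont continuous_intros) auto
    then show ?thesis using lim[OF M, of x] lim[OF N, of x] LIMSEQ_unique em[OF M] em[OF N] by auto
  qed
  have di: "emeasure (distr L borel (\<lambda>s. s)) {x<..} = emeasure L {s\<in>space L. x < s}"
    if "represents L t" for L and x :: real
  proof -
    have "(\<lambda>s. s) -` {x<..} \<inter> space L = {s\<in>space L. x < s}" by auto
    then show ?thesis using represents_measurable[OF that, of "\<lambda>s. s"]
      by (subst emeasure_distr) simp_all
  qed
  \<comment> \<open>The measures live on a restricted space; they are pushed forward to the Borel
    sets of the whole line, where half-lines determine a measure.\<close>
  have MN: "distr M borel (\<lambda>s. s) = distr N borel (\<lambda>s. s)"
  proof (rule measure_eqI_lessThan)
    show "emeasure (distr M borel (\<lambda>s. s)) {x<..} < \<infinity>" for x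
      unfolding di[OF M] em[OF M] by simp
    show "emeasure (distr M borel (\<lambda>s. s)) {x<..} = emeasure (distr N borel (\<lambda>s. s)) {x<..}" for x
      unfolding di[OF M] di[OF N] by (rule eq)
  qed auto
  have MS: "sets M = sets (restrict_space borel {0..})" "sets N = sets (restrict_space borel {0..})"
    using M N by (auto simp: represents_def)
  show ?thesis
  proof (rule measure_eqI)
    fix A assume A: "A \<in> sets M"
    then have "A \<in> sets borel" "A \<subseteq> {0..}" by (auto simp: MS sets_restrict_space)
    then have "emeasure (distr L borel (\<lambda>s. s)) A = emeasure L A" if "represents L t" for L
      using represents_measurable[OF that, of "\<lambda>s. s"] represents_space[OF that]
      by (subst emeasure_distr) (auto simp: Int_absorb2)
    from this[OF M] this[OF N] show "emeasure M A = emeasure N A" using MN by simp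
  qed (simp add: MS)
qed


section \<open>Measures on the unit interval from nonnegative iterated differences\<close>

section \<open>The Hausdorff moment problem\<close>

text \<open>If \<open>b n\<close> is the integral of \<open>x ^ n\<close>, this is the integral of
  \<open>x ^ n * (1 - x) ^ m\<close>, which is nonnegative for a measure on the unit
  interval.\<close>

primrec backward_difference :: "nat \<Rightarrow> (nat \<Rightarrow> real) \<Rightarrow> nat \<Rightarrow> real" where
  "backward_difference 0 b n = b n"
| "backward_difference (Suc m) b n = backward_difference m b n - backward_difference m b (Suc n)"

text \<open>The integrated form of \<open>x ^ n * (x + (1 - x)) ^ r = x ^ n\<close>; algebraically
  an induction by Pascal's rule.\<close>

lemma binomial_sum_backward_difference:
  "(\<Sum>j\<le>r. real (r choose j) * backward_difference (r - j) b (n + j)) = b n"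
proof (induction r)
  case (Suc r)
  let ?D = "backward_difference"
  have "(\<Sum>j\<le>Suc r. real (Suc r choose j) * ?D (Suc r - j) b (n + j))
      = ?D (Suc r) b n + (\<Sum>j\<le>r. real (Suc r choose Suc j) * ?D (r - j) b (n + Suc j))"
    by (subst sum.atMost_Suc_shift) simp
  also have "(\<Sum>j\<le>r. real (Suc r choose Suc j) * ?D (r - j) b (n + Suc j))
      = (\<Sum>j\<le>r. real (r choose j) * ?D (r - j) b (Suc (n + j)))
        + (\<Sum>j\<le>r. real (r choose Suc j) * ?D (r - j) b (n + Suc j))"
    by (simp add: sum.distrib algebra_simps)
  also have "?D (Suc r) b n + ((\<Sum>j\<le>r. real (r choose j) * ?D (r - j) b (Suc (n + j)))
        + (\<Sum>j\<le>r. real (r choose Suc j) * ?D (r - j) b (n + Suc j)))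
     = (\<Sum>j\<le>r. real (r choose j) * ?D (r - j) b (Suc (n + j)))
        + (\<Sum>j\<le>Suc r. real (r choose j) * ?D (Suc r - j) b (n + j))"
  proof -
    have "(\<Sum>j\<le>Suc r. real (r choose j) * ?D (Suc r - j) b (n + j))
        = ?D (Suc r) b n + (\<Sum>j\<le>r. real (r choose Suc j) * ?D (r - j) b (n + Suc j))"
      by (subst sum.atMost_Suc_shift) simp
    then show ?thesis by simp
  qed
  also have "(\<Sum>j\<le>Suc r. real (r choose j) * ?D (Suc r - j) b (n + j))
      = (\<Sum>j\<le>r. real (r choose j) * (?D (r - j) b (n + j) - ?D (r - j) b (Suc (n + j))))"
    by (simp add: Suc_diff_le)
  finally show ?case
    using Suc by (simp add: algebra_simps sum.distrib sum_subtractf)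
qed simp

lemma binomial_ratio_prod:
  assumes "n \<le> m"
  shows "real (k choose n) / real (m choose n) = (\<Prod>i<n. (real k - real i) / (real m - real i))"
  by (simp add: binomial_gbinomial gbinomial_prod_rev prod_dividef atLeast0LessThan)

text \<open>Compares power moments with factorial moments. Both quantities are products of
  \<open>n\<close> factors of modulus at most 1, so they differ by at most the sum of the
  differences of their factors.\<close>

lemma power_binomial_ratio_diff:
  assumes k: "k \<le> m" and m: "2 * n < m"
  shows "\<bar>(real k / real m) ^ n - real (k choose n) / real (m choose n)\<bar>
    \<le> (real n)\<^sup>2 / (real m - real n)"
proof -
  have nm: "n \<le> m" using m by simp
  have "norm ((\<Prod>i<n. real k / real m) - (\<Prod>i<n. (real k - real i) / (real m - real i)))
    \<le> (\<Sum>i<n. norm (real k / real m - (real k - real i) / (real m - real i)))"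
  proof (rule norm_prod_diff)
    fix i assume "i \<in> {..<n}"
    \<comment> \<open>For \<open>k < i\<close> the numerator is negative; its modulus is at most
      \<open>i\<close>, and \<open>2 * n < m\<close> keeps that below \<open>m - i\<close>.\<close>
    then show "norm ((real k - real i) / (real m - real i)) \<le> 1"
      using k m by (auto simp: abs_le_iff field_simps)
  qed (use k m in auto)
  also have "\<dots> \<le> (\<Sum>i<n. real n / (real m - real n))"
  proof (rule sum_mono)
    fix i assume "i \<in> {..<n}"
    then have i: "real i < real n" "real i < real m" "0 < real m" using m by auto
    have "real k / real m - (real k - real i) / (real m - real i)
        = real i / (real m - real i) * (1 - real k / real m)"
      using i by (simp add: field_simps)
    moreover have "real i / (real m - real i) * (1 - real k / real m) \<le> real n / (real m - real n) * 1"
      using i k m by (intro mult_mono frac_le) (auto simp: field_simps)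
    moreover have "0 \<le> real i / (real m - real i) * (1 - real k / real m)"
      using i k by (intro mult_nonneg_nonneg) (auto simp: field_simps)
    ultimately show "norm (real k / real m - (real k - real i) / (real m - real i)) \<le> real n / (real m - real n)"
      by (metis abs_of_nonneg mult.right_neutral real_norm_def)
  qed
  finally show ?thesis
    unfolding binomial_ratio_prod[OF nm] by (simp add: power2_eq_square)
qed

text \<open>Bernstein's approximation: the weights \<open>p m\<close> on the points
  \<open>k / m\<close> form a probability measure whose factorial moments are already
  \<open>b n\<close>, and a weak limit has these numbers as power moments. Truncating
  \<open>x\<close> to the unit interval turns the power into a bounded continuous function on the
  line, as weak convergence requires.\<close>

theorem hausdorff_moment:
  assumes nn: "\<And>m n. 0 \<le> backward_difference m b n" and b0: "b 0 = 1"
  shows "\<exists>M. real_distribution M \<and> (\<forall>n. (\<integral>x. (max 0 (min 1 x)) ^ n \<partial>M) = b n)"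
proof -
  let ?D = "backward_difference"
  \<comment> \<open>The integral that the measure sought would give to the Bernstein polynomial
    \<open>(m choose k) * x ^ k * (1 - x) ^ (m - k)\<close>.\<close>
  define p where "p m k = real (m choose k) * ?D (m - k) b k" for m k
  have p0: "0 \<le> p m k" for m k using nn by (simp add: p_def)
  have p1: "(\<Sum>k\<le>m. p m k) = 1" for m
    using binomial_sum_backward_difference[of m b 0] b0 by (simp add: p_def)
  have factorial_moment: "(\<Sum>k\<le>m. p m k * (real (k choose n) / real (m choose n))) = b n"
    if nm: "n \<le> m" for n m
  proof -
    have "(\<Sum>k\<le>m. p m k * (real (k choose n) / real (m choose n)))
        = (\<Sum>k\<in>{n..m}. p m k * (real (k choose n) / real (m choose n)))"
      by (intro sum.mono_neutral_right) auto
    \<comment> \<open>Choosing \<open>n\<close> out of \<open>k\<close> out of \<open>m\<close> in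
      the other order removes the denominator and leaves the binomial identity of order
      \<open>m - n\<close>.\<close>
    also have "\<dots> = (\<Sum>k\<in>{n..m}. real ((m - n) choose (k - n)) * ?D (m - k) b k)"
    proof (rule sum.cong)
      fix k assume k: "k \<in> {n..m}"
      have "real (m choose k) * real (k choose n) = real (m choose n) * real ((m - n) choose (k - n))"
        using choose_mult[of n k m] k by (simp flip: of_nat_mult)
      moreover have "real (m choose n) \<noteq> 0" using nm by simp
      ultimately show "p m k * (real (k choose n) / real (m choose n)) = real ((m - n) choose (k - n)) * ?D (m - k) b k"
        by (simp add: p_def field_simps)
    qed simp
    also have "\<dots> = (\<Sum>j\<le>m - n. real ((m - n) choose j) * ?D (m - n - j) b (n + j))"
      by (rule sum.reindex_bij_witness[of _ "\<lambda>j. n + j" "\<lambda>k. k - n"]) (use nm in auto)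
    also have "\<dots> = b n" by (rule binomial_sum_backward_difference)
    finally show ?thesis .
  qed
  \<comment> \<open>\<open>Suc i\<close> instead of \<open>i\<close> keeps the mesh
    \<open>1 / Suc i\<close> defined for every index.\<close>
  define \<mu> where "\<mu> i = distr (point_measure {..Suc i} (p (Suc i))) borel (\<lambda>k. real k / real (Suc i))" for i
  have rd: "real_distribution (\<mu> i)" for i
  proof -
    interpret prob_space "point_measure {..Suc i} (p (Suc i))"
      by (rule prob_spaceI) (use p1[of "Suc i"] p0 in \<open>simp add: space_point_measure emeasure_point_measure_finite sum_ennreal del: sum.atMost_Suc\<close>)
    show ?thesis unfolding \<mu>_def by simp
  qed
  have int: "(\<integral>x. f x \<partial>\<mu> i) = (\<Sum>k\<le>Suc i. p (Suc i) k * f (real k / real (Suc i)))"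
    if "f \<in> borel_measurable borel" for f :: "real \<Rightarrow> real" and i
    unfolding \<mu>_def using that p0
    by (subst integral_distr) (auto simp: lebesgue_integral_point_measure_finite simp del: sum.atMost_Suc)
  have tight: "tight \<mu>"
    unfolding tight_def
  proof (intro conjI allI impI rd)
    fix e :: real assume e: "0 < e"
    \<comment> \<open>Tightness asks for half-open intervals; the left end -1 keeps the possible
      atom at 0 inside.\<close>
    have "measure (\<mu> i) {- 1<..1} = 1" for i
    proof -
      interpret real_distribution "\<mu> i" by (rule rd)
      have "measure (\<mu> i) {- 1<..1} = (\<integral>x. indicator {- 1<..1} x \<partial>\<mu> i)" by simp
      also have "\<dots> = (\<Sum>k\<le>Suc i. p (Suc i) k * indicator {- 1<..1} (real k / real (Suc i)))"
        by (rule int) simp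
      also have "\<dots> = (\<Sum>k\<le>Suc i. p (Suc i) k)"
        by (intro sum.cong) (auto simp: indicator_def field_simps)
      finally show ?thesis using p1[of "Suc i"] by simp
    qed
    then show "\<exists>a b. a < b \<and> (\<forall>n. 1 - e < measure (\<mu> n) {a<..b})"
      using e by (intro exI[of _ "- 1"] exI[of _ 1]) auto
  qed
  obtain r M where r: "strict_mono (r :: nat \<Rightarrow> nat)" and M: "real_distribution M"
    and wc: "weak_conv_m (\<mu> \<circ> (\<lambda>n. n) \<circ> r) M"
    using tight_imp_convergent_subsubsequence[OF tight, of "\<lambda>n. n"] by (auto simp: strict_mono_def)
  have "(\<integral>x. (max 0 (min 1 x)) ^ n \<partial>M) = b n" for n
  proof -
    define f where "f x = (max 0 (min 1 x)) ^ n" for x :: real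
    have fc: "continuous_on UNIV f" unfolding f_def by (intro continuous_intros)
    have "(\<lambda>i. \<integral>x. f x \<partial>(\<mu> \<circ> (\<lambda>n. n) \<circ> r) i) \<longlonglongrightarrow> (\<integral>x. f x \<partial>M)"
    proof (rule weak_conv_imp_integral_bdd_continuous_conv[OF _ M wc])
      show "isCont f x" for x using fc by (simp add: continuous_on_eq_continuous_at)
      show "norm (f x) \<le> 1" for x by (auto simp: f_def power_le_one)
    qed (use rd in auto)
    then have lim: "(\<lambda>i. \<integral>x. f x \<partial>\<mu> (r i)) \<longlonglongrightarrow> (\<integral>x. f x \<partial>M)" by simp
    have "(\<lambda>i. (\<integral>x. f x \<partial>\<mu> i) - b n) \<longlonglongrightarrow> 0"
    proof (rule Lim_null_comparison)
      show "(\<lambda>i. (real n)\<^sup>2 / (real (Suc i) - real n)) \<longlonglongrightarrow> 0" by real_asymp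
      show "\<forall>\<^sub>F i in sequentially. norm ((\<integral>x. f x \<partial>\<mu> i) - b n) \<le> (real n)\<^sup>2 / (real (Suc i) - real n)"
        using eventually_ge_at_top[of "2 * n"]
      proof eventually_elim
        case (elim i)
        have fm: "f \<in> borel_measurable borel" using fc by (rule borel_measurable_continuous_onI)
        let ?q = "\<lambda>k. real (k choose n) / real (Suc i choose n)"
        let ?C = "(real n)\<^sup>2 / (real (Suc i) - real n)"
        have "(\<integral>x. f x \<partial>\<mu> i) = (\<Sum>k\<le>Suc i. p (Suc i) k * (real k / real (Suc i)) ^ n)"
        proof (unfold int[OF fm], rule sum.cong)
          fix k assume "k \<in> {..Suc i}"
          then have "real k / real (Suc i) \<le> 1" by simp
          then have "max 0 (min 1 (real k / real (Suc i))) = real k / real (Suc i)" by simp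
          then show "p (Suc i) k * f (real k / real (Suc i)) = p (Suc i) k * (real k / real (Suc i)) ^ n"
            unfolding f_def by presburger
        qed simp
        moreover have "b n = (\<Sum>k\<le>Suc i. p (Suc i) k * ?q k)"
          using elim by (intro factorial_moment[symmetric]) simp
        ultimately have "(\<integral>x. f x \<partial>\<mu> i) - b n
            = (\<Sum>k\<le>Suc i. p (Suc i) k * ((real k / real (Suc i)) ^ n - ?q k))"
          unfolding right_diff_distrib sum_subtractf by (rule arg_cong2[where f = minus])
        then have "\<bar>(\<integral>x. f x \<partial>\<mu> i) - b n\<bar>
            = \<bar>\<Sum>k\<le>Suc i. p (Suc i) k * ((real k / real (Suc i)) ^ n - ?q k)\<bar>"
          by (rule arg_cong)
        also have "\<dots> \<le> (\<Sum>k\<le>Suc i. \<bar>p (Suc i) k * ((real k / real (Suc i)) ^ n - ?q k)\<bar>)"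
          by (rule sum_abs)
        also have "\<dots> \<le> (\<Sum>k\<le>Suc i. p (Suc i) k * ?C)"
        proof (rule sum_mono)
          fix k assume k: "k \<in> {..Suc i}"
          have "\<bar>(real k / real (Suc i)) ^ n - ?q k\<bar> \<le> ?C"
            using k elim by (intro power_binomial_ratio_diff) simp_all
          then show "\<bar>p (Suc i) k * ((real k / real (Suc i)) ^ n - ?q k)\<bar> \<le> p (Suc i) k * ?C"
            unfolding abs_mult abs_of_nonneg[OF p0] by (rule mult_left_mono) (rule p0)
        qed
        also have "\<dots> = ?C"
          unfolding sum_distrib_right[symmetric] p1 by (rule mult_1)
        finally show ?case by simp
      qed
    qed
    then have "(\<lambda>i. \<integral>x. f x \<partial>\<mu> i) \<longlonglongrightarrow> b n" by (simp add: LIM_zero_iff)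
    then have "(\<lambda>i. \<integral>x. f x \<partial>\<mu> (r i)) \<longlonglongrightarrow> b n"
      using LIMSEQ_subseq_LIMSEQ[OF _ r] by (fastforce simp: o_def)
    then show ?thesis using lim LIMSEQ_unique unfolding f_def by blast
  qed
  then show ?thesis using M by blast
qed

text \<open>Rescales \<open>{0..c}\<close> to the unit interval and normalises the total mass. If
  \<open>t 0 = 0\<close> no normalisation is possible, but then the differences of orders 0 and 1
  force every \<open>t n\<close> to be 0.\<close>

theorem stieltjes_moment_sequence_backward_difference:
  assumes nn: "\<And>m n. 0 \<le> backward_difference m (\<lambda>n. t n / c ^ n) n" and c: "0 < c"
  shows "stieltjes_moment_sequence t"
proof (cases "t 0 = 0")
  case True
  let ?b = "\<lambda>n. t n / c ^ n"
  have "?b n = 0" for n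
  proof (induction n)
    case (Suc n)
    show ?case using nn[of 0 "Suc n"] nn[of 1 n] Suc by simp
  qed (simp add: True)
  then have t0: "t n = 0" for n using c by (metis divide_eq_0_iff less_irrefl power_not_zero)
  have "(\<lambda>s::real. s ^ n) \<in> borel_measurable (restrict_space borel {0..})" for n
    by (intro measurable_restrict_space1) simp
  then have "represents (null_measure (restrict_space borel {0..})) t"
    unfolding represents_def has_bochner_integral_iff by (auto simp: t0)
  then show ?thesis by (auto simp: stieltjes_moment_sequence_def)
next
  case False
  have t0: "0 < t 0" using nn[of 0 0] False by simp
  define b where "b n = t n / c ^ n / t 0" for n
  have "backward_difference m b n = backward_difference m (\<lambda>n. t n / c ^ n) n / t 0" for m n
    by (induction m arbitrary: n) (simp_all add: b_def diff_divide_distrib)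
  then have "0 \<le> backward_difference m b n" for m n using nn t0 by simp
  moreover have "b 0 = 1" using t0 by (simp add: b_def)
  ultimately obtain P where P: "real_distribution P" "\<And>n. (\<integral>x. (max 0 (min 1 x)) ^ n \<partial>P) = b n"
    using hausdorff_moment by blast
  interpret real_distribution P by fact
  \<comment> \<open>The truncation sends all of \<open>P\<close> into the half line, wherever
    \<open>P\<close> itself is concentrated, and leaves the moments as computed.\<close>
  let ?g = "\<lambda>x. c * max 0 (min 1 x)"
  have g: "?g \<in> measurable P (restrict_space borel {0..})"
    using c by (intro measurable_restrict_space2) auto
  define M where "M = scale_measure (ennreal (t 0)) (distr P (restrict_space borel {0..}) ?g)"
  have int: "integrable P (\<lambda>x. t 0 * (?g x) ^ n)" for n
    using c by (intro integrable_mult_right integrable_const_bound[of _ "c ^ n"])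
      (auto intro!: AE_I2 power_mono simp: mult_left_le)
  have "represents M t"
  proof (rule representsI)
    show "sets M = sets (restrict_space borel {0..})" by (simp add: M_def)
    fix n
    have "(\<integral>\<^sup>+s. ennreal (s ^ n) \<partial>M) = ennreal (t 0) * (\<integral>\<^sup>+x. ennreal ((?g x) ^ n) \<partial>P)"
      unfolding M_def using g by (subst nn_integral_scale_measure) (auto simp: nn_integral_distr measurable_restrict_space1)
    also have "\<dots> = (\<integral>\<^sup>+x. ennreal (t 0 * (?g x) ^ n) \<partial>P)"
      using t0 by (simp add: ennreal_mult' nn_integral_cmult)
    also have "\<dots> = ennreal (\<integral>x. t 0 * (?g x) ^ n \<partial>P)"
      using int c t0 by (intro nn_integral_eq_integral) auto
    also have "(\<integral>x. t 0 * (?g x) ^ n \<partial>P) = t n"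
      using P(2)[of n] t0 c by (simp add: power_mult_distrib b_def)
    finally show "(\<integral>\<^sup>+s. ennreal (s ^ n) \<partial>M) = ennreal (t n)" .
    have "0 < c ^ n" using c by simp
    then show "0 \<le> t n" using nn[of 0 n] by (simp add: zero_le_divide_iff)
  qed
  then show ?thesis by (auto simp: stieltjes_moment_sequence_def)
qed


section \<open>Sums and direct sums of arbitrarily many measures\<close>

section \<open>Direct sums of measures\<close>

text \<open>Links the sums in \<open>inverse_moment_sum\<close> to integration theory. The delicate
  case is a simple function below \<open>f\<close> with infinite support: it has finitely many
  values, so some nonzero value is taken infinitely often and the sum is infinite.\<close>

lemma infsum_ennreal_eq_nn_integral:
  fixes f :: "'i \<Rightarrow> ennreal"
  shows "infsum f A = (\<integral>\<^sup>+i. f i \<partial>count_space A)"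
proof (rule antisym)
  have "sum f F \<le> (\<integral>\<^sup>+i. f i \<partial>count_space A)" if "finite F" "F \<subseteq> A" for F
  proof -
    have "sum f F = (\<integral>\<^sup>+i. f i * indicator F i \<partial>count_space A)"
      using that by (subst nn_integral_count_space'[of F]) auto
    also have "\<dots> \<le> (\<integral>\<^sup>+i. f i \<partial>count_space A)"
      by (intro nn_integral_mono) (auto simp: indicator_def)
    finally show ?thesis .
  qed
  then show "infsum f A \<le> (\<integral>\<^sup>+i. f i \<partial>count_space A)"
    by (subst nonneg_infsum_complete) (auto intro!: SUP_least)
next
  have sum_le: "sum f F \<le> infsum f A" if "finite F" "F \<subseteq> A" for F
    using that by (subst nonneg_infsum_complete) (auto intro!: SUP_upper)
  have "integral\<^sup>S (count_space A) g \<le> infsum f A"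
    if g: "simple_function (count_space A) g" "g \<le> f" for g
  proof (cases "finite {a\<in>A. g a \<noteq> 0}")
    case True
    have "integral\<^sup>S (count_space A) g = (\<integral>\<^sup>+a. g a \<partial>count_space A)"
      using g by (simp add: nn_integral_eq_simple_integral)
    also have "\<dots> = sum g {a\<in>A. g a \<noteq> 0}"
      using True by (intro nn_integral_count_space') auto
    also have "\<dots> \<le> sum f {a\<in>A. g a \<noteq> 0}" using g by (intro sum_mono) (simp add: le_fun_def)
    also have "\<dots> \<le> infsum f A" using True by (intro sum_le) auto
    finally show ?thesis .
  next
    case False
    let ?B = "{a\<in>A. g a \<noteq> 0}"
    have "finite (g ` ?B)" using g(1) by (simp add: finite_subset[OF image_mono[of ?B A]])
    then obtain y where y: "y \<in> g ` ?B" "infinite (g -` {y} \<inter> ?B)"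
      by (rule inf_img_fin_domE'[OF _ False])
    have "of_nat n * y \<le> infsum f A" for n
    proof -
      obtain F where F: "F \<subseteq> g -` {y} \<inter> ?B" "finite F" "card F = n"
        using infinite_arbitrarily_large[OF y(2)] by blast
      have "of_nat n * y = sum g F" using F by (subst sum.cong[of F F g "\<lambda>_. y"]) auto
      also have "\<dots> \<le> sum f F" using g by (intro sum_mono) (simp add: le_fun_def)
      also have "\<dots> \<le> infsum f A" using F by (intro sum_le) auto
      finally show ?thesis .
    qed
    then have "(SUP n. of_nat n * y) \<le> infsum f A" by (intro SUP_least) auto
    moreover have "(SUP n. of_nat n * y) = \<top>"
      using y by (auto simp: ennreal_SUP_of_nat_eq_top ennreal_top_mult simp flip: SUP_mult_right_ennreal)
    ultimately show ?thesis by (simp add: top_unique)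
  qed
  then show "(\<integral>\<^sup>+i. f i \<partial>count_space A) \<le> infsum f A"
    unfolding nn_integral_def by (auto intro!: SUP_least)
qed

text \<open>All sets with measurable sections are measurable, so that no countability of the index
  type is needed.\<close>

definition direct_sum_measure :: "'a measure \<Rightarrow> ('i \<Rightarrow> 'a measure) \<Rightarrow> ('i \<times> 'a) measure" where
  "direct_sum_measure N \<kappa> = measure_of (UNIV \<times> space N)
    {A. A \<subseteq> UNIV \<times> space N \<and> (\<forall>i. Pair i -` A \<in> sets N)}
    (\<lambda>A. \<integral>\<^sup>+i. emeasure (\<kappa> i) (Pair i -` A) \<partial>count_space UNIV)"

lemma direct_sum_sigma_algebra:
  "sigma_algebra (UNIV \<times> space N) {A. A \<subseteq> UNIV \<times> space N \<and> (\<forall>i. Pair i -` A \<in> sets N)}"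
proof (subst sigma_algebra_iff2, intro conjI ballI allI impI)
  fix A assume "A \<in> {A. A \<subseteq> UNIV \<times> space N \<and> (\<forall>i. Pair i -` A \<in> sets N)}"
  moreover have "Pair i -` (UNIV \<times> space N - A) = space N - Pair i -` A" for i by auto
  ultimately show "UNIV \<times> space N - A \<in> {A. A \<subseteq> UNIV \<times> space N \<and> (\<forall>i. Pair i -` A \<in> sets N)}"
    by auto
qed (auto simp: vimage_Union)

lemma space_direct_sum_measure [simp]: "space (direct_sum_measure N \<kappa>) = UNIV \<times> space N"
  unfolding direct_sum_measure_def by (rule space_measure_of) auto

lemma sets_direct_sum_measure:
  "sets (direct_sum_measure N \<kappa>) = {A. A \<subseteq> UNIV \<times> space N \<and> (\<forall>i. Pair i -` A \<in> sets N)}"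
  unfolding direct_sum_measure_def
  by (rule sigma_algebra.sets_measure_of_eq[OF direct_sum_sigma_algebra])

lemma measurable_direct_sum_measureI:
  assumes "\<And>i. (\<lambda>s. f (i, s)) \<in> measurable N L"
  shows "f \<in> measurable (direct_sum_measure N \<kappa>) L"
proof (rule measurableI)
  fix A assume A: "A \<in> sets L"
  have "Pair i -` (f -` A \<inter> space (direct_sum_measure N \<kappa>)) = (\<lambda>s. f (i, s)) -` A \<inter> space N" for i
    by auto
  then show "f -` A \<inter> space (direct_sum_measure N \<kappa>) \<in> sets (direct_sum_measure N \<kappa>)"
    using measurable_sets[OF assms A] by (auto simp: sets_direct_sum_measure)
qed (use measurable_space[OF assms] in auto)

lemma measurable_direct_sum_section:
  assumes "f \<in> measurable (direct_sum_measure N \<kappa>) L"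
  shows "(\<lambda>s. f (i, s)) \<in> measurable N L"
proof -
  have "Pair i \<in> measurable N (direct_sum_measure N \<kappa>)"
    by (rule measurableI) (auto simp: sets_direct_sum_measure Int_absorb2 dest: sets.sets_into_space)
  then show ?thesis using measurable_compose assms by blast
qed

context
  fixes N :: "'a measure" and \<kappa> :: "'i \<Rightarrow> 'a measure"
  assumes sets_\<kappa>: "\<And>i. sets (\<kappa> i) = sets N"
begin

lemma emeasure_direct_sum_measure:
  assumes A: "A \<in> sets (direct_sum_measure N \<kappa>)"
  shows "emeasure (direct_sum_measure N \<kappa>) A = (\<integral>\<^sup>+i. emeasure (\<kappa> i) (Pair i -` A) \<partial>count_space UNIV)"
proof (rule emeasure_measure_of[OF direct_sum_measure_def])
  show "countably_additive (sets (direct_sum_measure N \<kappa>))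
     (\<lambda>A. \<integral>\<^sup>+i. emeasure (\<kappa> i) (Pair i -` A) \<partial>count_space UNIV)"
  proof (rule countably_additiveI)
    fix F :: "nat \<Rightarrow> ('i \<times> 'a) set"
    assume F: "range F \<subseteq> sets (direct_sum_measure N \<kappa>)" "disjoint_family F"
    have "(\<Sum>n. \<integral>\<^sup>+i. emeasure (\<kappa> i) (Pair i -` F n) \<partial>count_space UNIV)
      = (\<integral>\<^sup>+i. (\<Sum>n. emeasure (\<kappa> i) (Pair i -` F n)) \<partial>count_space UNIV)"
      by (intro nn_integral_suminf[symmetric]) simp
    also have "\<dots> = (\<integral>\<^sup>+i. emeasure (\<kappa> i) (Pair i -` (\<Union>n. F n)) \<partial>count_space UNIV)"
    proof (rule nn_integral_cong)
      fix i
      have "Pair i -` F n \<in> sets (\<kappa> i)" for n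
        using F(1) by (auto simp: sets_direct_sum_measure sets_\<kappa>)
      then have "(\<Sum>n. emeasure (\<kappa> i) (Pair i -` F n)) = emeasure (\<kappa> i) (\<Union>n. Pair i -` F n)"
        using F(2) by (intro suminf_emeasure) (auto simp: disjoint_family_on_def)
      then show "(\<Sum>n. emeasure (\<kappa> i) (Pair i -` F n)) = emeasure (\<kappa> i) (Pair i -` (\<Union>n. F n))"
        by (simp add: vimage_UN)
    qed
    finally show "(\<Sum>n. \<integral>\<^sup>+i. emeasure (\<kappa> i) (Pair i -` F n) \<partial>count_space UNIV)
      = (\<integral>\<^sup>+i. emeasure (\<kappa> i) (Pair i -` (\<Union>n. F n)) \<partial>count_space UNIV)" .
  qed
qed (use A in \<open>auto simp: positive_def\<close>)

lemma measurable_direct_sum_summand: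
  assumes "f \<in> measurable (direct_sum_measure N \<kappa>) L"
  shows "(\<lambda>s. f (i, s)) \<in> measurable (\<kappa> i) L"
  using measurable_direct_sum_section[OF assms, of i] measurable_cong_sets[OF sets_\<kappa> refl] by blast

lemma nn_integral_direct_sum_measure:
  assumes f: "f \<in> borel_measurable (direct_sum_measure N \<kappa>)"
  shows "(\<integral>\<^sup>+x. f x \<partial>direct_sum_measure N \<kappa>) = (\<integral>\<^sup>+i. \<integral>\<^sup>+s. f (i, s) \<partial>\<kappa> i \<partial>count_space UNIV)"
  using f
proof (induction rule: borel_measurable_induct)
  case (cong f g)
  have "(\<integral>\<^sup>+s. f (i, s) \<partial>\<kappa> i) = (\<integral>\<^sup>+s. g (i, s) \<partial>\<kappa> i)" for i
    using cong(3) sets_eq_imp_space_eq[OF sets_\<kappa>] by (intro nn_integral_cong) auto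
  moreover have "(\<integral>\<^sup>+x. f x \<partial>direct_sum_measure N \<kappa>) = (\<integral>\<^sup>+x. g x \<partial>direct_sum_measure N \<kappa>)"
    using cong(3) by (intro nn_integral_cong) auto
  ultimately show ?case using cong(4) by simp
next
  case (set A)
  have "(\<integral>\<^sup>+s. indicator A (i, s) \<partial>\<kappa> i) = emeasure (\<kappa> i) (Pair i -` A)" for i
  proof -
    have "(\<lambda>s. indicator A (i, s) :: ennreal) = indicator (Pair i -` A)"
      by (auto simp: indicator_def)
    then show ?thesis using set by (simp add: sets_direct_sum_measure sets_\<kappa>)
  qed
  then show ?case using set by (simp add: emeasure_direct_sum_measure)
next
  case (mult u c)
  then show ?case
    by (simp add: nn_integral_cmult measurable_direct_sum_summand)
next
  case (add u v)
  then show ?case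
    by (simp add: nn_integral_add measurable_direct_sum_summand)
next
  case (seq U)
  have m: "(\<lambda>s. U n (i, s)) \<in> borel_measurable (\<kappa> i)" for n i
    using seq(1) by (rule measurable_direct_sum_summand)
  have "(\<integral>\<^sup>+x. (SUP n. U n) x \<partial>direct_sum_measure N \<kappa>) = (SUP n. \<integral>\<^sup>+x. U n x \<partial>direct_sum_measure N \<kappa>)"
    unfolding SUP_apply
    using seq by (intro nn_integral_monotone_convergence_SUP) auto
  also have "\<dots> = (SUP n. \<integral>\<^sup>+i. \<integral>\<^sup>+s. U n (i, s) \<partial>\<kappa> i \<partial>count_space UNIV)"
    using seq by simp
  also have "\<dots> = (\<integral>\<^sup>+i. (SUP n. \<integral>\<^sup>+s. U n (i, s) \<partial>\<kappa> i) \<partial>count_space UNIV)"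
    using seq(3) by (intro nn_integral_monotone_convergence_SUP[symmetric])
      (auto simp: incseq_def le_fun_def intro!: nn_integral_mono)
  also have "\<dots> = (\<integral>\<^sup>+i. \<integral>\<^sup>+s. (SUP n. U n (i, s)) \<partial>\<kappa> i \<partial>count_space UNIV)"
    using seq(3) m
    by (intro nn_integral_cong nn_integral_monotone_convergence_SUP[symmetric])
      (auto simp: incseq_def le_fun_def)
  finally show ?case by (simp add: image_comp)
qed

text \<open>Choose a null set in each summand. Their union is measurable because only sections
  count, and its measure is a sum of zeros, however many summands there are.\<close>

lemma AE_direct_sum_measureI:
  assumes "\<And>i. AE s in \<kappa> i. P (i, s)"
  shows "AE x in direct_sum_measure N \<kappa>. P x"
proof -
  have sp: "space (\<kappa> i) = space N" for i using sets_eq_imp_space_eq[OF sets_\<kappa>] .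
  have "\<exists>Z. Z \<in> sets N \<and> emeasure (\<kappa> i) Z = 0 \<and> {s \<in> space N. \<not> P (i, s)} \<subseteq> Z" for i
  proof -
    obtain Z where "{s \<in> space (\<kappa> i). \<not> P (i, s)} \<subseteq> Z" "emeasure (\<kappa> i) Z = 0" "Z \<in> sets (\<kappa> i)"
      using assms[of i] by (rule AE_E)
    then show ?thesis unfolding sp sets_\<kappa> by blast
  qed
  then have "\<exists>Z. \<forall>i. Z i \<in> sets N \<and> emeasure (\<kappa> i) (Z i) = 0 \<and> {s \<in> space N. \<not> P (i, s)} \<subseteq> Z i"
    by (intro choice allI)
  then obtain Z where Z: "\<And>i. Z i \<in> sets N" "\<And>i. emeasure (\<kappa> i) (Z i) = 0"
    "\<And>i. {s \<in> space N. \<not> P (i, s)} \<subseteq> Z i" by blast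
  have v: "Pair i -` Sigma UNIV Z = Z i" for i by auto
  have S: "Sigma UNIV Z \<in> sets (direct_sum_measure N \<kappa>)"
    using Z(1) sets.sets_into_space[OF Z(1)] by (auto simp: sets_direct_sum_measure v)
  show ?thesis
  proof (rule AE_I[OF _ _ S])
    show "{x \<in> space (direct_sum_measure N \<kappa>). \<not> P x} \<subseteq> Sigma UNIV Z"
      using Z(3) by auto
    show "emeasure (direct_sum_measure N \<kappa>) (Sigma UNIV Z) = 0"
      by (simp add: emeasure_direct_sum_measure[OF S] v Z(2))
  qed
qed

end


section \<open>Completeness of L2 and operators induced on it\<close>

section \<open>The Hilbert space of square integrable functions\<close>

definition square_integrable :: "'x measure \<Rightarrow> ('x \<Rightarrow> complex) \<Rightarrow> bool" where
  "square_integrable M f \<longleftrightarrow> f \<in> borel_measurable M \<and> integrable M (\<lambda>x. (cmod (f x))\<^sup>2)"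

lemma square_integrable_iff:
  "square_integrable M f \<longleftrightarrow>
    f \<in> borel_measurable M \<and> (\<integral>\<^sup>+x. ennreal ((cmod (f x))\<^sup>2) \<partial>M) < \<infinity>"
  by (auto simp: square_integrable_def integrable_iff_bounded)

lemma square_integrable_mult:
  assumes f: "square_integrable M f" and g: "square_integrable M g"
  shows "integrable M (\<lambda>x. f x * g x)"
proof (rule Bochner_Integration.integrable_bound)
  show "integrable M (\<lambda>x. (cmod (f x))\<^sup>2 + (cmod (g x))\<^sup>2)"
    using f g by (auto simp: square_integrable_def)
  have "cmod (f x) * cmod (g x) \<le> (cmod (f x))\<^sup>2 + (cmod (g x))\<^sup>2" for x
  proof -
    have "0 \<le> cmod (f x) * cmod (g x)" by simp
    with sum_squares_bound[of "cmod (f x)" "cmod (g x)"] show ?thesis by linarith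
  qed
  then show "AE x in M. norm (f x * g x) \<le> norm ((cmod (f x))\<^sup>2 + (cmod (g x))\<^sup>2)"
    by (simp add: norm_mult)
qed (use f g in \<open>auto simp: square_integrable_def\<close>)

lemma square_integrable_cnj: "square_integrable M f \<Longrightarrow> square_integrable M (\<lambda>x. cnj (f x))"
  by (auto simp: square_integrable_def intro: borel_measurable_continuous_on continuous_intros)

lemma square_integrable_add:
  assumes f: "square_integrable M f" and g: "square_integrable M g"
  shows "square_integrable M (\<lambda>x. f x + g x)"
proof -
  have m: "f \<in> borel_measurable M" "g \<in> borel_measurable M"
    using f g by (auto simp: square_integrable_def)
  have le: "(cmod (f x + g x))\<^sup>2 \<le> 2 * (cmod (f x))\<^sup>2 + 2 * (cmod (g x))\<^sup>2" for x
  proof -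
    have "(cmod (f x + g x))\<^sup>2 \<le> (cmod (f x) + cmod (g x))\<^sup>2"
      by (intro power_mono norm_triangle_ineq) simp
    also have "\<dots> \<le> 2 * (cmod (f x))\<^sup>2 + 2 * (cmod (g x))\<^sup>2"
      using sum_squares_bound[of "cmod (f x)" "cmod (g x)"] by (simp add: power2_sum)
    finally show ?thesis .
  qed
  have "integrable M (\<lambda>x. (cmod (f x + g x))\<^sup>2)"
  proof (rule Bochner_Integration.integrable_bound)
    show "integrable M (\<lambda>x. 2 * (cmod (f x))\<^sup>2 + 2 * (cmod (g x))\<^sup>2)"
      using f g unfolding square_integrable_def
      by (intro Bochner_Integration.integrable_add integrable_mult_right) auto
    show "AE x in M. norm ((cmod (f x + g x))\<^sup>2) \<le> norm (2 * (cmod (f x))\<^sup>2 + 2 * (cmod (g x))\<^sup>2)"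
      using le by (intro AE_I2) simp
  qed (use m in measurable)
  then show ?thesis using m by (simp add: square_integrable_def)
qed

lemma square_integrable_scale:
  "square_integrable M f \<Longrightarrow> square_integrable M (\<lambda>x. c * f x)"
  by (auto simp: square_integrable_def norm_mult power_mult_distrib)

lemma square_integrable_cong_AE:
  assumes "AE x in M. f x = g x" "g \<in> borel_measurable M" "square_integrable M f"
  shows "square_integrable M g"
proof -
  have "(\<integral>\<^sup>+x. ennreal ((cmod (f x))\<^sup>2) \<partial>M) = (\<integral>\<^sup>+x. ennreal ((cmod (g x))\<^sup>2) \<partial>M)"
    using assms(1) by (intro nn_integral_cong_AE) auto
  then show ?thesis using assms by (simp add: square_integrable_iff)
qed

definition L2_rep :: "'x measure \<Rightarrow> ('x \<Rightarrow> complex) \<Rightarrow> 'x \<Rightarrow> complex" where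
  "L2_rep M f = (SOME g. g \<in> borel_measurable M \<and> (AE x in M. g x = f x))"

lemma
  assumes "f \<in> borel_measurable M"
  shows L2_rep_measurable: "L2_rep M f \<in> borel_measurable M"
    and L2_rep_AE: "AE x in M. L2_rep M f x = f x"
  using someI[of "\<lambda>g. g \<in> borel_measurable M \<and> (AE x in M. g x = f x)" f] assms
  by (auto simp: L2_rep_def)

text \<open>The choice sees \<open>f\<close> only through a condition that holds almost everywhere,
  so equivalent functions get the same representative. This turns the vector space laws of
  \<open>L2 M\<close> into identities of functions.\<close>

lemma L2_rep_cong:
  assumes "AE x in M. f x = g x"
  shows "L2_rep M f = L2_rep M g"
proof -
  have "(AE x in M. h x = f x) \<longleftrightarrow> (AE x in M. h x = g x)" for h
    using assms by (auto elim: eventually_elim2)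
  then show ?thesis by (simp add: L2_rep_def)
qed

lemma L2_rep_rep: "f \<in> borel_measurable M \<Longrightarrow> L2_rep M (L2_rep M f) = L2_rep M f"
  by (intro L2_rep_cong L2_rep_AE)

lemma square_integrable_L2_rep: "square_integrable M f \<Longrightarrow> square_integrable M (L2_rep M f)"
  using square_integrable_cong_AE[of f "L2_rep M f" M] L2_rep_AE[of f M] L2_rep_measurable[of f M]
  by (auto simp: square_integrable_def eq_commute)

text \<open>Square integrable functions modulo null sets, each class being represented by the one of its
  members that is selected by \<^const>\<open>L2_rep\<close>.\<close>

definition L2 :: "'x measure \<Rightarrow> ('x \<Rightarrow> complex) hilb" where
  "L2 M = \<lparr>hset = {f. square_integrable M f \<and> L2_rep M f = f},
     hzero = L2_rep M (\<lambda>x. 0),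
     hadd = (\<lambda>f g. L2_rep M (\<lambda>x. f x + g x)),
     hscale = (\<lambda>c f. L2_rep M (\<lambda>x. c * f x)),
     hinner = (\<lambda>f g. \<integral>x. f x * cnj (g x) \<partial>M)\<rparr>"

lemma L2_simps:
  "hzero (L2 M) = L2_rep M (\<lambda>x. 0)"
  "hadd (L2 M) f g = L2_rep M (\<lambda>x. f x + g x)"
  "hscale (L2 M) c f = L2_rep M (\<lambda>x. c * f x)"
  "hinner (L2 M) f g = (\<integral>x. f x * cnj (g x) \<partial>M)"
  by (simp_all add: L2_def)

lemma hset_L2I: "square_integrable M f \<Longrightarrow> L2_rep M f \<in> hset (L2 M)"
  by (simp add: L2_def square_integrable_L2_rep L2_rep_rep square_integrable_iff[THEN iffD1])

lemma hset_L2D: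
  assumes "f \<in> hset (L2 M)"
  shows "square_integrable M f" "L2_rep M f = f" "f \<in> borel_measurable M"
  using assms by (auto simp: L2_def square_integrable_def)

lemma hnorm_L2:
  assumes "square_integrable M f"
  shows "0 \<le> hnorm (L2 M) f" "ennreal ((hnorm (L2 M) f)\<^sup>2) = (\<integral>\<^sup>+x. ennreal ((cmod (f x))\<^sup>2) \<partial>M)"
    "Re (hinner (L2 M) f f) = (\<integral>x. (cmod (f x))\<^sup>2 \<partial>M)"
proof -
  have "hinner (L2 M) f f = (\<integral>x. complex_of_real ((cmod (f x))\<^sup>2) \<partial>M)"
    by (simp add: L2_simps complex_norm_square flip: of_real_power)
  also have "\<dots> = complex_of_real (\<integral>x. (cmod (f x))\<^sup>2 \<partial>M)"
    by (rule integral_complex_of_real)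
  finally show r: "Re (hinner (L2 M) f f) = (\<integral>x. (cmod (f x))\<^sup>2 \<partial>M)" by simp
  then show "0 \<le> hnorm (L2 M) f" by (simp add: hnorm_def)
  have "(hnorm (L2 M) f)\<^sup>2 = (\<integral>x. (cmod (f x))\<^sup>2 \<partial>M)" by (simp add: hnorm_def r)
  then show "ennreal ((hnorm (L2 M) f)\<^sup>2) = (\<integral>\<^sup>+x. ennreal ((cmod (f x))\<^sup>2) \<partial>M)"
    using assms by (simp add: square_integrable_def nn_integral_eq_integral)
qed

lemma hdist_L2:
  assumes f: "square_integrable M f" and g: "square_integrable M g"
  shows "0 \<le> hdist (L2 M) f g"
    and "ennreal ((hdist (L2 M) f g)\<^sup>2) = (\<integral>\<^sup>+x. ennreal ((cmod (f x - g x))\<^sup>2) \<partial>M)"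
proof -
  note si = square_integrable_L2_rep square_integrable_add square_integrable_scale f g
  have m: "square_integrable M h \<Longrightarrow> h \<in> borel_measurable M" for h
    by (simp add: square_integrable_def)
  let ?d = "hadd (L2 M) f (hscale (L2 M) (- 1) g)"
  have d: "square_integrable M ?d" unfolding L2_simps by (intro si)
  then show "0 \<le> hdist (L2 M) f g" unfolding hdist_def by (rule hnorm_L2)
  have "AE x in M. ?d x = f x + L2_rep M (\<lambda>x. - 1 * g x) x"
    unfolding L2_simps by (intro L2_rep_AE m si)
  moreover have "AE x in M. L2_rep M (\<lambda>x. - 1 * g x) x = - 1 * g x"
    by (intro L2_rep_AE m si)
  ultimately have "AE x in M. ?d x = f x - g x" by eventually_elim simp
  then have "(\<integral>\<^sup>+x. ennreal ((cmod (?d x))\<^sup>2) \<partial>M) = (\<integral>\<^sup>+x. ennreal ((cmod (f x - g x))\<^sup>2) \<partial>M)"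
    by (intro nn_integral_cong_AE) auto
  then show "ennreal ((hdist (L2 M) f g)\<^sup>2) = (\<integral>\<^sup>+x. ennreal ((cmod (f x - g x))\<^sup>2) \<partial>M)"
    unfolding hdist_def hnorm_L2(2)[OF d] .
qed

text \<open>Riesz-Fischer. Along a subsequence with distances below \<open>(1 / 2) ^ k\<close>, the
  squared increments weighted by \<open>2 ^ k\<close> have a summable sequence of integrals; so at
  almost every point the increments decay geometrically. Fatou's lemma carries the Cauchy estimate
  over to the limit.\<close>

lemma L2_complete:
  assumes X: "\<And>n. square_integrable M (X n)"
    and C: "\<And>\<epsilon>. 0 < \<epsilon> \<Longrightarrow> \<exists>N. \<forall>m\<ge>N. \<forall>n\<ge>N. hdist (L2 M) (X m) (X n) < \<epsilon>"
  shows "\<exists>y. square_integrable M y \<and> (\<lambda>n. hdist (L2 M) (X n) y) \<longlonglongrightarrow> 0"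
proof -
  have Xm [measurable]: "X n \<in> borel_measurable M" for n using X by (simp add: square_integrable_def)
  have "\<exists>N. \<forall>m\<ge>N. \<forall>n\<ge>N. hdist (L2 M) (X m) (X n) < (1 / 2) ^ k" for k by (rule C) simp
  then obtain N where N: "\<And>k m n. N k \<le> m \<Longrightarrow> N k \<le> n \<Longrightarrow> hdist (L2 M) (X m) (X n) < (1 / 2) ^ k"
    by metis
  \<comment> \<open>Adding all thresholds up to \<open>k\<close> makes \<open>r\<close> monotone and
    at least \<open>N k\<close>; the summand \<open>k\<close> makes it tend to infinity.\<close>
  define r where "r k = k + (\<Sum>j\<le>k. N j)" for k
  have rN: "N k \<le> r k" for k using member_le_sum[of k "{..k}" N] by (simp add: r_def trans_le_add2)
  have rSuc: "r k \<le> r (Suc k)" for k by (simp add: r_def)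
  have rk: "k \<le> r k" for k by (simp add: r_def)
  define D where "D k x = (cmod (X (r (Suc k)) x - X (r k) x))\<^sup>2" for k x
  have Dm [measurable]: "D k \<in> borel_measurable M" for k unfolding D_def by measurable
  have Dint: "(\<integral>\<^sup>+x. ennreal (2 ^ k * D k x) \<partial>M) \<le> ennreal ((1 / 2) ^ k)" for k
  proof -
    let ?h = "hdist (L2 M) (X (r (Suc k))) (X (r k))"
    have "?h \<le> (1 / 2) ^ k"
      using N[of k "r (Suc k)" "r k"] rN[of k] rSuc[of k] by simp
    then have "2 ^ k * ?h\<^sup>2 \<le> 2 ^ k * ((1 / 2) ^ k)\<^sup>2"
      using hdist_L2(1)[OF X X] by (intro mult_left_mono power_mono) auto
    also have "\<dots> = (1 / 2) ^ k" by (simp add: power2_eq_square power_divide)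
    finally have le: "2 ^ k * ?h\<^sup>2 \<le> (1 / 2) ^ k" .
    have "(\<integral>\<^sup>+x. ennreal (2 ^ k * D k x) \<partial>M) = ennreal (2 ^ k) * (\<integral>\<^sup>+x. ennreal (D k x) \<partial>M)"
      by (simp add: ennreal_mult' nn_integral_cmult)
    also have "\<dots> = ennreal (2 ^ k) * ennreal (?h\<^sup>2)"
      unfolding D_def hdist_L2(2)[OF X X] ..
    also have "\<dots> = ennreal (2 ^ k * ?h\<^sup>2)" by (simp add: ennreal_mult')
    finally show ?thesis using le by (simp add: ennreal_leI)
  qed
  have "(\<integral>\<^sup>+x. (\<Sum>k. ennreal (2 ^ k * D k x)) \<partial>M) = (\<Sum>k. \<integral>\<^sup>+x. ennreal (2 ^ k * D k x) \<partial>M)"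
    by (rule nn_integral_suminf) simp
  also have "\<dots> \<le> (\<Sum>k. ennreal ((1 / 2) ^ k))" by (intro suminf_le Dint) auto
  also have "\<dots> = ennreal (\<Sum>k. (1 / 2) ^ k)"
    by (intro suminf_ennreal2) (auto intro: summable_geometric)
  also have "\<dots> < \<infinity>" by simp
  finally have "AE x in M. (\<Sum>k. ennreal (2 ^ k * D k x)) \<noteq> \<infinity>"
    by (intro nn_integral_noteq_infinite) auto
  then have conv: "AE x in M. convergent (\<lambda>k. X (r k) x)"
  proof eventually_elim
    case (elim x)
    then obtain B where B: "0 \<le> B" "(\<Sum>k. ennreal (2 ^ k * D k x)) = ennreal B"
      by (cases "\<Sum>k. ennreal (2 ^ k * D k x)") auto
    have dk: "cmod (X (r (Suc k)) x - X (r k) x) \<le> sqrt B * (1 / sqrt 2) ^ k" for k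
    proof -
      have "ennreal (2 ^ k * D k x) \<le> ennreal B"
        unfolding B(2)[symmetric] using sum_le_suminf[of "\<lambda>k. ennreal (2 ^ k * D k x)" "{k}"] by simp
      then have "2 ^ k * D k x \<le> B" using B(1) by (simp add: D_def)
      then have "D k x \<le> B * (1 / 2) ^ k" by (simp add: field_simps power_divide)
      then have "sqrt (D k x) \<le> sqrt (B * (1 / 2) ^ k)" by (rule real_sqrt_le_mono)
      then show ?thesis by (simp add: D_def real_sqrt_mult real_sqrt_power real_sqrt_divide)
    qed
    have "summable (\<lambda>k. sqrt B * (1 / sqrt 2) ^ k)"
      by (intro summable_mult summable_geometric) simp
    then have "summable (\<lambda>k. X (r (Suc k)) x - X (r k) x)"
      by (rule summable_comparison_test'[where N = 0]) (rule dk)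
    then have "convergent (\<lambda>n. \<Sum>k<n. X (r (Suc k)) x - X (r k) x)"
      by (simp add: summable_iff_convergent)
    then have "convergent (\<lambda>n. X (r n) x - X (r 0) x)"
      by (simp only: sum_lessThan_telescope[of "\<lambda>k. X (r k) x"])
    from convergent_add[OF this convergent_const[of "X (r 0) x"]] show ?case by simp
  qed
  define y where "y x = lim (\<lambda>k. X (r k) x)" for x
  have [measurable]: "y \<in> borel_measurable M" unfolding y_def by (intro borel_measurable_lim_metric) auto
  have near: "(\<integral>\<^sup>+x. ennreal ((cmod (X m x - y x))\<^sup>2) \<partial>M) \<le> ennreal (\<epsilon>\<^sup>2)"
    if m: "N0 \<le> m" and N0: "\<And>m n. N0 \<le> m \<Longrightarrow> N0 \<le> n \<Longrightarrow> hdist (L2 M) (X m) (X n) < \<epsilon>" for m N0 \<epsilon>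
  proof -
    have "(\<integral>\<^sup>+x. ennreal ((cmod (X m x - y x))\<^sup>2) \<partial>M)
      = (\<integral>\<^sup>+x. liminf (\<lambda>k. ennreal ((cmod (X m x - X (r k) x))\<^sup>2)) \<partial>M)"
    proof (rule nn_integral_cong_AE)
      show "AE x in M. ennreal ((cmod (X m x - y x))\<^sup>2)
        = liminf (\<lambda>k. ennreal ((cmod (X m x - X (r k) x))\<^sup>2))"
        using conv
      proof eventually_elim
        case (elim x)
        then have "(\<lambda>k. X (r k) x) \<longlonglongrightarrow> y x" by (simp add: y_def convergent_LIMSEQ_iff)
        then have "(\<lambda>k. ennreal ((cmod (X m x - X (r k) x))\<^sup>2)) \<longlonglongrightarrow> ennreal ((cmod (X m x - y x))\<^sup>2)"
          by (intro tendsto_ennrealI tendsto_intros)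
        then show ?case by (intro lim_imp_Liminf[symmetric]) auto
      qed
    qed
    also have "\<dots> \<le> liminf (\<lambda>k. \<integral>\<^sup>+x. ennreal ((cmod (X m x - X (r k) x))\<^sup>2) \<partial>M)"
      by (intro nn_integral_liminf) measurable
    also have "\<dots> \<le> limsup (\<lambda>k. \<integral>\<^sup>+x. ennreal ((cmod (X m x - X (r k) x))\<^sup>2) \<partial>M)"
      by (rule Liminf_le_Limsup) simp
    also have "\<dots> \<le> ennreal (\<epsilon>\<^sup>2)"
    proof (rule Limsup_bounded)
      show "\<forall>\<^sub>F k in sequentially. (\<integral>\<^sup>+x. ennreal ((cmod (X m x - X (r k) x))\<^sup>2) \<partial>M) \<le> ennreal (\<epsilon>\<^sup>2)"
        using eventually_ge_at_top[of N0]
      proof eventually_elim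
        case (elim k)
        have "hdist (L2 M) (X m) (X (r k)) < \<epsilon>" using m rk[of k] elim by (intro N0) auto
        then show ?case
          unfolding hdist_L2(2)[OF X X, symmetric]
          by (intro ennreal_leI power_mono) (auto intro: hdist_L2(1)[OF X X])
      qed
    qed
    finally show ?thesis .
  qed
  \<comment> \<open>The limit is square integrable because it differs from a single member of the
    sequence by a square integrable function.\<close>
  obtain N1 where N1: "\<And>m n. N1 \<le> m \<Longrightarrow> N1 \<le> n \<Longrightarrow> hdist (L2 M) (X m) (X n) < 1"
    using C[of 1] by auto
  have "(\<integral>\<^sup>+x. ennreal ((cmod (X N1 x - y x))\<^sup>2) \<partial>M) \<le> ennreal (1\<^sup>2)"
    by (rule near[OF order.refl N1])
  also have "\<dots> < \<infinity>" by simp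
  finally have "square_integrable M (\<lambda>x. X N1 x - y x)"
    by (simp add: square_integrable_iff)
  then have "square_integrable M (\<lambda>x. X N1 x + - 1 * (X N1 x - y x))"
    by (intro square_integrable_add X square_integrable_scale)
  then have y: "square_integrable M y" by (simp add: eta_contract_eq)
  have "(\<lambda>n. hdist (L2 M) (X n) y) \<longlonglongrightarrow> 0"
  proof (rule LIMSEQ_I)
    fix e :: real assume e: "0 < e"
    then obtain N2 where N2: "\<And>m n. N2 \<le> m \<Longrightarrow> N2 \<le> n \<Longrightarrow> hdist (L2 M) (X m) (X n) < e / 2"
      using C[of "e / 2"] by auto
    have half: "hdist (L2 M) (X m) y \<le> e / 2" if "N2 \<le> m" for m
    proof -
      have "ennreal ((hdist (L2 M) (X m) y)\<^sup>2) \<le> ennreal ((e / 2)\<^sup>2)"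
        unfolding hdist_L2(2)[OF X y] by (rule near[OF that N2])
      then have "(hdist (L2 M) (X m) y)\<^sup>2 \<le> (e / 2)\<^sup>2"
        by (subst (asm) ennreal_le_iff) (rule zero_le_power2)
      then show ?thesis by (rule power2_le_imp_le) (use e in simp)
    qed
    have "norm (hdist (L2 M) (X n) y - 0) < e" if "N2 \<le> n" for n
      using half[OF that] hdist_L2(1)[OF X y, of n] e by simp
    then show "\<exists>no. \<forall>n\<ge>no. norm (hdist (L2 M) (X n) y - 0) < e" by blast
  qed
  then show ?thesis using y by blast
qed

lemma L2_hilbert: "complex_hilbert_space (L2 M)"
proof -
  note si = square_integrable_L2_rep square_integrable_add square_integrable_scale
  have m: "square_integrable M h \<Longrightarrow> h \<in> borel_measurable M" for h
    by (simp add: square_integrable_def)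
  have z: "square_integrable M (\<lambda>x. 0)" by (simp add: square_integrable_def)
  have add_cong: "L2_rep M (\<lambda>x. L2_rep M f x + L2_rep M g x) = L2_rep M (\<lambda>x. f x + g x)"
    if "square_integrable M f" "square_integrable M g" for f g
    by (rule L2_rep_cong) (use L2_rep_AE[OF m[OF that(1)]] L2_rep_AE[OF m[OF that(2)]] in eventually_elim, simp)
  have scale_cong: "L2_rep M (\<lambda>x. c * L2_rep M f x) = L2_rep M (\<lambda>x. c * f x)"
    if "square_integrable M f" for f c
    by (rule L2_rep_cong) (use L2_rep_AE[OF m[OF that(1)]] in eventually_elim, simp)
  have ip: "integrable M (\<lambda>x. f x * cnj (g x))" if "square_integrable M f" "square_integrable M g" for f g
    using that by (intro square_integrable_mult square_integrable_cnj)
  have inner_cong: "(\<integral>x. L2_rep M f x * cnj (g x) \<partial>M) = (\<integral>x. f x * cnj (g x) \<partial>M)"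
    if "square_integrable M f" "square_integrable M g" for f g
  proof (rule integral_cong_AE)
    show "AE x in M. L2_rep M f x * cnj (g x) = f x * cnj (g x)"
      using L2_rep_AE[OF m[OF that(1)]] by eventually_elim simp
  qed (intro borel_measurable_integrable ip square_integrable_L2_rep that)+
  show ?thesis
  proof (unfold_locales, unfold L2_simps)
    fix x y z :: "'a \<Rightarrow> complex" assume "x \<in> hset (L2 M)" "y \<in> hset (L2 M)" "z \<in> hset (L2 M)"
    note xyz = hset_L2D[OF this(1)] hset_L2D[OF this(2)] hset_L2D[OF this(3)]
    show "L2_rep M (\<lambda>t. L2_rep M (\<lambda>t. x t + y t) t + z t) = L2_rep M (\<lambda>t. x t + L2_rep M (\<lambda>t. y t + z t) t)"
      using add_cong[of "\<lambda>t. x t + y t" z] add_cong[of x "\<lambda>t. y t + z t"] xyz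
      by (simp add: si add.assoc)
    show "(\<integral>t. L2_rep M (\<lambda>t. x t + y t) t * cnj (z t) \<partial>M) = (\<integral>t. x t * cnj (z t) \<partial>M) + (\<integral>t. y t * cnj (z t) \<partial>M)"
      using xyz by (simp add: inner_cong si distrib_right ip)
  next
    fix x y :: "'a \<Rightarrow> complex" and c assume "x \<in> hset (L2 M)" "y \<in> hset (L2 M)"
    note xy = hset_L2D[OF this(1)] hset_L2D[OF this(2)]
    show "L2_rep M (\<lambda>t. x t + y t) \<in> hset (L2 M)" using xy by (intro hset_L2I si)
    show "L2_rep M (\<lambda>t. x t + y t) = L2_rep M (\<lambda>t. y t + x t)" by (simp add: add.commute)
    show "L2_rep M (\<lambda>t. c * L2_rep M (\<lambda>t. x t + y t) t) = L2_rep M (\<lambda>t. L2_rep M (\<lambda>t. c * x t) t + L2_rep M (\<lambda>t. c * y t) t)"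
      using xy by (simp add: add_cong scale_cong si distrib_left)
    show "(\<integral>t. L2_rep M (\<lambda>t. c * x t) t * cnj (y t) \<partial>M) = c * (\<integral>t. x t * cnj (y t) \<partial>M)"
      using xy by (simp add: inner_cong si mult.assoc ip)
    show "(\<integral>t. x t * cnj (y t) \<partial>M) = cnj (\<integral>t. y t * cnj (x t) \<partial>M)"
    proof -
      have "(\<integral>t. x t * cnj (y t) \<partial>M) = (\<integral>t. cnj (y t * cnj (x t)) \<partial>M)" by (simp add: mult.commute)
      then show ?thesis by (rule trans) (rule Bochner_Integration.integral_cnj)
    qed
  next
    fix x :: "'a \<Rightarrow> complex" and c d assume "x \<in> hset (L2 M)"
    note x = hset_L2D[OF this(1)]
    show "L2_rep M (\<lambda>t. c * x t) \<in> hset (L2 M)" using x by (intro hset_L2I si)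
    show "L2_rep M (\<lambda>t. x t + L2_rep M (\<lambda>x. 0) t) = x" using add_cong[OF x(1) z] x by simp
    show "L2_rep M (\<lambda>t. x t + L2_rep M (\<lambda>t. - 1 * x t) t) = L2_rep M (\<lambda>x. 0)"
      using add_cong[OF x(1), of "\<lambda>t. - 1 * x t"] square_integrable_scale[OF x(1), of "- 1"] x(2) by simp
    show "L2_rep M (\<lambda>t. (c + d) * x t) = L2_rep M (\<lambda>t. L2_rep M (\<lambda>t. c * x t) t + L2_rep M (\<lambda>t. d * x t) t)"
      using x by (simp add: add_cong si distrib_right)
    show "L2_rep M (\<lambda>t. c * L2_rep M (\<lambda>t. d * x t) t) = L2_rep M (\<lambda>t. c * d * x t)"
      using x by (simp add: scale_cong si mult.assoc)
    show "L2_rep M (\<lambda>t. 1 * x t) = x" using x by simp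
    show "0 \<le> Re (\<integral>t. x t * cnj (x t) \<partial>M)"
      using hnorm_L2(3)[OF x(1)] by (simp add: L2_simps)
    assume "(\<integral>t. x t * cnj (x t) \<partial>M) = 0"
    then have "(\<integral>t. (cmod (x t))\<^sup>2 \<partial>M) = 0" using hnorm_L2(3)[OF x(1)] by (simp add: L2_simps)
    then have "AE t in M. (cmod (x t))\<^sup>2 = 0"
      using x(1) by (subst (asm) integral_nonneg_eq_0_iff_AE) (auto simp: square_integrable_def)
    then have "AE t in M. x t = 0" by eventually_elim simp
    from L2_rep_cong[OF this] show "x = L2_rep M (\<lambda>x. 0)" using x(2) by simp
  next
    fix X :: "nat \<Rightarrow> 'a \<Rightarrow> complex"
    assume X: "\<And>n. X n \<in> hset (L2 M)"
      and C: "\<And>\<epsilon>. 0 < \<epsilon> \<Longrightarrow> \<exists>N. \<forall>m\<ge>N. \<forall>n\<ge>N. hdist (L2 M) (X m) (X n) < \<epsilon>"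
    obtain y where y: "square_integrable M y" "(\<lambda>n. hdist (L2 M) (X n) y) \<longlonglongrightarrow> 0"
      using L2_complete[OF hset_L2D(1)[OF X] C] by blast
    have "hdist (L2 M) (X n) (L2_rep M y) = hdist (L2 M) (X n) y" for n
      unfolding hdist_def L2_simps scale_cong[OF y(1)] ..
    then show "\<exists>x\<in>hset (L2 M). (\<lambda>n. hdist (L2 M) (X n) x) \<longlonglongrightarrow> 0"
      using y by (intro bexI[of _ "L2_rep M y"]) (auto intro: hset_L2I)
  qed (auto intro: hset_L2I z)
qed

text \<open>\<open>T\<close> acts on functions, whereas \<open>L2 M\<close> consists of
  representatives of classes. The norm bound applied to \<open>f - g\<close> shows that
  \<open>T\<close> respects equality almost everywhere, and this is what makes the induced map
  linear.\<close>

lemma L2_bounded_operator: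
  assumes add: "\<And>f g. T (\<lambda>x. f x + g x) = (\<lambda>x. T f x + T g x)"
    and scale: "\<And>c f. T (\<lambda>x. c * f x) = (\<lambda>x. c * T f x)"
    and meas: "\<And>f. f \<in> borel_measurable M \<Longrightarrow> T f \<in> borel_measurable M"
    and bd: "\<And>f. f \<in> borel_measurable M \<Longrightarrow> (\<integral>\<^sup>+x. ennreal ((cmod (T f x))\<^sup>2) \<partial>M)
      \<le> ennreal C * (\<integral>\<^sup>+x. ennreal ((cmod (f x))\<^sup>2) \<partial>M)"
    and C: "0 \<le> C"
  shows L2_operator_cong: "\<lbrakk>f \<in> borel_measurable M; g \<in> borel_measurable M; AE x in M. f x = g x\<rbrakk>
      \<Longrightarrow> AE x in M. T f x = T g x"
    and "bounded_operator (L2 M) (\<lambda>f. L2_rep M (T f))"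
proof -
  have cong: "AE x in M. T f x = T g x"
    if f: "f \<in> borel_measurable M" and g: "g \<in> borel_measurable M" and fg: "AE x in M. f x = g x" for f g
  proof -
    let ?h = "\<lambda>x. f x + - 1 * g x"
    have hm: "?h \<in> borel_measurable M" using f g by simp
    have "(\<integral>\<^sup>+x. ennreal ((cmod (?h x))\<^sup>2) \<partial>M) = (\<integral>\<^sup>+x. 0 \<partial>M)"
      using fg by (intro nn_integral_cong_AE) auto
    then have "(\<integral>\<^sup>+x. ennreal ((cmod (T ?h x))\<^sup>2) \<partial>M) = 0" using bd[OF hm] by simp
    then have "AE x in M. ennreal ((cmod (T ?h x))\<^sup>2) = 0"
      using meas[OF hm] by (subst (asm) nn_integral_0_iff_AE) auto
    then have "AE x in M. T ?h x = 0" by eventually_elim simp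
    moreover have "T ?h = (\<lambda>x. T f x + - 1 * T g x)"
      using add[of f "\<lambda>x. - 1 * g x"] scale[of "- 1" g] by simp
    ultimately show ?thesis by simp
  qed
  then show "\<lbrakk>f \<in> borel_measurable M; g \<in> borel_measurable M; AE x in M. f x = g x\<rbrakk>
      \<Longrightarrow> AE x in M. T f x = T g x" .
  have m: "square_integrable M h \<Longrightarrow> h \<in> borel_measurable M" for h
    by (simp add: square_integrable_def)
  have Tsi: "square_integrable M (T f)" if f: "square_integrable M f" for f
  proof -
    have "ennreal C * (\<integral>\<^sup>+x. ennreal ((cmod (f x))\<^sup>2) \<partial>M) < \<infinity>"
      using f by (simp add: square_integrable_iff ennreal_mult_less_top)
    then show ?thesis using bd[OF m[OF f]] meas[OF m[OF f]]
      by (auto simp: square_integrable_iff intro: le_less_trans)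
  qed
  show "bounded_operator (L2 M) (\<lambda>f. L2_rep M (T f))"
    unfolding bounded_operator_def linear_map_def
  proof (intro conjI ballI allI exI[of _ "sqrt C"])
    fix x assume "x \<in> hset (L2 M)"
    note x = hset_L2D[OF this]
    show "L2_rep M (T x) \<in> hset (L2 M)" by (intro hset_L2I Tsi x)
    have TL: "square_integrable M (L2_rep M (T x))" by (intro square_integrable_L2_rep Tsi x)
    have "ennreal ((hnorm (L2 M) (L2_rep M (T x)))\<^sup>2) = (\<integral>\<^sup>+t. ennreal ((cmod (L2_rep M (T x) t))\<^sup>2) \<partial>M)"
      by (rule hnorm_L2[OF TL])
    also have "\<dots> = (\<integral>\<^sup>+t. ennreal ((cmod (T x t))\<^sup>2) \<partial>M)"
      using L2_rep_AE[OF m[OF Tsi[OF x(1)]]] by (intro nn_integral_cong_AE) auto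
    also have "\<dots> \<le> ennreal C * ennreal ((hnorm (L2 M) x)\<^sup>2)"
      unfolding hnorm_L2(2)[OF x(1)] by (rule bd[OF x(3)])
    also have "\<dots> = ennreal ((sqrt C * hnorm (L2 M) x)\<^sup>2)"
      using C by (simp add: power_mult_distrib ennreal_mult)
    finally have "(hnorm (L2 M) (L2_rep M (T x)))\<^sup>2 \<le> (sqrt C * hnorm (L2 M) x)\<^sup>2" by simp
    then show "hnorm (L2 M) (L2_rep M (T x)) \<le> sqrt C * hnorm (L2 M) x"
      by (rule power2_le_imp_le) (use C hnorm_L2(1)[OF x(1)] in simp)
    show "L2_rep M (T (hscale (L2 M) c x)) = hscale (L2 M) c (L2_rep M (T x))" for c
    proof -
      have "AE t in M. L2_rep M (\<lambda>t. c * x t) t = c * x t"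
        using x by (intro L2_rep_AE) simp
      from cong[OF _ _ this] have "AE t in M. T (L2_rep M (\<lambda>t. c * x t)) t = c * T x t"
        using x L2_rep_measurable[of "\<lambda>t. c * x t" M] by (simp add: scale)
      moreover have "AE t in M. L2_rep M (T x) t = T x t" by (intro L2_rep_AE meas x)
      ultimately have "AE t in M. T (L2_rep M (\<lambda>t. c * x t)) t = c * L2_rep M (T x) t"
        by eventually_elim simp
      then show ?thesis unfolding L2_simps by (rule L2_rep_cong)
    qed
    fix y assume "y \<in> hset (L2 M)"
    note y = hset_L2D[OF this]
    have "AE t in M. L2_rep M (\<lambda>t. x t + y t) t = x t + y t"
      using x y by (intro L2_rep_AE) simp
    from cong[OF _ _ this] have "AE t in M. T (L2_rep M (\<lambda>t. x t + y t)) t = T x t + T y t"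
      using x y L2_rep_measurable[of "\<lambda>t. x t + y t" M] by (simp add: add)
    moreover have "AE t in M. L2_rep M (T x) t = T x t" by (intro L2_rep_AE meas x)
    moreover have "AE t in M. L2_rep M (T y) t = T y t" by (intro L2_rep_AE meas y)
    ultimately have "AE t in M. T (L2_rep M (\<lambda>t. x t + y t)) t = L2_rep M (T x) t + L2_rep M (T y) t"
      by eventually_elim simp
    then show "L2_rep M (T (hadd (L2 M) x y)) = hadd (L2 M) (L2_rep M (T x)) (L2_rep M (T y))"
      unfolding L2_simps by (rule L2_rep_cong)
  qed
qed


section \<open>Moment sequences from normal extensions, without spectral measures\<close>

section \<open>Moments of subnormal operators\<close>

text \<open>Differences at index \<open>n\<close> are, up to a positive factor, differences at index
  0 for \<open>(N ^^ n) y\<close>. The order falls by two whenever \<open>y\<close> is replaced by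
  \<open>Q y\<close>, so two base cases remain: order 0 is a squared norm, and order 1 is the bound
  on \<open>N\<close>.\<close>

lemma subnormal_moment_sequence:
  assumes sub: "subnormal H A" and f: "f \<in> hset H"
  shows "stieltjes_moment_sequence (\<lambda>n. (hnorm H ((A ^^ n) f))\<^sup>2)"
proof -
  obtain K :: "('a \<times> nat \<Rightarrow> complex) hilb" and N J where ext: "normal_extension H A K N J"
    using sub by (auto simp: subnormal_def)
  interpret complex_hilbert_space K using ext by (simp add: normal_extension_def)
  note [simp] = zero_closed add_closed scale_closed
  obtain N' where N': "bounded_operator K N'" "is_adjoint K N N'"
    and comm: "\<And>x. x \<in> hset K \<Longrightarrow> N (N' x) = N' (N x)" and N: "bounded_operator K N"
    using ext by (auto simp: normal_extension_def normal_operator_def)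
  have NJ: "\<And>x. x \<in> hset H \<Longrightarrow> N (J x) = J (A x)"
    and J: "isometric_embedding H K J" using ext by (auto simp: normal_extension_def)
  have [simp]: "\<And>x. x \<in> hset H \<Longrightarrow> A x \<in> hset H" "\<And>x. x \<in> hset H \<Longrightarrow> J x \<in> hset K"
    "\<And>x. x \<in> hset K \<Longrightarrow> N x \<in> hset K" "\<And>x. x \<in> hset K \<Longrightarrow> N' x \<in> hset K"
    using sub N N'(1) J
    by (auto simp: subnormal_def bounded_operator_def isometric_embedding_def linear_map_def)
  have Nadd: "N (hadd K x y) = hadd K (N x) (N y)" if "x \<in> hset K" "y \<in> hset K" for x y
    using N that by (auto simp: bounded_operator_def linear_map_def)
  have Nscale: "N (hscale K c x) = hscale K c (N x)" if "x \<in> hset K" for x c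
    using N that by (auto simp: bounded_operator_def linear_map_def)
  have adj: "hinner K (N x) y = hinner K x (N' y)"
    if "x \<in> hset K" "y \<in> hset K" for x y using N'(2) that by (simp add: is_adjoint_def)
  have adj': "hinner K (N' x) y = hinner K x (N y)"
    if "x \<in> hset K" "y \<in> hset K" for x y
  proof -
    have "hinner K (N' x) y = cnj (hinner K y (N' x))" using that by (simp add: inner_commute[of "N' x"])
    also have "\<dots> = cnj (hinner K (N y) x)" using that adj by simp
    finally show ?thesis using that inner_commute[of x "N y"] by simp
  qed
  have [simp]: "(N ^^ n) x \<in> hset K" if "x \<in> hset K" for n x
    using that by (induction n) auto
  have Npow_add: "(N ^^ n) (hadd K x y) = hadd K ((N ^^ n) x) ((N ^^ n) y)"
    if "x \<in> hset K" "y \<in> hset K" for x y n using that by (induction n) (auto simp: Nadd)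
  have Npow_scale: "(N ^^ n) (hscale K c x) = hscale K c ((N ^^ n) x)" if "x \<in> hset K" for x c n
    using that by (induction n) (auto simp: Nscale)
  have Npow_comm: "(N ^^ n) (N' x) = N' ((N ^^ n) x)" if "x \<in> hset K" for x n
    using that by (induction n) (auto simp: comm)
  obtain C0 where C0: "\<And>x. x \<in> hset K \<Longrightarrow> hnorm K (N x) \<le> C0 * hnorm K x"
    using N by (auto simp: bounded_operator_def)
  \<comment> \<open>Made positive so that division by \<open>c\<close> is possible. As
    \<open>c\<close> is the square of a bound for \<open>N\<close>, the scaled sequence
    \<open>b y\<close> is nonincreasing.\<close>
  define C where "C = \<bar>C0\<bar> + 1"
  define c where "c = C\<^sup>2"
  have C: "0 < C" by (simp add: C_def)
  then have c: "0 < c" by (simp add: c_def)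
  have CN: "hnorm K (N x) \<le> C * hnorm K x" if "x \<in> hset K" for x
  proof -
    have "C0 * hnorm K x \<le> C * hnorm K x"
      using hnorm_nonneg[OF that] by (intro mult_right_mono) (auto simp: C_def)
    then show ?thesis using C0[OF that] by linarith
  qed
  define a where "a y n = (hnorm K ((N ^^ n) y))\<^sup>2" for y n
  define b where "b y n = a y n / c ^ n" for y n
  have a_inner: "a y n = Re (hinner K ((N ^^ n) y) ((N ^^ n) y))" if "y \<in> hset K" for y n
    using inner_nonneg that by (simp add: a_def hnorm_def)
  have aN: "a (N y) n = a y (Suc n)" for y n by (simp add: a_def funpow_swap1)
  \<comment> \<open>In spectral terms \<open>b y n\<close> is an integral of \<open>x ^ n\<close>
    with \<open>x = |z|\<^sup>2 / c\<close>, and \<open>Q\<close> multiplies by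
    \<open>1 - x\<close>; in a squared norm this factor occurs twice, which gives the second
    difference.\<close>
  define Q where "Q y = hadd K y (hscale K (- complex_of_real (1 / c)) (N' (N y)))" for y
  have Q [simp]: "Q y \<in> hset K" if "y \<in> hset K" for y using that by (simp add: Q_def)
  have bQ: "b (Q y) n = b y n - 2 * b y (Suc n) + b y (Suc (Suc n))" if y: "y \<in> hset K" for y n
  proof -
    define u where "u = (N ^^ n) y"
    have u: "u \<in> hset K" using y by (simp add: u_def)
    let ?w = "N' (N u)" and ?d = "- complex_of_real (1 / c)"
    have w: "?w \<in> hset K" using u by simp
    have "(N ^^ n) (Q y) = hadd K u (hscale K ?d ?w)"
      using y by (simp add: Q_def Npow_add Npow_scale Npow_comm u_def funpow_swap1)
    then have "hinner K ((N ^^ n) (Q y)) ((N ^^ n) (Q y))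
      = hinner K u u + ?d * hinner K ?w u + ?d * hinner K u ?w + ?d * ?d * hinner K ?w ?w"
      using u w by (simp add: inner_add inner_add_right inner_scale inner_scale_right algebra_simps)
    moreover have "hinner K ?w u = hinner K (N u) (N u)" "hinner K u ?w = hinner K (N u) (N u)"
      using u adj[of u "N u"] adj'[of "N u" u] by auto
    moreover have "hinner K ?w ?w = hinner K (N (N u)) (N (N u))"
    proof -
      have "hinner K ?w ?w = hinner K (N u) (N (N' (N u)))" using u adj' by simp
      also have "\<dots> = hinner K (N u) (N' (N (N u)))" using u comm by simp
      finally show ?thesis using u adj by simp
    qed
    ultimately have "a (Q y) n = a y n - 2 / c * a y (Suc n) + 1 / c\<^sup>2 * a y (Suc (Suc n))"
      using y by (simp add: a_inner u_def power2_eq_square)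
    then show ?thesis using c by (simp add: b_def field_simps power2_eq_square)
  qed
  have bN: "b y (Suc n) = b (N y) n / c" for y n
    by (simp add: b_def aN)
  have bd_shift: "backward_difference m (b y) (Suc n) = backward_difference m (b (N y)) n / c" for m y n
    by (induction m arbitrary: n) (simp_all add: bN diff_divide_distrib)
  have bd2: "backward_difference m (b (Q y)) n = backward_difference (Suc (Suc m)) (b y) n"
    if "y \<in> hset K" for m n y
    using that by (induction m arbitrary: n) (simp_all add: bQ)
  have bd0: "0 \<le> backward_difference m (b y) 0" if "y \<in> hset K" for m y
    using that
  proof (induction m arbitrary: y rule: induct_nat_012)
    case 0 show ?case using c by (simp add: b_def a_def)
  next
    case 1
    have "(hnorm K (N y))\<^sup>2 \<le> (C * hnorm K y)\<^sup>2"
      using CN[OF 1] by (intro power_mono) (simp_all add: hnorm_nonneg 1)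
    then show ?case using c by (simp add: b_def a_def c_def power_mult_distrib field_simps)
  next
    case (ge2 m)
    then show ?case using bd2[of y m 0] by (metis Q)
  qed
  have bdn: "0 \<le> backward_difference m (b y) n" if "y \<in> hset K" for m n y
    using that by (induction n arbitrary: y) (simp_all add: bd0 bd_shift c less_imp_le)
  have Npow: "(N ^^ n) (J f) = J ((A ^^ n) f)" and Apow: "(A ^^ n) f \<in> hset H" for n
    using f by (induction n) (simp_all add: NJ)
  have eq: "(hnorm H ((A ^^ n) f))\<^sup>2 = a (J f) n" for n
    using J Apow[of n] by (simp add: a_def Npow hnorm_def isometric_embedding_def)
  show ?thesis
    unfolding eq
    by (rule stieltjes_moment_sequence_backward_difference[OF _ c])
      (use bdn[of "J f"] f in \<open>simp add: b_def[abs_def]\<close>)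
qed


section \<open>Acyclicity of directed trees and the recursion for the moments of a shift\<close>

section \<open>Moments of weighted shifts\<close>

lemma ennreal_infsum:
  fixes f :: "'i \<Rightarrow> real"
  assumes "f summable_on A" "\<And>i. i \<in> A \<Longrightarrow> 0 \<le> f i"
  shows "ennreal (infsum f A) = (\<integral>\<^sup>+i. ennreal (f i) \<partial>count_space A)"
proof -
  have "ennreal (infsum f A) = (SUP F\<in>{F. finite F \<and> F \<subseteq> A}. ennreal (sum f F))"
    using assms by (intro infsum_nonneg_is_SUPREMUM_ennreal) auto
  also have "\<dots> = (SUP F\<in>{F. finite F \<and> F \<subseteq> A}. \<Sum>i\<in>F. ennreal (f i))"
    using assms(2) by (intro SUP_cong refl sum_ennreal[symmetric]) auto
  also have "\<dots> = infsum (\<lambda>i. ennreal (f i)) A"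
    by (subst nonneg_infsum_complete) auto
  finally show ?thesis by (simp add: infsum_ennreal_eq_nn_integral)
qed

text \<open>Tonelli's theorem for counting measures that may fail to be sigma-finite: after
  extension by indicators, both iterated integrals equal the integral over the counting measure on
  pairs.\<close>

lemma nn_integral_count_space_swap:
  "(\<integral>\<^sup>+x. \<integral>\<^sup>+y. f x y \<partial>count_space B \<partial>count_space A)
    = (\<integral>\<^sup>+y. \<integral>\<^sup>+x. f x y \<partial>count_space A \<partial>count_space B)"
proof -
  let ?g = "\<lambda>(x, y). f x y * indicator B y * indicator A x"
  have "(\<integral>\<^sup>+x. \<integral>\<^sup>+y. f x y \<partial>count_space B \<partial>count_space A)
    = (\<integral>\<^sup>+x. \<integral>\<^sup>+y. ?g (x, y) \<partial>count_space UNIV \<partial>count_space UNIV)"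
    by (simp add: nn_integral_count_space_indicator nn_integral_multc)
  also have "\<dots> = (\<integral>\<^sup>+y. \<integral>\<^sup>+x. ?g (x, y) \<partial>count_space UNIV \<partial>count_space UNIV)"
    unfolding nn_integral_fst_count_space nn_integral_snd_count_space ..
  also have "\<dots> = (\<integral>\<^sup>+y. \<integral>\<^sup>+x. f x y \<partial>count_space A \<partial>count_space B)"
  proof -
    have g: "?g (x, y) = f x y * indicator A x * indicator B y" for x y by (simp add: indicator_def)
    show ?thesis
      unfolding g by (simp add: nn_integral_count_space_indicator nn_integral_multc)
  qed
  finally show ?thesis .
qed

lemma hset_ell2: "f \<in> hset (ell2 V) \<longleftrightarrow>
    (\<forall>v. v \<notin> V \<longrightarrow> f v = 0) \<and> (\<lambda>v. (cmod (f v))\<^sup>2) summable_on V"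
  by (simp add: ell2_def)

lemma ell2_simps:
  "hadd (ell2 V) f g = (\<lambda>v. f v + g v)" "hscale (ell2 V) c f = (\<lambda>v. c * f v)"
  "hinner (ell2 V) f g = (\<Sum>\<^sub>\<infinity>v\<in>V. f v * cnj (g v))"
  by (simp_all add: ell2_def)

lemma hnorm_ell2:
  assumes "f \<in> hset (ell2 V)"
  shows "(hnorm (ell2 V) f)\<^sup>2 = (\<Sum>\<^sub>\<infinity>v\<in>V. (cmod (f v))\<^sup>2)" "0 \<le> hnorm (ell2 V) f"
proof -
  have "((\<lambda>v. (cmod (f v))\<^sup>2) has_sum (\<Sum>\<^sub>\<infinity>v\<in>V. (cmod (f v))\<^sup>2)) V"
    using assms by (simp add: hset_ell2)
  then have "((\<lambda>v. complex_of_real ((cmod (f v))\<^sup>2)) has_sum complex_of_real (\<Sum>\<^sub>\<infinity>v\<in>V. (cmod (f v))\<^sup>2)) V"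
    unfolding has_sum_of_real_iff .
  then have "(\<Sum>\<^sub>\<infinity>v\<in>V. f v * cnj (f v)) = complex_of_real (\<Sum>\<^sub>\<infinity>v\<in>V. (cmod (f v))\<^sup>2)"
    unfolding complex_norm_square by (rule infsumI)
  then have "Re (hinner (ell2 V) f f) = (\<Sum>\<^sub>\<infinity>v\<in>V. (cmod (f v))\<^sup>2)" by (simp add: ell2_simps)
  moreover have "0 \<le> (\<Sum>\<^sub>\<infinity>v\<in>V. (cmod (f v))\<^sup>2)" by (intro infsum_nonneg) simp
  ultimately show "(hnorm (ell2 V) f)\<^sup>2 = (\<Sum>\<^sub>\<infinity>v\<in>V. (cmod (f v))\<^sup>2)" "0 \<le> hnorm (ell2 V) f"
    by (simp_all add: hnorm_def)
qed

lemma ennreal_hnorm_ell2: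
  "f \<in> hset (ell2 V) \<Longrightarrow>
    ennreal ((hnorm (ell2 V) f)\<^sup>2) = (\<integral>\<^sup>+v. ennreal ((cmod (f v))\<^sup>2) \<partial>count_space V)"
  by (simp add: hnorm_ell2 hset_ell2 ennreal_infsum)

lemma unit_vec_ell2:
  assumes "u \<in> V"
  shows "unit_vec u \<in> hset (ell2 V)" "hnorm (ell2 V) (unit_vec u) = 1"
proof -
  have s: "((\<lambda>v. (cmod (unit_vec u v))\<^sup>2) has_sum 1) V"
  proof -
    have "((\<lambda>v. (cmod (unit_vec u v))\<^sup>2) has_sum (\<Sum>v\<in>{u}. (cmod (unit_vec u v))\<^sup>2)) {u}"
      by (rule has_sum_finite) simp
    then show ?thesis
      using assms by (subst (asm) has_sum_cong_neutral[where T = V]) (auto simp: unit_vec_def)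
  qed
  then show "unit_vec u \<in> hset (ell2 V)"
    using assms by (auto simp: hset_ell2 unit_vec_def has_sum_imp_summable)
  then have "(hnorm (ell2 V) (unit_vec u))\<^sup>2 = 1" "0 \<le> hnorm (ell2 V) (unit_vec u)"
    using s by (simp_all add: hnorm_ell2 infsumI)
  then show "hnorm (ell2 V) (unit_vec u) = 1" by (simp add: power2_eq_1_iff)
qed

locale bounded_tree_shift =
  fixes V :: "'v set" and E :: "('v \<times> 'v) set" and lam :: "'v \<Rightarrow> complex"
  assumes tree: "directed_tree V E"
    and bounded: "bounded_operator (ell2 V) (wshift V E lam)"
begin

abbreviation "S \<equiv> wshift V E lam"

lemma edgeD: "(u, v) \<in> E \<Longrightarrow> u \<in> V \<and> v \<in> V \<and> u \<noteq> v"
  using tree by (auto simp: directed_tree_def)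

lemma nonrootsD: "v \<in> nonroots V E \<Longrightarrow> v \<in> V \<and> (par E v, v) \<in> E"
proof -
  assume v: "v \<in> nonroots V E"
  then have "\<exists>!u. (u, v) \<in> E" using tree by (auto simp: directed_tree_def nonroots_def)
  then show ?thesis using v theI'[of "\<lambda>u. (u, v) \<in> E"] by (auto simp: par_def nonroots_def)
qed

lemma edge_iff: "(u, v) \<in> E \<longleftrightarrow> v \<in> nonroots V E \<and> par E v = u"
proof
  assume e: "(u, v) \<in> E"
  then have v: "v \<in> nonroots V E" using edgeD by (auto simp: nonroots_def is_root_def)
  moreover have "\<exists>!u. (u, v) \<in> E" using v tree by (auto simp: directed_tree_def nonroots_def)
  ultimately show "v \<in> nonroots V E \<and> par E v = u" using e nonrootsD by auto
qed (use nonrootsD in auto)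

lemma Chi_iff: "v \<in> Chi E u \<longleftrightarrow> v \<in> nonroots V E \<and> par E v = u"
  by (simp add: Chi_def edge_iff)

lemma ChiD: "v \<in> Chi E u \<Longrightarrow> v \<in> V \<and> u \<in> V \<and> v \<in> nonroots V E \<and> par E v = u"
  using edgeD edge_iff by (auto simp: Chi_def)

lemma par_in_V: "v \<in> nonroots V E \<Longrightarrow> par E v \<in> V"
  using nonrootsD edgeD by blast

text \<open>The circuits excluded by \<open>directed_tree\<close> have distinct vertices, so the
  return time is first made minimal. It is at least 2 because no edge is a loop.\<close>

lemma par_no_cycle:
  assumes m: "0 < m" and up: "\<forall>j<m. (par E ^^ j) x \<in> nonroots V E"
  shows "(par E ^^ m) x \<noteq> x"
proof
  assume ret: "(par E ^^ m) x = x"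
  define k where "k = (LEAST k. 0 < k \<and> (par E ^^ k) x = x)"
  have k: "0 < k" "(par E ^^ k) x = x"
    using LeastI[of "\<lambda>k. 0 < k \<and> (par E ^^ k) x = x" m] m ret by (auto simp: k_def)
  have kmin: "(par E ^^ i) x \<noteq> x" if "0 < i" "i < k" for i
    using not_less_Least[of i "\<lambda>k. 0 < k \<and> (par E ^^ k) x = x"] that by (auto simp: k_def)
  have km: "k \<le> m" unfolding k_def using m ret by (intro Least_le) auto
  have inj: "(par E ^^ i) x \<noteq> (par E ^^ j) x" if "i < j" "j < k" for i j
  proof
    assume eq: "(par E ^^ i) x = (par E ^^ j) x"
    have "(par E ^^ (k - j + i)) x = (par E ^^ (k - j)) ((par E ^^ i) x)" by (simp add: funpow_add)
    also have "\<dots> = (par E ^^ (k - j + j)) x" unfolding eq by (simp add: funpow_add)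
    also have "\<dots> = x" using that k by simp
    finally have ret': "(par E ^^ (k - j + i)) x = x" .
    have "0 < k - j + i" "k - j + i < k" using that by arith+
    from kmin[OF this] ret' show False by (rule notE)
  qed
  have edge: "((par E ^^ Suc j) x, (par E ^^ j) x) \<in> E" if "j < k" for j
    using nonrootsD up that km by auto
  \<comment> \<open>Listed from the oldest ancestor down to \<open>x\<close>, since edges lead from
    parents to children.\<close>
  define p where "p = map (\<lambda>j. (par E ^^ (k - 1 - j)) x) [0..<k]"
  have k2: "2 \<le> k"
  proof (rule ccontr)
    assume "\<not> 2 \<le> k"
    then have "k = 1" using k by simp
    then show False using edge[of 0] k edgeD by auto
  qed
  have "inj_on (\<lambda>j. (par E ^^ (k - 1 - j)) x) {0..<k}"
  proof (rule inj_onI)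
    fix i j assume ij: "i \<in> {0..<k}" "j \<in> {0..<k}"
      and eq: "(par E ^^ (k - 1 - i)) x = (par E ^^ (k - 1 - j)) x"
    show "i = j"
    proof (rule ccontr)
      assume "i \<noteq> j"
      then have "k - 1 - i < k - 1 - j \<or> k - 1 - j < k - 1 - i" using ij by auto
      then show False using eq inj[of "k - 1 - i" "k - 1 - j"] inj[of "k - 1 - j" "k - 1 - i"] ij by auto
    qed
  qed
  then have "distinct p" by (simp add: p_def distinct_map)
  moreover have "2 \<le> length p" using k2 by (simp add: p_def)
  moreover have "(p ! j, p ! Suc j) \<in> E" if "Suc j < length p" for j
  proof -
    have "k - 1 - j = Suc (k - 1 - Suc j)" using that by (simp add: p_def)
    then show ?thesis using edge[of "k - 1 - Suc j"] that by (simp add: p_def)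
  qed
  moreover have "(last p, hd p) \<in> E"
  proof -
    have "last p = x" "hd p = (par E ^^ (k - 1)) x"
      using k by (simp_all add: p_def last_map hd_map hd_conv_nth)
    moreover have "par E ((par E ^^ (k - 1)) x) = x"
      using k by (metis One_nat_def Suc_pred comp_apply funpow.simps(2))
    ultimately show ?thesis using edge[of "k - 1"] k by simp
  qed
  ultimately show False using tree unfolding directed_tree_def by blast
qed

lemma S_closed: "f \<in> hset (ell2 V) \<Longrightarrow> S f \<in> hset (ell2 V)"
  using bounded by (auto simp: bounded_operator_def linear_map_def)

lemma S_pow_closed: "f \<in> hset (ell2 V) \<Longrightarrow> (S ^^ n) f \<in> hset (ell2 V)"
  by (induction n) (auto intro: S_closed)

text \<open>Different children have disjoint descendants, so at each \<open>w\<close> at most one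
  \<open>v\<close> contributes, and squared moduli can be added without cross terms. The induction
  only replaces \<open>w\<close> by its parent, so this disjointness enters tacitly, through the
  uniqueness of parents.\<close>

lemma S_pow_Suc_unit_vec:
  "ennreal ((cmod ((S ^^ Suc n) (unit_vec u) w))\<^sup>2)
    = (\<integral>\<^sup>+v. ennreal ((cmod (lam v))\<^sup>2) * ennreal ((cmod ((S ^^ n) (unit_vec v) w))\<^sup>2) \<partial>count_space (Chi E u))"
proof (induction n arbitrary: w)
  case 0
  have "(\<integral>\<^sup>+v. ennreal ((cmod (lam v))\<^sup>2) * ennreal ((cmod ((S ^^ 0) (unit_vec v) w))\<^sup>2) \<partial>count_space (Chi E u))
    = (\<Sum>v\<in>{w} \<inter> Chi E u. ennreal ((cmod (lam v))\<^sup>2) * ennreal ((cmod ((S ^^ 0) (unit_vec v) w))\<^sup>2))"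
    by (intro nn_integral_count_space') (auto simp: unit_vec_def)
  also have "\<dots> = ennreal ((cmod ((S ^^ Suc 0) (unit_vec u) w))\<^sup>2)"
    by (cases "w \<in> Chi E u") (auto simp: unit_vec_def wshift_def Chi_iff)
  finally show ?case by simp
next
  case (Suc n)
  show ?case
  proof (cases "w \<in> nonroots V E")
    case True
    let ?c = "ennreal ((cmod (lam w))\<^sup>2)"
    have st: "ennreal ((cmod ((S ^^ Suc m) (unit_vec v) w))\<^sup>2)
      = ?c * ennreal ((cmod ((S ^^ m) (unit_vec v) (par E w)))\<^sup>2)" for m v
      using True by (simp add: wshift_def norm_mult power_mult_distrib ennreal_mult)
    show ?thesis
      unfolding st Suc by (subst nn_integral_cmult[symmetric]) (auto simp: mult.left_commute)
  qed (simp add: wshift_def)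
qed

abbreviation "mom \<equiv> shift_moments V E lam"

lemma ennreal_mom:
  assumes "u \<in> V"
  shows "ennreal (mom u n) = (\<integral>\<^sup>+w. ennreal ((cmod ((S ^^ n) (unit_vec u) w))\<^sup>2) \<partial>count_space V)"
  unfolding shift_moments_def using assms by (intro ennreal_hnorm_ell2 S_pow_closed unit_vec_ell2)

lemma mom_nonneg: "0 \<le> mom u n"
  by (simp add: shift_moments_def)

lemma mom_0: "u \<in> V \<Longrightarrow> mom u 0 = 1"
  by (simp add: shift_moments_def unit_vec_ell2)

lemma mom_Suc:
  assumes "u \<in> V"
  shows "ennreal (mom u (Suc n))
    = (\<integral>\<^sup>+v. ennreal ((cmod (lam v))\<^sup>2) * ennreal (mom v n) \<partial>count_space (Chi E u))"
  unfolding ennreal_mom[OF assms] S_pow_Suc_unit_vec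
proof (subst nn_integral_count_space_swap, rule nn_integral_cong)
  fix v assume "v \<in> space (count_space (Chi E u))"
  then have "v \<in> V" using ChiD by auto
  then show "(\<integral>\<^sup>+w. ennreal ((cmod (lam v))\<^sup>2) * ennreal ((cmod ((S ^^ n) (unit_vec v) w))\<^sup>2) \<partial>count_space V)
    = ennreal ((cmod (lam v))\<^sup>2) * ennreal (mom v n)"
    unfolding ennreal_mom[OF \<open>v \<in> V\<close>] by (intro nn_integral_cmult) simp
qed

text \<open>One base \<open>c\<close> serves all vertices: it yields the uniqueness of each
  \<open>\<mu> u\<close> and later a common bound for their supports.\<close>

lemma mom_growth: "\<exists>c\<ge>0. \<forall>u\<in>V. \<forall>n. mom u n \<le> c ^ n"
proof -
  obtain C where C: "\<And>f. f \<in> hset (ell2 V) \<Longrightarrow> hnorm (ell2 V) (S f) \<le> C * hnorm (ell2 V) f"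
    using bounded by (auto simp: bounded_operator_def)
  have C': "hnorm (ell2 V) (S f) \<le> \<bar>C\<bar> * hnorm (ell2 V) f" if "f \<in> hset (ell2 V)" for f
    using C[OF that] hnorm_ell2(2)[OF that] by (meson abs_ge_self mult_right_mono order_trans)
  have "hnorm (ell2 V) ((S ^^ n) (unit_vec u)) \<le> \<bar>C\<bar> ^ n" if "u \<in> V" for u n
  proof (induction n)
    case (Suc n)
    have "hnorm (ell2 V) (S ((S ^^ n) (unit_vec u))) \<le> \<bar>C\<bar> * hnorm (ell2 V) ((S ^^ n) (unit_vec u))"
      using that by (intro C' S_pow_closed unit_vec_ell2)
    also have "\<dots> \<le> \<bar>C\<bar> * \<bar>C\<bar> ^ n" using Suc by (intro mult_left_mono) auto
    finally show ?case by simp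
  qed (use that in \<open>simp add: unit_vec_ell2\<close>)
  then have "mom u n \<le> (\<bar>C\<bar> ^ n)\<^sup>2" if "u \<in> V" for u n
    using that unfolding shift_moments_def
    by (intro power_mono hnorm_ell2 S_pow_closed unit_vec_ell2) auto
  moreover have "(\<bar>C\<bar> ^ n)\<^sup>2 = (\<bar>C\<bar>\<^sup>2) ^ n" for n
    by (simp only: power_mult[symmetric] mult.commute)
  ultimately have "\<forall>u\<in>V. \<forall>n. mom u n \<le> (\<bar>C\<bar>\<^sup>2) ^ n" by metis
  then show ?thesis by (intro exI[of _ "\<bar>C\<bar>\<^sup>2"]) auto
qed

abbreviation "stieltjes_at v \<equiv> stieltjes_moment_sequence (mom v)"
abbreviation "\<mu> \<equiv> shift_measure V E lam"

lemma shift_measure_represents: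
  assumes u: "u \<in> V" and st: "stieltjes_at u"
  shows "represents (\<mu> u) (mom u)"
proof -
  obtain c where "0 \<le> c" "\<And>n. mom u n \<le> 1 * c ^ n" using mom_growth u by auto
  then have unique: "M = N" if "represents M (mom u)" "represents N (mom u)" for M N
    using represents_unique that by blast
  obtain M where M: "represents M (mom u)" using st by (auto simp: stieltjes_moment_sequence_def)
  show ?thesis unfolding shift_measure_def by (rule theI[of "\<lambda>M. represents M (mom u)", OF M unique[OF _ M]])
qed

lemma subnormal_imp_stieltjes:
  assumes "subnormal (ell2 V) S" "u \<in> V"
  shows "stieltjes_at u"
  using subnormal_moment_sequence[OF assms(1) unit_vec_ell2(1)[OF assms(2)]]
  by (simp add: shift_moments_def[abs_def])

text \<open>Both sides are integrals against measures representing \<^term>\<open>\<lambda>n. mom u (Suc n)\<close>.\<close>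

lemma nn_integral_shift_measure:
  assumes u: "u \<in> V" and su: "stieltjes_at u" and sc: "\<And>v. v \<in> Chi E u \<Longrightarrow> stieltjes_at v"
    and f: "f \<in> borel_measurable (restrict_space borel {0..})"
  shows "(\<integral>\<^sup>+s. ennreal s * f s \<partial>\<mu> u)
    = (\<integral>\<^sup>+v. ennreal ((cmod (lam v))\<^sup>2) * (\<integral>\<^sup>+s. f s \<partial>\<mu> v) \<partial>count_space (Chi E u))"
proof -
  let ?R = "restrict_space borel {0..} :: real measure"
  have rep: "represents (\<mu> v) (mom v)" if "v \<in> Chi E u" for v
    using that sc ChiD by (intro shift_measure_represents) auto
  have repu: "represents (\<mu> u) (mom u)" using u su by (rule shift_measure_represents)
  have su': "sets (\<mu> u) = sets ?R" using repu by (simp add: represents_def)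
  \<comment> \<open>Null off the children, since a direct sum runs over its whole index
    type.\<close>
  define \<kappa> where "\<kappa> v = (if v \<in> Chi E u then scale_measure (ennreal ((cmod (lam v))\<^sup>2)) (\<mu> v) else null_measure ?R)" for v
  have sets\<kappa>: "sets (\<kappa> v) = sets ?R" for v using rep by (auto simp: \<kappa>_def represents_def)
  \<comment> \<open>Projecting the direct sum to the half line realises the sum of arbitrarily many
    measures; \<open>D'\<close> is the measure \<open>s d\<mu>\<close> at \<open>u\<close>.\<close>
  define D where "D = distr (direct_sum_measure ?R \<kappa>) ?R snd"
  define D' where "D' = density (\<mu> u) ennreal"
  have snd_m: "snd \<in> measurable (direct_sum_measure ?R \<kappa>) ?R"
    by (intro measurable_direct_sum_measureI) simp
  have intD: "(\<integral>\<^sup>+s. g s \<partial>D) = (\<integral>\<^sup>+v. ennreal ((cmod (lam v))\<^sup>2) * (\<integral>\<^sup>+s. g s \<partial>\<mu> v) \<partial>count_space (Chi E u))"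
    if g: "g \<in> borel_measurable ?R" for g
  proof -
    have gv: "g \<in> borel_measurable (\<mu> v)" if "v \<in> Chi E u" for v
    proof -
      have "sets (\<mu> v) = sets ?R" using rep[OF that] by (simp add: represents_def)
      then show ?thesis using g measurable_cong_sets by blast
    qed
    have "(\<integral>\<^sup>+s. g s \<partial>D) = (\<integral>\<^sup>+x. g (snd x) \<partial>direct_sum_measure ?R \<kappa>)"
      unfolding D_def by (rule nn_integral_distr[OF snd_m]) (use g in simp)
    also have "\<dots> = (\<integral>\<^sup>+v. \<integral>\<^sup>+s. g s \<partial>\<kappa> v \<partial>count_space UNIV)"
      using measurable_compose[OF snd_m g] by (subst nn_integral_direct_sum_measure[OF sets\<kappa>]) auto
    also have "\<dots> = (\<integral>\<^sup>+v. (ennreal ((cmod (lam v))\<^sup>2) * (\<integral>\<^sup>+s. g s \<partial>\<mu> v)) * indicator (Chi E u) v \<partial>count_space UNIV)"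
      by (intro nn_integral_cong) (auto simp: \<kappa>_def nn_integral_scale_measure gv indicator_def)
    finally show ?thesis by (simp add: nn_integral_count_space_indicator)
  qed
  have ennreal_m: "ennreal \<in> borel_measurable (\<mu> u)"
    by (rule represents_measurable[OF repu]) measurable
  have intD': "(\<integral>\<^sup>+s. g s \<partial>D') = (\<integral>\<^sup>+s. ennreal s * g s \<partial>\<mu> u)" if g: "g \<in> borel_measurable ?R" for g
  proof -
    have "g \<in> borel_measurable (\<mu> u)" using g su' measurable_cong_sets by blast
    then show ?thesis unfolding D'_def using ennreal_m by (rule nn_integral_density[rotated])
  qed
  have pm: "(\<lambda>s. ennreal (s ^ n)) \<in> borel_measurable ?R" for n
    by (intro measurable_restrict_space1) simp
  have D: "represents D (\<lambda>n. mom u (Suc n))"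
  proof (rule representsI)
    fix n
    show "(\<integral>\<^sup>+s. ennreal (s ^ n) \<partial>D) = ennreal (mom u (Suc n))"
      unfolding intD[OF pm] mom_Suc[OF u]
      by (intro nn_integral_cong) (simp add: represents_nn_integral[OF rep])
  qed (auto simp: D_def mom_nonneg)
  have D': "represents D' (\<lambda>n. mom u (Suc n))"
  proof (rule representsI)
    fix n
    have "(\<integral>\<^sup>+s. ennreal (s ^ n) \<partial>D') = (\<integral>\<^sup>+s. ennreal (s ^ Suc n) \<partial>\<mu> u)"
      unfolding intD'[OF pm] using represents_space[OF repu]
      by (intro nn_integral_cong) (auto simp: ennreal_mult)
    then show "(\<integral>\<^sup>+s. ennreal (s ^ n) \<partial>D') = ennreal (mom u (Suc n))"
      using represents_nn_integral[OF repu, of "Suc n"] by simp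
  qed (auto simp: D'_def su' mom_nonneg)
  obtain c where c: "0 \<le> c" "\<And>n. mom u n \<le> c ^ n" using mom_growth u by auto
  have "D = D'" using represents_unique[OF D D' _ c(1), of c] c(2)[of "Suc _"] by simp
  then show ?thesis using intD[OF f] intD'[OF f] by simp
qed

end


section \<open>Negative moments along the chain of ancestors of \<omega>\<close>

section \<open>Negative moments along the path to the root\<close>

locale one_branching_shift = bounded_tree_shift V E lam
  for V :: "'v set" and E lam +
  fixes \<omega> :: 'v
  assumes omega: "\<omega> \<in> V"
    and non_branching: "\<And>v. v \<in> V - {\<omega>} \<Longrightarrow> card (Chi E v) = 1"
    and nonzero: "\<And>v. v \<in> nonroots V E \<Longrightarrow> lam v \<noteq> 0"
begin

abbreviation "up j \<equiv> (par E ^^ j) \<omega>"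

text \<open>The parent of a root is unspecified, so \<open>up k\<close> has a meaning only under
  this condition.\<close>

definition "has_up k \<longleftrightarrow> (\<forall>j<k. up j \<in> nonroots V E)"

text \<open>Under \<open>has_up k\<close> this is the reciprocal of the squared norm of
  \<open>(S ^^ k) (unit_vec (up k))\<close>, a vector equal to the product times
  \<open>unit_vec \<omega>\<close>.\<close>

definition "path_weight k = ennreal (1 / (cmod (\<Prod>j<k. lam (up j)))\<^sup>2)"

abbreviation "inv_sum \<equiv> inverse_moment_sum V E lam \<omega>"

lemma has_up_0 [simp]: "has_up 0" by (simp add: has_up_def)

lemma has_up_Suc: "has_up (Suc k) \<longleftrightarrow> has_up k \<and> up k \<in> nonroots V E"
  by (auto simp: has_up_def less_Suc_eq)

lemma has_up_mono: "has_up k \<Longrightarrow> j \<le> k \<Longrightarrow> has_up j"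
  by (auto simp: has_up_def)

lemma up_in_V: "has_up k \<Longrightarrow> up k \<in> V"
  by (cases k) (auto simp: omega has_up_Suc par_in_V)

lemma up_ne_omega: "has_up k \<Longrightarrow> 0 < k \<Longrightarrow> up k \<noteq> \<omega>"
  using par_no_cycle[of k \<omega>] by (simp add: has_up_def)

lemma Chi_par:
  assumes "x \<in> nonroots V E" "par E x \<noteq> \<omega>"
  shows "Chi E (par E x) = {x}"
proof -
  have "card (Chi E (par E x)) = 1" using assms par_in_V by (intro non_branching) auto
  moreover have "x \<in> Chi E (par E x)" using assms by (simp add: Chi_iff)
  ultimately show ?thesis by (auto simp: card_1_singleton_iff)
qed

lemma Chi_up: "has_up (Suc j) \<Longrightarrow> Chi E (up (Suc j)) = {up j}"
  using up_ne_omega[of "Suc j"] Chi_par[of "up j"] by (simp add: has_up_Suc)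

lemma path_weight_Suc:
  assumes "has_up (Suc k)"
  shows "ennreal ((cmod (lam (up k)))\<^sup>2) * path_weight (Suc k) = path_weight k"
  using nonzero[of "up k"] assms
  by (simp add: path_weight_def has_up_Suc norm_mult power_mult_distrib flip: ennreal_mult')

text \<open>For an only child, \<open>mom x n\<close> is \<open>mom (par E x) (Suc n)\<close>
  divided by \<open>(cmod (lam x))\<^sup>2\<close>, so a multiple of \<open>s d\<mu>\<close> of the
  parent represents it. Moment sequences thus descend along the chain to \<omega>, which explains
  why (ii-b) mentions only the root and (iii-b) only infinitely many ancestors.\<close>

lemma stieltjes_single_child:
  assumes x: "x \<in> nonroots V E" and C: "Chi E (par E x) = {x}" and st: "stieltjes_at (par E x)"
  shows "stieltjes_at x"
proof -
  let ?c = "(cmod (lam x))\<^sup>2" and ?M = "\<mu> (par E x)"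
  have c: "0 < ?c" using nonzero[OF x] by simp
  have u: "par E x \<in> V" using x by (rule par_in_V)
  have rep: "represents ?M (mom (par E x))" using u st by (rule shift_measure_represents)
  note rm = represents_measurable[OF rep]
  have "represents (density ?M (\<lambda>s. ennreal (s / ?c))) (mom x)"
  proof (rule representsI)
    fix n
    have "(\<integral>\<^sup>+s. ennreal (s ^ n) \<partial>density ?M (\<lambda>s. ennreal (s / ?c)))
      = (\<integral>\<^sup>+s. ennreal (s / ?c) * ennreal (s ^ n) \<partial>?M)"
      by (intro nn_integral_density rm) measurable
    also have "\<dots> = (\<integral>\<^sup>+s. ennreal (1 / ?c) * ennreal (s ^ Suc n) \<partial>?M)"
      using represents_space[OF rep] c
      by (intro nn_integral_cong) (auto simp: mult.commute simp flip: ennreal_mult)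
    also have "\<dots> = ennreal (1 / ?c) * ennreal (mom (par E x) (Suc n))"
      unfolding represents_nn_integral[OF rep, symmetric] by (intro nn_integral_cmult rm) measurable
    also have "\<dots> = ennreal (1 / ?c) * (ennreal ?c * ennreal (mom x n))"
      unfolding mom_Suc[OF u] C by (simp add: nn_integral_count_space_finite)
    also have "\<dots> = ennreal (1 / ?c * (?c * mom x n))"
      using c mom_nonneg by (simp only: ennreal_mult zero_le_divide_iff mult_nonneg_nonneg less_imp_le zero_le_one simp_thms)
    also have "1 / ?c * (?c * mom x n) = mom x n" using c by simp
    finally show "(\<integral>\<^sup>+s. ennreal (s ^ n) \<partial>density ?M (\<lambda>s. ennreal (s / ?c))) = ennreal (mom x n)" .
  qed (use rep in \<open>auto simp: represents_def mom_nonneg\<close>)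
  then show ?thesis by (auto simp: stieltjes_moment_sequence_def)
qed

lemma stieltjes_up:
  assumes "has_up K" "stieltjes_at (up K)" "j \<le> K"
  shows "stieltjes_at (up j)"
  using assms
proof (induction K)
  case (Suc K)
  show ?case
  proof (cases "j = Suc K")
    case False
    have hK: "has_up K" and x: "up K \<in> nonroots V E" using Suc.prems(1) by (simp_all add: has_up_Suc)
    have "stieltjes_at (up K)"
      using stieltjes_single_child[OF x] Chi_up[OF Suc.prems(1)] Suc.prems(2) by simp
    from Suc.IH[OF hK this] show ?thesis using Suc.prems(3) False by linarith
  qed (use Suc.prems in simp)
qed simp

text \<open>The atom at 0 is left out because \<open>s d\<mu>\<close> does not see it; for
  \<open>m = 0\<close> this is the mass of the open half line.\<close>

definition "negative_moment u m = (\<integral>\<^sup>+s. (if s = 0 then 0 else 1 / ennreal (s ^ m)) \<partial>\<mu> u)"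

text \<open>Integrates \<open>1 / s ^ Suc m\<close> against both descriptions of the measure
  \<open>s d\<mu>\<close> at \<open>u\<close>.\<close>

lemma negative_moment_eq:
  assumes u: "u \<in> V" and su: "stieltjes_at u" and sc: "\<And>v. v \<in> Chi E u \<Longrightarrow> stieltjes_at v"
  shows "negative_moment u m = inverse_moment_sum V E lam u (Suc m)"
proof -
  have rep: "represents (\<mu> u) (mom u)" using u su by (rule shift_measure_represents)
  \<comment> \<open>At \<open>s = 0\<close> the right side is \<open>0 * \<infinity> = 0\<close>, in
    agreement with the omitted atom.\<close>
  have "(if s = 0 then 0 else 1 / ennreal (s ^ m)) = ennreal s * (1 / ennreal (s ^ Suc m))"
    if "0 \<le> s" for s
    using that by (cases "s = 0") (simp_all add: divide_ennreal flip: ennreal_mult ennreal_1)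
  then have "negative_moment u m = (\<integral>\<^sup>+s. ennreal s * (1 / ennreal (s ^ Suc m)) \<partial>\<mu> u)"
    unfolding negative_moment_def using represents_space[OF rep] by (intro nn_integral_cong) auto
  also have "\<dots> = inverse_moment_sum V E lam u (Suc m)"
    unfolding inverse_moment_sum_def infsum_ennreal_eq_nn_integral
    by (intro nn_integral_shift_measure u su sc measurable_restrict_space1) measurable
  finally show ?thesis .
qed

lemma negative_moment_0_le:
  assumes "u \<in> V" "stieltjes_at u"
  shows "negative_moment u 0 \<le> 1"
proof -
  have rep: "represents (\<mu> u) (mom u)" using assms by (rule shift_measure_represents)
  have "negative_moment u 0 \<le> (\<integral>\<^sup>+s. ennreal (s ^ 0) \<partial>\<mu> u)"
    unfolding negative_moment_def by (intro nn_integral_mono) (auto simp flip: ennreal_1 simp: divide_ennreal)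
  then show ?thesis unfolding represents_nn_integral[OF rep] using assms by (simp add: mom_0)
qed

text \<open>The source of all equalities: \<open>s d\<mu>\<close> of the parent has no atom at 0 and
  is a nonzero multiple of \<open>\<mu> x\<close>. So \<open>\<mu> x\<close> has no atom at 0
  either, and its whole mass 1 lies on the open half line. For the topmost vertex only
  \<open>negative_moment_0_le\<close> is left.\<close>

lemma negative_moment_par:
  assumes x: "x \<in> nonroots V E" and C: "Chi E (par E x) = {x}" and st: "stieltjes_at (par E x)"
  shows "negative_moment (par E x) m = ennreal ((cmod (lam x))\<^sup>2) * negative_moment x (Suc m)"
    and "negative_moment x 0 = 1"
proof -
  have sx: "stieltjes_at x" using assms by (rule stieltjes_single_child)
  have xV: "x \<in> V" and u: "par E x \<in> V" using x nonrootsD par_in_V by auto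
  have rep: "represents (\<mu> x) (mom x)" using xV sx by (rule shift_measure_represents)
  have repu: "represents (\<mu> (par E x)) (mom (par E x))" using u st by (rule shift_measure_represents)
  have eq: "(\<integral>\<^sup>+s. ennreal s * f s \<partial>\<mu> (par E x)) = ennreal ((cmod (lam x))\<^sup>2) * (\<integral>\<^sup>+s. f s \<partial>\<mu> x)"
    if "f \<in> borel_measurable borel" for f
    using nn_integral_shift_measure[OF u st, of f] that sx
    by (simp add: C nn_integral_count_space_finite measurable_restrict_space1)
  let ?g = "\<lambda>m s. (if s = 0 then 0 else 1 / ennreal (s ^ m))"
  have "ennreal s * ?g (Suc m) s = ?g m s" if "0 \<le> s" for s
    using that by (cases "s = 0") (simp_all add: divide_ennreal flip: ennreal_mult ennreal_1)
  then have "negative_moment (par E x) m = (\<integral>\<^sup>+s. ennreal s * ?g (Suc m) s \<partial>\<mu> (par E x))"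
    unfolding negative_moment_def using represents_space[OF repu] by (intro nn_integral_cong) auto
  also have "\<dots> = ennreal ((cmod (lam x))\<^sup>2) * negative_moment x (Suc m)"
    unfolding negative_moment_def by (rule eq) measurable
  finally show "negative_moment (par E x) m = ennreal ((cmod (lam x))\<^sup>2) * negative_moment x (Suc m)" .
  have "(\<integral>\<^sup>+s. ennreal s * indicator {0} s \<partial>\<mu> (par E x)) = (\<integral>\<^sup>+s. 0 \<partial>\<mu> (par E x))"
    by (intro nn_integral_cong) (auto simp: indicator_def)
  then have z: "(\<integral>\<^sup>+s. indicator {0} s \<partial>\<mu> x) = 0"
    using eq[of "indicator {0}"] nonzero[OF x] by simp
  have "(indicator {0} :: real \<Rightarrow> ennreal) \<in> borel_measurable (\<mu> x)"
    by (rule represents_measurable[OF rep]) measurable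
  then have "AE s in \<mu> x. (indicator {0} s :: ennreal) = 0" using z by (simp add: nn_integral_0_iff_AE)
  then have "AE s in \<mu> x. ?g 0 s = ennreal (s ^ 0)"
    by eventually_elim (auto simp: indicator_def divide_ennreal simp flip: ennreal_1 split: if_splits)
  then have "negative_moment x 0 = (\<integral>\<^sup>+s. ennreal (s ^ 0) \<partial>\<mu> x)"
    unfolding negative_moment_def by (rule nn_integral_cong_AE)
  then show "negative_moment x 0 = 1" unfolding represents_nn_integral[OF rep] using xV by (simp add: mom_0)
qed

text \<open>Climbing from \<omega> gives
  \<open>inv_sum (Suc k) = path_weight k * negative_moment (up k) 0\<close>. The last factor is 1
  when the parent of \<open>up k\<close> also has a moment sequence, and at most 1 at the end of the
  chain.\<close>

lemma inv_sum_path_weight: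
  assumes up: "has_up K" and st: "stieltjes_at (up K)" and sc: "\<And>v. v \<in> Chi E \<omega> \<Longrightarrow> stieltjes_at v"
  shows "\<And>k. k < K \<Longrightarrow> inv_sum (Suc k) = path_weight k" and "inv_sum (Suc K) \<le> path_weight K"
proof -
  have sj: "stieltjes_at (up j)" if "j \<le> K" for j using stieltjes_up up st that by blast
  have inv: "inv_sum (Suc k) = negative_moment \<omega> k" for k
    using sj[of 0] omega sc by (simp add: negative_moment_eq)
  \<comment> \<open>Stated for all \<open>m\<close>, since each step up lowers the order of the
    negative moment by one.\<close>
  have nm: "negative_moment \<omega> (m + i) = path_weight i * negative_moment (up i) m" if "i \<le> K" for i m
    using that
  proof (induction i arbitrary: m)
    case 0
    then show ?case by (simp add: path_weight_def)
  next
    case (Suc i)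
    have hi: "has_up (Suc i)" using up Suc.prems by (rule has_up_mono)
    then have x: "up i \<in> nonroots V E" by (simp add: has_up_Suc)
    have "negative_moment \<omega> (m + Suc i) = path_weight i * negative_moment (up i) (Suc m)"
      using Suc.IH[of "Suc m"] Suc.prems by simp
    also have "\<dots> = path_weight (Suc i) * (ennreal ((cmod (lam (up i)))\<^sup>2) * negative_moment (up i) (Suc m))"
      unfolding path_weight_Suc[OF hi, symmetric] by (simp add: ac_simps)
    also have "\<dots> = path_weight (Suc i) * negative_moment (up (Suc i)) m"
      using negative_moment_par(1)[OF x, of m] Chi_up[OF hi] sj[OF Suc.prems] by simp
    finally show ?case .
  qed
  show "inv_sum (Suc k) = path_weight k" if k: "k < K" for k
  proof -
    have hk: "has_up (Suc k)" using has_up_mono[OF up, of "Suc k"] k by simp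
    have x: "up k \<in> nonroots V E" using hk by (simp add: has_up_Suc)
    have "stieltjes_at (up (Suc k))" using k by (intro sj) simp
    then have "negative_moment (up k) 0 = 1"
      using negative_moment_par(2)[OF x] Chi_up[OF hk] by simp
    then show ?thesis using nm[of k 0] k by (simp add: inv)
  qed
  have "path_weight K * negative_moment (up K) 0 \<le> path_weight K * 1"
    using up sj by (intro mult_left_mono negative_moment_0_le up_in_V) auto
  then show "inv_sum (Suc K) \<le> path_weight K" using nm[of K 0] by (simp add: inv)
qed

end


section \<open>A normal operator moving between the levels of a two-sided sequence of
  measures\<close>

section \<open>A normal bilateral shift\<close>

abbreviation "halfline \<equiv> restrict_space borel {0..} :: real measure"

text \<open>\<open>step\<close> says that off the point 0 the next level is \<open>s\<close> times
  the present one. At 0 the levels are unrelated, which leaves room for atoms.\<close>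

locale bilateral_shift =
  fixes \<kappa> :: "int \<times> 'b \<Rightarrow> real measure" and C :: real
  assumes sets_kappa: "\<And>i. sets (\<kappa> i) = sets halfline"
    and step: "\<And>n b g. g \<in> borel_measurable halfline \<Longrightarrow>
      (\<integral>\<^sup>+s. ennreal s * g s \<partial>\<kappa> (n, b)) = (\<integral>\<^sup>+s. (if 0 < s then g s else 0) \<partial>\<kappa> (n + 1, b))"
    and C_nonneg: "0 \<le> C"
    and bound: "\<And>i. AE s in \<kappa> i. s \<le> C"
begin

definition "M = direct_sum_measure halfline \<kappa>"

text \<open>The cut-off at \<open>s = 0\<close> is forced, as an atom at 0 on level \<open>n\<close>
  is not controlled by level \<open>n - 1\<close>. With it, \<open>T (T' f)\<close> and
  \<open>T' (T f)\<close> are both multiplication by \<open>s\<close>.\<close>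

definition T :: "((int \<times> 'b) \<times> real \<Rightarrow> complex) \<Rightarrow> (int \<times> 'b) \<times> real \<Rightarrow> complex" where
  "T f = (\<lambda>((n, b), s). if 0 < s then f ((n - 1, b), s) else 0)"

definition T' :: "((int \<times> 'b) \<times> real \<Rightarrow> complex) \<Rightarrow> (int \<times> 'b) \<times> real \<Rightarrow> complex" where
  "T' f = (\<lambda>((n, b), s). complex_of_real s * f ((n + 1, b), s))"

definition next_level :: "(int \<times> 'b) \<times> real \<Rightarrow> (int \<times> 'b) \<times> real" where
  "next_level = (\<lambda>((n, b), s). ((n + 1, b), s))"

lemma space_M: "space M = UNIV \<times> {0..}"
  by (simp add: M_def space_restrict_space)

lemma measurable_M: "f \<in> measurable M L \<longleftrightarrow> (\<forall>i. (\<lambda>s. f (i, s)) \<in> measurable halfline L)"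
  unfolding M_def using measurable_direct_sum_measureI measurable_direct_sum_section by metis

lemma nn_integral_M:
  assumes "f \<in> borel_measurable M"
  shows "(\<integral>\<^sup>+x. f x \<partial>M) = (\<integral>\<^sup>+b. \<integral>\<^sup>+n. \<integral>\<^sup>+s. f ((n, b), s) \<partial>\<kappa> (n, b) \<partial>count_space UNIV \<partial>count_space UNIV)"
  using nn_integral_direct_sum_measure[OF sets_kappa, of f] assms
    nn_integral_snd_count_space[of "\<lambda>i. \<integral>\<^sup>+s. f (i, s) \<partial>\<kappa> i"]
  by (simp add: M_def)

lemma nn_integral_shift_int:
  "(\<integral>\<^sup>+n. F (n + 1 :: int) \<partial>count_space UNIV) = (\<integral>\<^sup>+n. F n \<partial>count_space UNIV)"
  by (rule nn_integral_bij_count_space[of "\<lambda>n::int. n + 1"])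
    (rule bij_betwI[of _ _ _ "\<lambda>n. n - 1"], auto)

lemma measurable_pos: "Measurable.pred halfline (\<lambda>s. 0 < s)"
  by (intro measurable_restrict_space1) measurable

lemma measurable_snd_M: "snd \<in> borel_measurable M"
  unfolding measurable_M by (auto intro!: measurable_restrict_space1)

text \<open>\<open>step\<close> summed over all levels and branches. Both norm bounds and the
  adjoint relation are instances of this change of variables.\<close>

lemma nn_integral_next_level:
  assumes h: "h \<in> borel_measurable M"
  shows "(\<integral>\<^sup>+x. ennreal (snd x) * h (next_level x) \<partial>M) = (\<integral>\<^sup>+x. (if 0 < snd x then h x else 0) \<partial>M)"
proof -
  have hs: "(\<lambda>s. h (i, s)) \<in> borel_measurable halfline" for i using h unfolding measurable_M by blast
  have "ennreal \<in> borel_measurable halfline" by (intro measurable_restrict_space1) simp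
  then have m1: "(\<lambda>x. ennreal (snd x) * h (next_level x)) \<in> borel_measurable M"
    unfolding measurable_M using hs by (auto simp: next_level_def)
  have m2: "(\<lambda>x. if 0 < snd x then h x else 0) \<in> borel_measurable M"
    unfolding measurable_M using hs measurable_pos by auto
  show ?thesis
    unfolding nn_integral_M[OF m1] nn_integral_M[OF m2]
    using nn_integral_shift_int[of "\<lambda>n. \<integral>\<^sup>+s. (if 0 < s then h ((n, _), s) else 0) \<partial>\<kappa> (n, _)"]
    by (simp add: next_level_def step[OF hs])
qed

lemma measurable_next_level: "next_level \<in> measurable M M"
proof (rule measurableI)
  fix A assume "A \<in> sets M"
  then have A: "A \<subseteq> UNIV \<times> {0..}" "\<And>i. Pair i -` A \<in> sets halfline"
    by (auto simp: M_def sets_direct_sum_measure space_restrict_space)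
  have "Pair (n, b) -` (next_level -` A \<inter> space M) = Pair (n + 1, b) -` A" for n b
    using A(1) by (auto simp: next_level_def space_M)
  then have "Pair i -` (next_level -` A \<inter> space M) \<in> sets halfline" for i
    using A(2) by (cases i) simp
  then show "next_level -` A \<inter> space M \<in> sets M"
    by (auto simp: M_def sets_direct_sum_measure space_restrict_space)
qed (auto simp: space_M next_level_def)

lemma T_eq: "T f x = (if 0 < snd x then f ((fst (fst x) - 1, snd (fst x)), snd x) else 0)"
  by (simp add: T_def split_beta)

lemma T'_eq: "T' f x = complex_of_real (snd x) * f (next_level x)"
  by (simp add: T'_def next_level_def split_beta)

lemma T_next_level: "T f (next_level x) = (if 0 < snd x then f x else 0)"
  by (simp add: T_eq next_level_def split_beta)

lemma measurable_T: "f \<in> borel_measurable M \<Longrightarrow> T f \<in> borel_measurable M"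
proof -
  assume f: "f \<in> borel_measurable M"
  have fs: "(\<lambda>s. f (i, s)) \<in> borel_measurable halfline" for i using f unfolding measurable_M by blast
  show ?thesis
    unfolding measurable_M T_def
    using measurable_If[OF fs borel_measurable_const measurable_pos[unfolded pred_def]] by auto
qed

lemma measurable_T': "f \<in> borel_measurable M \<Longrightarrow> T' f \<in> borel_measurable M"
proof -
  assume f: "f \<in> borel_measurable M"
  have "(\<lambda>s. complex_of_real s) \<in> borel_measurable halfline" by (intro measurable_restrict_space1) simp
  moreover have "(\<lambda>s. f (i, s)) \<in> borel_measurable halfline" for i using f unfolding measurable_M by blast
  ultimately show ?thesis unfolding measurable_M T'_def by (auto intro: borel_measurable_times)
qed

lemma AE_M_le: "AE x in M. snd x \<le> C"
  unfolding M_def by (rule AE_direct_sum_measureI[OF sets_kappa]) (simp add: bound)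

lemma T_bound:
  assumes f: "f \<in> borel_measurable M"
  shows "(\<integral>\<^sup>+x. ennreal ((cmod (T f x))\<^sup>2) \<partial>M) \<le> ennreal C * (\<integral>\<^sup>+x. ennreal ((cmod (f x))\<^sup>2) \<partial>M)"
proof -
  let ?h = "\<lambda>x. ennreal ((cmod (T f x))\<^sup>2)"
  have h: "?h \<in> borel_measurable M" using measurable_T[OF f] by simp
  have "(\<integral>\<^sup>+x. ?h x \<partial>M) = (\<integral>\<^sup>+x. (if 0 < snd x then ?h x else 0) \<partial>M)"
    by (intro nn_integral_cong) (auto simp: T_eq)
  also have "\<dots> = (\<integral>\<^sup>+x. ennreal (snd x) * ?h (next_level x) \<partial>M)"
    using nn_integral_next_level[OF h] by simp
  also have "\<dots> \<le> (\<integral>\<^sup>+x. ennreal C * ennreal ((cmod (f x))\<^sup>2) \<partial>M)"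
  proof (rule nn_integral_mono_AE)
    show "AE x in M. ennreal (snd x) * ?h (next_level x) \<le> ennreal C * ennreal ((cmod (f x))\<^sup>2)"
      using AE_M_le by eventually_elim (auto simp: T_next_level intro!: mult_mono ennreal_leI)
  qed
  also have "\<dots> = ennreal C * (\<integral>\<^sup>+x. ennreal ((cmod (f x))\<^sup>2) \<partial>M)"
    using f by (intro nn_integral_cmult) simp
  finally show ?thesis .
qed

lemma T'_bound:
  assumes f: "f \<in> borel_measurable M"
  shows "(\<integral>\<^sup>+x. ennreal ((cmod (T' f x))\<^sup>2) \<partial>M) \<le> ennreal C * (\<integral>\<^sup>+x. ennreal ((cmod (f x))\<^sup>2) \<partial>M)"
proof -
  let ?h = "\<lambda>x. ennreal (snd x) * ennreal ((cmod (f x))\<^sup>2)"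
  have h: "?h \<in> borel_measurable M" using f measurable_snd_M by simp
  have "ennreal ((cmod (T' f x))\<^sup>2) = ennreal (snd x) * ?h (next_level x)" if "x \<in> space M" for x
  proof -
    have "0 \<le> snd x" "snd (next_level x) = snd x"
      using that by (auto simp: space_M next_level_def)
    moreover have "(cmod (T' f x))\<^sup>2 = snd x * (snd x * (cmod (f (next_level x)))\<^sup>2)"
      by (simp add: T'_eq norm_mult power_mult_distrib power2_eq_square ac_simps)
    ultimately show ?thesis by (simp add: ennreal_mult)
  qed
  then have "(\<integral>\<^sup>+x. ennreal ((cmod (T' f x))\<^sup>2) \<partial>M) = (\<integral>\<^sup>+x. ennreal (snd x) * ?h (next_level x) \<partial>M)"
    by (intro nn_integral_cong) auto
  also have "\<dots> = (\<integral>\<^sup>+x. (if 0 < snd x then ?h x else 0) \<partial>M)" by (rule nn_integral_next_level[OF h])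
  also have "\<dots> \<le> (\<integral>\<^sup>+x. ennreal C * ennreal ((cmod (f x))\<^sup>2) \<partial>M)"
  proof (rule nn_integral_mono_AE)
    show "AE x in M. (if 0 < snd x then ?h x else 0) \<le> ennreal C * ennreal ((cmod (f x))\<^sup>2)"
      using AE_M_le by eventually_elim (auto intro!: mult_right_mono ennreal_leI)
  qed
  also have "\<dots> = ennreal C * (\<integral>\<^sup>+x. ennreal ((cmod (f x))\<^sup>2) \<partial>M)"
    using f by (intro nn_integral_cmult) simp
  finally show ?thesis .
qed

lemma T_linear: "T (\<lambda>x. f x + g x) = (\<lambda>x. T f x + T g x)" "T (\<lambda>x. c * f x) = (\<lambda>x. c * T f x)"
  by (auto simp: T_eq fun_eq_iff)

lemma T'_linear: "T' (\<lambda>x. f x + g x) = (\<lambda>x. T' f x + T' g x)" "T' (\<lambda>x. c * f x) = (\<lambda>x. c * T' f x)"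
  by (auto simp: T'_eq fun_eq_iff algebra_simps)

lemma T_operator: "bounded_operator (L2 M) (\<lambda>f. L2_rep M (T f))"
  and T'_operator: "bounded_operator (L2 M) (\<lambda>f. L2_rep M (T' f))"
  by (rule L2_bounded_operator(2);
      (assumption | rule T_linear T'_linear measurable_T measurable_T' T_bound T'_bound C_nonneg)+)+

lemma
  assumes "f \<in> borel_measurable M" "g \<in> borel_measurable M" "AE x in M. f x = g x"
  shows T_cong: "AE x in M. T f x = T g x" and T'_cong: "AE x in M. T' f x = T' g x"
proof -
  show "AE x in M. T f x = T g x"
    by (rule L2_operator_cong[where T = T and f = f and g = g];
      (assumption | rule assms T_linear measurable_T T_bound C_nonneg)+)
  show "AE x in M. T' f x = T' g x"
    by (rule L2_operator_cong[where T = T' and f = f and g = g];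
      (assumption | rule assms T'_linear measurable_T' T'_bound C_nonneg)+)
qed

text \<open>Recasts the identity for nonnegative integrals as an equality of measures, in which form
  it applies to complex integrands.\<close>

lemma density_next_level:
  "density M (\<lambda>x. ennreal (if 0 < snd x then 1 else 0))
    = distr (density M (\<lambda>x. ennreal (snd x))) M next_level"
proof (rule measure_eqI)
  fix A assume "A \<in> sets (density M (\<lambda>x. ennreal (if 0 < snd x then 1 else 0)))"
  then have A: "A \<in> sets M" by simp
  have pm: "(\<lambda>x. ennreal (if 0 < snd x then 1 else 0)) \<in> borel_measurable M"
    using measurable_pos by (auto simp: measurable_M)
  have sm: "(\<lambda>x. ennreal (snd x)) \<in> borel_measurable M" using measurable_snd_M by simp
  have nA: "next_level -` A \<inter> space M \<in> sets M" using measurable_next_level A by (rule measurable_sets)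
  have "emeasure (density M (\<lambda>x. ennreal (if 0 < snd x then 1 else 0))) A
    = (\<integral>\<^sup>+x. (if 0 < snd x then indicator A x else 0) \<partial>M)"
    using pm A by (auto simp: emeasure_density intro!: nn_integral_cong)
  also have "\<dots> = (\<integral>\<^sup>+x. ennreal (snd x) * indicator A (next_level x) \<partial>M)"
    using A by (intro nn_integral_next_level[symmetric]) simp
  also have "\<dots> = (\<integral>\<^sup>+x. ennreal (snd x) * indicator (next_level -` A \<inter> space M) x \<partial>M)"
    by (intro nn_integral_cong) (auto simp: indicator_def)
  also have "\<dots> = emeasure (distr (density M (\<lambda>x. ennreal (snd x))) M next_level) A"
    using A sm nA measurable_next_level by (simp add: emeasure_distr emeasure_density)
  finally show "emeasure (density M (\<lambda>x. ennreal (if 0 < snd x then 1 else 0))) A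
    = emeasure (distr (density M (\<lambda>x. ennreal (snd x))) M next_level) A" .
qed simp

lemma integral_T_adjoint:
  assumes f: "f \<in> borel_measurable M" and g: "g \<in> borel_measurable M"
  shows "(\<integral>x. T f x * cnj (g x) \<partial>M) = (\<integral>x. f x * cnj (T' g x) \<partial>M)"
proof -
  have cm: "(\<lambda>x. cnj (h x)) \<in> borel_measurable M" if "h \<in> borel_measurable M" for h
    using that by (rule borel_measurable_continuous_on[rotated]) (intro continuous_intros)
  let ?h = "\<lambda>x. T f x * cnj (g x)"
  have h: "?h \<in> borel_measurable M" using measurable_T[OF f] cm[OF g] by simp
  have nn: "AE x in M. 0 \<le> snd x" by (rule AE_I2) (auto simp: space_M)
  have hn: "(\<lambda>x. ?h (next_level x)) \<in> borel_measurable M"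
    using measurable_compose[OF measurable_next_level h] .
  have pm: "(\<lambda>x. if 0 < snd x then 1 else 0 :: real) \<in> borel_measurable M"
    using measurable_pos by (auto simp: measurable_M)
  have "(\<integral>x. ?h x \<partial>M) = (\<integral>x. (if 0 < snd x then 1 else 0 :: real) *\<^sub>R ?h x \<partial>M)"
    by (intro Bochner_Integration.integral_cong) (auto simp: T_eq)
  also have "\<dots> = (\<integral>x. ?h x \<partial>density M (\<lambda>x. ennreal (if 0 < snd x then 1 else 0)))"
    using h pm by (intro integral_density[symmetric]) auto
  also have "\<dots> = (\<integral>x. ?h (next_level x) \<partial>density M (\<lambda>x. ennreal (snd x)))"
    unfolding density_next_level using measurable_next_level h by (subst integral_distr) auto
  also have "\<dots> = (\<integral>x. snd x *\<^sub>R ?h (next_level x) \<partial>M)"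
    using hn measurable_snd_M nn by (intro integral_density) auto
  also have "\<dots> = (\<integral>x. f x * cnj (T' g x) \<partial>M)"
    by (intro Bochner_Integration.integral_cong)
      (auto simp: T_next_level T'_eq scaleR_conv_of_real space_M)
  finally show ?thesis .
qed

definition "N f = L2_rep M (T f)"
definition "N' f = L2_rep M (T' f)"

lemma N_rep:
  assumes f: "f \<in> borel_measurable M"
  shows "N (L2_rep M f) = L2_rep M (T f)" "N' (L2_rep M f) = L2_rep M (T' f)"
  unfolding N_def N'_def
  using T_cong[OF L2_rep_measurable[OF f] f L2_rep_AE[OF f]]
    T'_cong[OF L2_rep_measurable[OF f] f L2_rep_AE[OF f]]
  by (auto intro: L2_rep_cong)

lemma N_normal: "normal_operator (L2 M) N"
  unfolding normal_operator_def
proof (intro conjI exI[of _ N'])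
  show "bounded_operator (L2 M) N" "bounded_operator (L2 M) N'"
    unfolding N_def[abs_def] N'_def[abs_def] by (rule T_operator, rule T'_operator)
  show "is_adjoint (L2 M) N N'"
    unfolding is_adjoint_def
  proof (intro ballI)
    fix f g assume "f \<in> hset (L2 M)" "g \<in> hset (L2 M)"
    then have fg: "f \<in> borel_measurable M" "g \<in> borel_measurable M" by (auto dest: hset_L2D)
    have cm: "(\<lambda>x. cnj (h x)) \<in> borel_measurable M" if "h \<in> borel_measurable M" for h
      using that by (rule borel_measurable_continuous_on[rotated]) (intro continuous_intros)
    note meas = measurable_T[OF fg(1)] measurable_T'[OF fg(2)]
    have "(\<integral>x. N f x * cnj (g x) \<partial>M) = (\<integral>x. T f x * cnj (g x) \<partial>M)"
    proof (rule integral_cong_AE)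
      show "AE x in M. N f x * cnj (g x) = T f x * cnj (g x)"
        unfolding N_def using L2_rep_AE[OF meas(1)] by eventually_elim simp
    qed (use fg meas L2_rep_measurable[OF meas(1)] cm in \<open>auto simp: N_def\<close>)
    also have "\<dots> = (\<integral>x. f x * cnj (T' g x) \<partial>M)" using fg by (rule integral_T_adjoint)
    also have "\<dots> = (\<integral>x. f x * cnj (N' g x) \<partial>M)"
    proof (rule integral_cong_AE)
      show "AE x in M. f x * cnj (T' g x) = f x * cnj (N' g x)"
        unfolding N'_def using L2_rep_AE[OF meas(2)] by eventually_elim simp
    qed (use fg meas L2_rep_measurable[OF meas(2)] cm in \<open>auto simp: N'_def\<close>)
    finally show "hinner (L2 M) (N f) g = hinner (L2 M) f (N' g)" unfolding L2_simps .
  qed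
  show "\<forall>f\<in>hset (L2 M). N (N' f) = N' (N f)"
  proof
    fix f assume "f \<in> hset (L2 M)"
    then have f: "f \<in> borel_measurable M" by (auto dest: hset_L2D)
    have "AE x in M. T (T' f) x = T' (T f) x"
    proof (rule AE_I2)
      fix x assume "x \<in> space M"
      then show "T (T' f) x = T' (T f) x"
        by (auto simp: T'_eq T_next_level) (auto simp: T_eq T'_eq next_level_def space_M split: prod.splits)
    qed
    then have "L2_rep M (T (T' f)) = L2_rep M (T' (T f))" by (rule L2_rep_cong)
    then show "N (N' f) = N' (N f)"
      unfolding N'_def[of f] N_def[of f]
      using N_rep(1)[OF measurable_T'[OF f]] N_rep(2)[OF measurable_T[OF f]] by simp
  qed
qed

end


section \<open>The tree as a trunk above \<omega> and one ray below each child of \<omega>\<close>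

section \<open>The vertices of a tree with one branching vertex\<close>

context one_branching_shift
begin

text \<open>Meaningful only below the children of \<omega>, where each set of children is a
  singleton.\<close>

primrec desc :: "nat \<Rightarrow> 'v \<Rightarrow> 'v" where
  "desc 0 v = v"
| "desc (Suc m) v = the_elem (Chi E (desc m v))"

text \<open>The coefficient of the basis vector of \<open>desc m v\<close> in
  \<open>(S ^^ Suc m) (unit_vec \<omega>)\<close>.\<close>

primrec wt :: "nat \<Rightarrow> 'v \<Rightarrow> complex" where
  "wt 0 v = lam v"
| "wt (Suc m) v = wt m v * lam (desc (Suc m) v)"

text \<open>A ray cannot come back to \<omega>, since that would close a cycle; so its current end
  has exactly one child and the induction can go on.\<close>

lemma desc_facts:
  assumes v: "v \<in> Chi E \<omega>"
  shows "(\<forall>j<Suc m. (par E ^^ j) (desc m v) \<in> nonroots V E) \<and> (par E ^^ m) (desc m v) = v"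
proof (induction m)
  case 0
  then show ?case using v by (simp add: Chi_iff)
next
  case (Suc m)
  let ?w = "desc m v"
  have w: "?w \<in> V" using Suc nonrootsD[of ?w] by auto
  have om: "(par E ^^ Suc m) ?w = \<omega>" using Suc v by (simp add: Chi_iff)
  have "?w \<noteq> \<omega>" using par_no_cycle[of "Suc m" ?w] Suc om by auto
  then have "card (Chi E ?w) = 1" using w non_branching by simp
  then obtain w' where w': "Chi E ?w = {w'}" by (auto simp: card_1_singleton_iff)
  then have "desc (Suc m) v = w'" by simp
  moreover have "w' \<in> nonroots V E" "par E w' = ?w" using w' ChiD[of w' ?w] by auto
  ultimately have p: "desc (Suc m) v \<in> nonroots V E" "par E (desc (Suc m) v) = ?w" by auto
  have pp: "(par E ^^ Suc j) (desc (Suc m) v) = (par E ^^ j) ?w" for j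
    unfolding funpow_Suc_right comp_apply p(2) ..
  have "(par E ^^ j) (desc (Suc m) v) \<in> nonroots V E" if "j < Suc (Suc m)" for j
  proof (cases j)
    case (Suc i)
    then show ?thesis using pp[of i] \<open>_ \<and> _\<close> that by simp
  qed (use p in simp)
  then show ?case using pp[of m] Suc by simp
qed

lemma
  assumes v: "v \<in> Chi E \<omega>"
  shows desc_nonroot: "desc m v \<in> nonroots V E" and desc_in_V: "desc m v \<in> V"
    and par_desc: "(par E ^^ Suc m) (desc m v) = \<omega>" and desc_ne_omega: "desc m v \<noteq> \<omega>"
    and desc_up: "j < Suc m \<Longrightarrow> (par E ^^ j) (desc m v) \<in> nonroots V E"
    and par_desc_top: "(par E ^^ m) (desc m v) = v"
proof -
  note d = desc_facts[OF v, of m]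
  show nr: "desc m v \<in> nonroots V E" using d by auto
  then show "desc m v \<in> V" using nonrootsD by blast
  show t: "(par E ^^ m) (desc m v) = v" using d by simp
  then show om: "(par E ^^ Suc m) (desc m v) = \<omega>" using v by (simp add: Chi_iff)
  then show "desc m v \<noteq> \<omega>" using par_no_cycle[of "Suc m" "desc m v"] d by auto
  show "j < Suc m \<Longrightarrow> (par E ^^ j) (desc m v) \<in> nonroots V E" using d by blast
qed

lemma Chi_desc:
  assumes v: "v \<in> Chi E \<omega>"
  shows "Chi E (desc m v) = {desc (Suc m) v}"
proof -
  have "card (Chi E (desc m v)) = 1" using desc_in_V[OF v] desc_ne_omega[OF v] non_branching by simp
  then obtain w where "Chi E (desc m v) = {w}" by (rule card_1_singletonE)
  then show ?thesis by simp
qed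

lemma par_desc_Suc: "v \<in> Chi E \<omega> \<Longrightarrow> par E (desc (Suc m) v) = desc m v"
proof -
  assume "v \<in> Chi E \<omega>"
  then have "desc (Suc m) v \<in> Chi E (desc m v)" using Chi_desc by blast
  then show "par E (desc (Suc m) v) = desc m v" using ChiD by blast
qed

lemma wt_nonzero: "v \<in> Chi E \<omega> \<Longrightarrow> wt m v \<noteq> 0"
proof (induction m)
  case (Suc m)
  then show ?case using nonzero[OF desc_nonroot[of v "Suc m"]] by simp
qed (simp add: nonzero Chi_iff)

lemma mom_wt:
  assumes v: "v \<in> Chi E \<omega>"
  shows "ennreal ((cmod (lam v))\<^sup>2) * ennreal (mom v m) = ennreal ((cmod (wt m v))\<^sup>2)"
proof -
  \<comment> \<open>Stated for all \<open>n\<close>, the number of steps still to be made below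
    \<open>desc m v\<close>.\<close>
  have "ennreal ((cmod (lam v))\<^sup>2) * ennreal (mom v (n + m)) = ennreal ((cmod (wt m v))\<^sup>2) * ennreal (mom (desc m v) n)" for n
  proof (induction m arbitrary: n)
    case (Suc m)
    have "ennreal ((cmod (lam v))\<^sup>2) * ennreal (mom v (n + Suc m))
      = ennreal ((cmod (wt m v))\<^sup>2) * ennreal (mom (desc m v) (Suc n))"
      using Suc.IH[of "Suc n"] by simp
    also have "\<dots> = ennreal ((cmod (wt m v))\<^sup>2) * (ennreal ((cmod (lam (desc (Suc m) v)))\<^sup>2) * ennreal (mom (desc (Suc m) v) n))"
      unfolding mom_Suc[OF desc_in_V[OF v]] Chi_desc[OF v]
      by (simp add: nn_integral_count_space_finite)
    also have "\<dots> = ennreal ((cmod (wt (Suc m) v))\<^sup>2) * ennreal (mom (desc (Suc m) v) n)"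
      by (simp add: norm_mult power_mult_distrib ennreal_mult mult.assoc)
    finally show ?case .
  qed simp
  from this[of 0] show ?thesis using mom_0[OF desc_in_V[OF v]] by simp
qed

text \<open>The vertices of the two kinds include \<omega> and are closed under edges in both
  directions, so connectedness makes them all of \<open>V\<close>.\<close>

lemma vertex_cases:
  assumes w: "w \<in> V"
  shows "(\<exists>k. has_up k \<and> w = up k) \<or> (\<exists>m. \<exists>v\<in>Chi E \<omega>. w = desc m v)"
proof -
  define W where "W = {w. (\<exists>k. has_up k \<and> w = up k) \<or> (\<exists>m. \<exists>v\<in>Chi E \<omega>. w = desc m v)}"
  have om: "\<omega> \<in> W" by (auto simp: W_def intro: exI[of _ 0])
  have down: "y \<in> W" if "x \<in> W" "(x, y) \<in> E" for x y
  proof -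
    have y: "y \<in> Chi E x" using that by (simp add: Chi_def)
    consider k where "has_up (Suc k)" "x = up (Suc k)" | "x = \<omega>" | m v where "v \<in> Chi E \<omega>" "x = desc m v"
    proof -
      from \<open>x \<in> W\<close> have "(\<exists>k. has_up k \<and> x = up k) \<or> (\<exists>m. \<exists>v\<in>Chi E \<omega>. x = desc m v)"
        unfolding W_def by (rule CollectD)
      then show thesis
      proof (elim disjE exE conjE bexE)
        fix k assume "has_up k" "x = up k"
        then show thesis using that(1,2) by (cases k) auto
      qed (rule that(3))
    qed
    then show ?thesis
    proof cases
      case (1 k)
      then have "y = up k" "has_up k" using y Chi_up[of k] by (simp_all add: has_up_Suc)
      then show ?thesis unfolding W_def by blast
    next
      case 2
      then have v: "y \<in> Chi E \<omega>" using y by simp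
      show ?thesis unfolding W_def by (intro CollectI disjI2 exI[of _ 0] bexI[OF _ v]) simp
    next
      case (3 m v)
      then have "y = desc (Suc m) v" using y Chi_desc[OF 3(1), of m] by blast
      then show ?thesis unfolding W_def by (intro CollectI disjI2 exI[of _ "Suc m"] bexI[OF _ 3(1)])
    qed
  qed
  have upw: "x \<in> W" if "y \<in> W" "(x, y) \<in> E" for x y
  proof -
    have y: "y \<in> nonroots V E" "par E y = x" using that by (auto simp: edge_iff)
    consider k where "has_up k" "y = up k" | m v where "v \<in> Chi E \<omega>" "y = desc m v"
    proof -
      from \<open>y \<in> W\<close> have "(\<exists>k. has_up k \<and> y = up k) \<or> (\<exists>m. \<exists>v\<in>Chi E \<omega>. y = desc m v)"
        unfolding W_def by (rule CollectD)
      then show thesis by (elim disjE exE conjE bexE) (rule that; assumption)+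
    qed
    then show ?thesis
    proof cases
      case (1 k)
      then have "has_up (Suc k)" "x = up (Suc k)" using y by (auto simp: has_up_Suc)
      then show ?thesis unfolding W_def by blast
    next
      case (2 m v)
      show ?thesis
      proof (cases m)
        case 0
        then have "x = \<omega>" using 2 y by (simp add: Chi_iff)
        then show ?thesis using om by simp
      next
        case (Suc i)
        then have "x = desc i v" using 2 y par_desc_Suc[of v i] by simp
        then show ?thesis unfolding W_def by (intro CollectI disjI2 exI[of _ i] bexI[OF _ 2(1)])
      qed
    qed
  qed
  have "w \<in> W"
  proof (cases "w = \<omega>")
    case False
    then obtain p where p: "2 \<le> length p" "hd p = \<omega>" "last p = w"
      "\<And>j. Suc j < length p \<Longrightarrow> (p ! j, p ! Suc j) \<in> E \<or> (p ! Suc j, p ! j) \<in> E"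
      using tree w omega unfolding directed_tree_def by metis
    have "p ! j \<in> W" if "j < length p" for j
      using that
    proof (induction j)
      case 0
      then show ?case using p om by (simp add: hd_conv_nth)
    next
      case (Suc j)
      have pj: "p ! j \<in> W" using Suc.IH Suc.prems by simp
      show ?case using p(4)[OF Suc.prems] down[OF pj] upw[OF pj] by blast
    qed
    then have "p ! (length p - 1) \<in> W" using p(1) by simp
    moreover have "p \<noteq> []" using p(1) by auto
    ultimately show ?thesis using p(3) by (simp add: last_conv_nth)
  qed (use om in simp)
  then show ?thesis by (simp add: W_def)
qed

lemma up_inj:
  assumes "has_up k" "has_up k'" "up k = up k'"
  shows "k = k'"
proof -
  have "False" if "k < k'" "has_up k'" "up k = up k'" for k k'
  proof -
    have e: "(par E ^^ j) (up k) = up (j + k)" for j by (simp add: funpow_add)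
    have "up (j + k) \<in> nonroots V E" if "j < k' - k" for j
      using that \<open>has_up k'\<close> unfolding has_up_def by (metis less_diff_conv)
    then have "(par E ^^ (k' - k)) (up k) \<noteq> up k"
      using that(1) by (intro par_no_cycle allI impI) (simp_all only: e zero_less_diff)
    moreover have "(par E ^^ (k' - k)) (up k) = up k'" unfolding e using that(1) by simp
    ultimately show False using that(3) by metis
  qed
  from this[of k k'] this[of k' k] show ?thesis using assms by (cases k k' rule: linorder_cases) auto
qed

text \<open>Otherwise climbing \<open>k\<close> steps from \<omega>, and then \<open>Suc m\<close>
  more, would lead back to \<omega>.\<close>

lemma up_ne_desc:
  assumes k: "has_up k" and v: "v \<in> Chi E \<omega>"
  shows "up k \<noteq> desc m v"
proof
  assume eq: "up k = desc m v"
  have ret: "up (Suc m + k) = \<omega>" using par_desc[OF v, of m] by (simp only: funpow_add comp_apply eq)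
  have "up j \<in> nonroots V E" if "j < Suc m + k" for j
  proof (cases "j < k")
    case False
    then have "up j = (par E ^^ (j - k)) (up k)" by (simp flip: funpow_add comp_apply[of "par E ^^ _"])
    then show ?thesis using desc_up[OF v, of "j - k" m] eq that False by simp
  qed (use k in \<open>simp add: has_up_def\<close>)
  then show False using par_no_cycle[of "Suc m + k" \<omega>] ret by simp
qed

text \<open>If \<open>m < m'\<close>, then \<omega> would be both \<open>Suc m\<close> and
  \<open>Suc m'\<close> steps above the same vertex, which is a cycle through \<omega>.\<close>

lemma desc_inj:
  assumes v: "v \<in> Chi E \<omega>" and v': "v' \<in> Chi E \<omega>" and eq: "desc m v = desc m' v'"
  shows "m = m' \<and> v = v'"
proof -
  have "False" if "m < m'" "v \<in> Chi E \<omega>" "v' \<in> Chi E \<omega>" "desc m v = desc m' v'" for m m' v v'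
  proof -
    have e: "(par E ^^ j) \<omega> = (par E ^^ (j + Suc m)) (desc m' v')" for j
      using par_desc[OF that(2), of m] that(4) by (simp only: funpow_add comp_apply)
    have "up j \<in> nonroots V E" if "j < m' - m" for j
      unfolding e using \<open>v' \<in> _\<close> by (rule desc_up) (use that in simp)
    then have "up (m' - m) \<noteq> \<omega>" using that(1) by (intro par_no_cycle) auto
    moreover have "up (m' - m) = \<omega>" unfolding e using par_desc[OF that(3), of m'] that(1) by simp
    ultimately show False by simp
  qed
  from this[OF _ v v' eq] this[OF _ v' v eq[symmetric]] have m: "m = m'"
    by (cases m m' rule: linorder_cases) auto
  have "v = (par E ^^ m) (desc m v)" using par_desc_top[OF v] by simp
  also have "\<dots> = v'" unfolding eq unfolding m by (rule par_desc_top[OF v'])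
  finally show ?thesis using m by simp
qed

end


section \<open>The embedding of \<open>ell2 V\<close> into the space of the bilateral shift\<close>

section \<open>The normal extension\<close>

text \<open>Reduces the preservation of inner products to that of norms, which \<open>G_norm\<close>
  obtains from nonnegative integrals.\<close>

lemma L2_polarization:
  assumes f: "square_integrable M f" and g: "square_integrable M g"
  shows "4 * (\<integral>x. f x * cnj (g x) \<partial>M)
    = (\<Sum>j<4. \<i> ^ j * complex_of_real (\<integral>x. (cmod (f x + \<i> ^ j * g x))\<^sup>2 \<partial>M))"
proof -
  have id: "4 * (a * cnj b) = (\<Sum>j<4. \<i> ^ j * complex_of_real ((cmod (a + \<i> ^ j * b))\<^sup>2))" for a b
    unfolding complex_norm_square by (simp add: numeral_eq_Suc algebra_simps)
  have "4 * (\<integral>x. f x * cnj (g x) \<partial>M) = (\<integral>x. 4 * (f x * cnj (g x)) \<partial>M)"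
    using square_integrable_mult[OF f square_integrable_cnj[OF g]] by simp
  also have "\<dots> = (\<Sum>j<4. \<integral>x. \<i> ^ j * complex_of_real ((cmod (f x + \<i> ^ j * g x))\<^sup>2) \<partial>M)"
    unfolding id
    using square_integrable_add[OF f square_integrable_scale[OF g]]
    by (intro Bochner_Integration.integral_sum integrable_mult_right integrable_of_real)
      (simp add: square_integrable_def)
  also have "\<dots> = (\<Sum>j<4. \<i> ^ j * complex_of_real (\<integral>x. (cmod (f x + \<i> ^ j * g x))\<^sup>2 \<partial>M))"
    by (simp only: integral_mult_right_zero integral_complex_of_real)
  finally show ?thesis .
qed

lemma ell2_square_integrable:
  assumes "f \<in> hset (ell2 V)"
  shows "square_integrable (count_space V) f"
proof -
  have "(\<integral>\<^sup>+v. ennreal ((cmod (f v))\<^sup>2) \<partial>count_space V) < \<infinity>"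
    unfolding ennreal_hnorm_ell2[OF assms, symmetric] by simp
  then show ?thesis by (simp add: square_integrable_iff)
qed

lemma hinner_ell2:
  assumes "f \<in> hset (ell2 V)" "g \<in> hset (ell2 V)"
  shows "hinner (ell2 V) f g = (\<integral>v. f v * cnj (g v) \<partial>count_space V)"
proof -
  have "integrable (count_space V) (\<lambda>v. f v * cnj (g v))"
    using assms by (intro square_integrable_mult square_integrable_cnj ell2_square_integrable)
  then have "Infinite_Set_Sum.abs_summable_on (\<lambda>v. f v * cnj (g v)) V"
    by (simp add: Infinite_Set_Sum.abs_summable_on_def)
  then show ?thesis by (simp add: ell2_simps infsetsum_infsum infsetsum_def flip: infsetsum_infsum)
qed

lemma ell2_add_scale:
  assumes f: "f \<in> hset (ell2 V)" and g: "g \<in> hset (ell2 V)"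
  shows "(\<lambda>v. f v + c * g v) \<in> hset (ell2 V)"
proof -
  have "square_integrable (count_space V) (\<lambda>v. f v + c * g v)"
    using f g by (intro square_integrable_add square_integrable_scale ell2_square_integrable)
  then have "integrable (count_space V) (\<lambda>v. (cmod (f v + c * g v))\<^sup>2)" by (simp add: square_integrable_def)
  then have "Infinite_Set_Sum.abs_summable_on (\<lambda>v. (cmod (f v + c * g v))\<^sup>2) V"
    by (simp add: Infinite_Set_Sum.abs_summable_on_def)
  then have "(\<lambda>v. (cmod (f v + c * g v))\<^sup>2) summable_on V"
    using abs_summable_equivalent abs_summable_summable by blast
  then show ?thesis using f g by (simp add: hset_ell2)
qed

text \<open>The common form of the sufficient conditions in all three cases: an inequality at every
  ancestor, sharpened to an equality wherever a further parent exists, that is, everywhere but at a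
  root.\<close>

locale extendible_shift = one_branching_shift V E lam \<omega>
  for V :: "'v set" and E lam \<omega> +
  assumes children: "\<And>v. v \<in> Chi E \<omega> \<Longrightarrow> stieltjes_at v"
    and inv_sum_le: "\<And>k. has_up k \<Longrightarrow> inv_sum (Suc k) \<le> path_weight k"
    and inv_sum_eq: "\<And>k. has_up (Suc k) \<Longrightarrow> inv_sum (Suc k) = path_weight k"
begin

lemma child_represents: "v \<in> Chi E \<omega> \<Longrightarrow> represents (\<mu> v) (mom v)"
  using children ChiD by (intro shift_measure_represents) auto

lemma sets_child: "v \<in> Chi E \<omega> \<Longrightarrow> sets (\<mu> v) = sets halfline"
  using child_represents by (simp add: represents_def)

lemma measurable_child:
  assumes "v \<in> Chi E \<omega>" "f \<in> measurable halfline L"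
  shows "f \<in> measurable (\<mu> v) L"
  using assms(2) measurable_cong_sets[OF sets_child[OF assms(1)] refl] by blast

text \<open>\<open>inv_sum 1\<close> is finite, whereas an atom at 0 would contribute
  \<open>1 / 0 = \<infinity>\<close> with a nonzero weight.\<close>

lemma child_pos:
  assumes v: "v \<in> Chi E \<omega>"
  shows "AE s in \<mu> v. 0 < s"
proof -
  let ?f = "\<lambda>v. ennreal ((cmod (lam v))\<^sup>2) * (\<integral>\<^sup>+s. 1 / ennreal (s ^ 1) \<partial>\<mu> v)"
  have "?f v \<le> (\<integral>\<^sup>+v. ?f v \<partial>count_space (Chi E \<omega>))"
    using v by (rule nn_integral_ge_point)
  also have "\<dots> = inv_sum (Suc 0)" by (simp add: inverse_moment_sum_def infsum_ennreal_eq_nn_integral)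
  also have "\<dots> \<le> path_weight 0" by (rule inv_sum_le) simp
  also have "\<dots> < \<infinity>" by (simp add: path_weight_def)
  finally have "?f v < \<top>" by simp
  moreover have "lam v \<noteq> 0" using v ChiD nonzero by blast
  ultimately have fin: "(\<integral>\<^sup>+s. 1 / ennreal (s ^ 1) \<partial>\<mu> v) \<noteq> \<infinity>"
    by (auto simp: ennreal_mult_less_top)
  have "(\<lambda>s. 1 / ennreal (s ^ 1)) \<in> borel_measurable (\<mu> v)"
    by (rule represents_measurable[OF child_represents[OF v]]) measurable
  then have "AE s in \<mu> v. 1 / ennreal (s ^ 1) \<noteq> \<infinity>" using fin by (rule nn_integral_PInf_AE)
  moreover have "AE s in \<mu> v. 0 \<le> s"
    using represents_space[OF child_represents[OF v]] by (intro AE_I2) simp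
  ultimately show ?thesis
    by eventually_elim (auto simp: less_le)
qed

text \<open>The power \<open>s ^ (n - 1)\<close> with an integer exponent. The offset puts the
  children of \<omega> on level 1, where the measure is \<open>(cmod (lam v))\<^sup>2\<close> times
  \<open>\<mu> v\<close>.\<close>

definition level_weight :: "int \<Rightarrow> real \<Rightarrow> ennreal" where
  "level_weight n s = (if 1 \<le> n then ennreal (s ^ nat (n - 1)) else 1 / ennreal (s ^ nat (1 - n)))"

lemma level_weight_Suc:
  assumes s: "0 < s"
  shows "level_weight n s * ennreal s = level_weight (n + 1) s"
proof -
  consider "1 \<le> n" | "n = 0" | "n < 0" by linarith
  then show ?thesis
  proof cases
    case 1
    then have "nat n = Suc (nat (n - 1))" by simp
    then show ?thesis using 1 s by (simp add: level_weight_def mult.commute flip: ennreal_mult)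
  next
    case 2
    then show ?thesis using s by (simp add: level_weight_def divide_ennreal flip: ennreal_mult ennreal_1)
  next
    case 3
    then have "nat (1 - n) = Suc (nat (- n))" by simp
    then show ?thesis using 3 s by (simp add: level_weight_def divide_ennreal flip: ennreal_mult ennreal_1)
  qed
qed

lemma measurable_level_weight: "level_weight n \<in> borel_measurable borel"
  unfolding level_weight_def[abs_def] by measurable

text \<open>The branch \<^term>\<open>\<omega>\<close>, which is no child of itself, carries the atoms at \<open>0\<close> that
  make up for the missing mass in the inequalities \<open>inv_sum_le\<close>.\<close>

definition defect :: "int \<Rightarrow> 'v \<Rightarrow> ennreal" where
  "defect n v = (if v = \<omega> \<and> n \<le> 0 \<and> has_up (nat (- n))
    then path_weight (nat (- n)) - inv_sum (Suc (nat (- n))) else 0)"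

text \<open>An index that is neither \<omega> nor a child of \<omega> carries the zero measure; such
  indices occur because the direct sum runs over a whole type.\<close>

definition \<kappa> :: "int \<times> 'v \<Rightarrow> real measure" where
  "\<kappa> = (\<lambda>(n, v). if v \<in> Chi E \<omega>
    then density (\<mu> v) (\<lambda>s. ennreal ((cmod (lam v))\<^sup>2) * level_weight n s)
    else density (return halfline 0) (\<lambda>_. defect n v))"

lemma omega_no_child: "\<omega> \<notin> Chi E \<omega>"
  using edgeD by (auto simp: Chi_def)

lemma sets_kappa: "sets (\<kappa> i) = sets halfline"
  by (cases i) (simp add: \<kappa>_def sets_child)

lemma child_density_measurable:
  assumes "v \<in> Chi E \<omega>"
  shows "(\<lambda>s. ennreal ((cmod (lam v))\<^sup>2) * level_weight n s) \<in> borel_measurable (\<mu> v)"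
  by (rule represents_measurable[OF child_represents[OF assms]])
    (use measurable_level_weight in measurable)

lemma AE_kappa_child:
  assumes v: "v \<in> Chi E \<omega>" and P: "AE s in \<mu> v. P s"
  shows "AE s in \<kappa> (n, v). P s"
proof -
  have "\<kappa> (n, v) = density (\<mu> v) (\<lambda>s. ennreal ((cmod (lam v))\<^sup>2) * level_weight n s)"
    using v by (simp add: \<kappa>_def)
  moreover have "AE s in \<mu> v. 0 < ennreal ((cmod (lam v))\<^sup>2) * level_weight n s \<longrightarrow> P s"
    using P by eventually_elim simp
  ultimately show ?thesis by (simp only: AE_density[OF child_density_measurable[OF v]])
qed

lemma AE_kappa_atom:
  assumes v: "v \<notin> Chi E \<omega>" and P: "Measurable.pred halfline P" "P 0"
  shows "AE s in \<kappa> (n, v). P s"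
proof -
  have "AE s in return halfline 0. P s"
    using P by (subst AE_return) (auto simp: space_restrict_space)
  then have "AE s in return halfline 0. 0 < defect n v \<longrightarrow> P s" by eventually_elim simp
  moreover have "\<kappa> (n, v) = density (return halfline 0) (\<lambda>_. defect n v)"
    using v by (simp add: \<kappa>_def)
  ultimately show ?thesis by (simp only: AE_density[OF borel_measurable_const])
qed

lemma nn_integral_kappa:
  assumes g: "g \<in> borel_measurable halfline"
  shows "v \<in> Chi E \<omega> \<Longrightarrow> (\<integral>\<^sup>+s. g s \<partial>\<kappa> (n, v)) = (\<integral>\<^sup>+s. ennreal ((cmod (lam v))\<^sup>2) * level_weight n s * g s \<partial>\<mu> v)"
    and "v \<notin> Chi E \<omega> \<Longrightarrow> (\<integral>\<^sup>+s. g s \<partial>\<kappa> (n, v)) = defect n v * g 0"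
proof -
  show "(\<integral>\<^sup>+s. g s \<partial>\<kappa> (n, v)) = (\<integral>\<^sup>+s. ennreal ((cmod (lam v))\<^sup>2) * level_weight n s * g s \<partial>\<mu> v)"
    if v: "v \<in> Chi E \<omega>"
    using nn_integral_density[OF child_density_measurable[OF v] measurable_child[OF v g]] v
    by (simp add: \<kappa>_def)
  have "g \<in> borel_measurable (return halfline 0)" using g by simp
  then show "(\<integral>\<^sup>+s. g s \<partial>\<kappa> (n, v)) = defect n v * g 0" if "v \<notin> Chi E \<omega>"
    using that g by (simp add: \<kappa>_def nn_integral_density nn_integral_return space_restrict_space)
qed

lemma bilateral_shift_kappa: "\<exists>c. bilateral_shift \<kappa> c"
proof -
  obtain c where c: "0 \<le> c" "\<And>u n. u \<in> V \<Longrightarrow> mom u n \<le> c ^ n" using mom_growth by blast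
  have "bilateral_shift \<kappa> c"
  proof
    show "sets (\<kappa> i) = sets halfline" for i by (rule sets_kappa)
    show "0 \<le> c" by fact
    show "AE s in \<kappa> i. s \<le> c" for i
    proof (cases i)
      case (Pair n v)
      show ?thesis
      proof (cases "v \<in> Chi E \<omega>")
        case True
        then have "\<And>n. mom v n \<le> 1 * c ^ n" using c(2) ChiD by auto
        then have "AE s in \<mu> v. s \<le> c" using child_represents[OF True] c(1) represents_AE_le by blast
        then show ?thesis unfolding Pair by (rule AE_kappa_child[OF True])
      next
        case False
        have "Measurable.pred halfline (\<lambda>s. s \<le> c)" by (intro measurable_restrict_space1) measurable
        then show ?thesis unfolding Pair using c(1) by (rule AE_kappa_atom[OF False])
      qed
    qed
    fix n v and g :: "real \<Rightarrow> ennreal" assume g: "g \<in> borel_measurable halfline"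
    have "ennreal \<in> borel_measurable halfline" by (intro measurable_restrict_space1) measurable
    then have m1: "(\<lambda>s. ennreal s * g s) \<in> borel_measurable halfline" using g by simp
    have "Measurable.pred halfline (\<lambda>s. 0 < s)" by (intro measurable_restrict_space1) measurable
    then have m2: "(\<lambda>s. if 0 < s then g s else 0) \<in> borel_measurable halfline" using g by simp
    show "(\<integral>\<^sup>+s. ennreal s * g s \<partial>\<kappa> (n, v)) = (\<integral>\<^sup>+s. (if 0 < s then g s else 0) \<partial>\<kappa> (n + 1, v))"
    proof (cases "v \<in> Chi E \<omega>")
      case True
      show ?thesis
        unfolding nn_integral_kappa(1)[OF m1 True] nn_integral_kappa(1)[OF m2 True]
      proof (rule nn_integral_cong_AE)
        show "AE s in \<mu> v. ennreal ((cmod (lam v))\<^sup>2) * level_weight n s * (ennreal s * g s)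
          = ennreal ((cmod (lam v))\<^sup>2) * level_weight (n + 1) s * (if 0 < s then g s else 0)"
          using child_pos[OF True] by eventually_elim (simp add: mult.assoc flip: level_weight_Suc)
      qed
    next
      case False
      \<comment> \<open>Both integrands vanish at the atom, so the defects of neighbouring levels
        need not match.\<close>
      show ?thesis unfolding nn_integral_kappa(2)[OF m1 False] nn_integral_kappa(2)[OF m2 False] by simp
    qed
  qed
  then show ?thesis by blast
qed

definition mass :: "int \<Rightarrow> 'v \<Rightarrow> ennreal" where
  "mass n v = (\<integral>\<^sup>+s. 1 \<partial>\<kappa> (n, v))"

lemma mass_ray:
  assumes v: "v \<in> Chi E \<omega>"
  shows "mass (int (Suc m)) v = ennreal ((cmod (wt m v))\<^sup>2)"
proof -
  have "mass (int (Suc m)) v = (\<integral>\<^sup>+s. ennreal ((cmod (lam v))\<^sup>2) * ennreal (s ^ m) \<partial>\<mu> v)"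
    unfolding mass_def by (subst nn_integral_kappa(1)[OF _ v]) (simp_all add: level_weight_def)
  also have "\<dots> = ennreal ((cmod (lam v))\<^sup>2) * (\<integral>\<^sup>+s. ennreal (s ^ m) \<partial>\<mu> v)"
    by (intro nn_integral_cmult represents_measurable[OF child_represents[OF v]]) measurable
  finally show ?thesis using represents_nn_integral[OF child_represents[OF v]] mom_wt[OF v] by simp
qed

text \<open>The branches of the children contribute \<open>inv_sum (Suc k)\<close> in total and the
  atom on branch \<omega> fills up the rest. So the level as a whole has the mass that belongs to
  the single vertex \<open>up k\<close>.\<close>

lemma mass_trunk:
  assumes k: "has_up k"
  shows "(\<integral>\<^sup>+v. mass (- int k) v \<partial>count_space UNIV) = path_weight k"
proof -
  let ?f = "\<lambda>v. ennreal ((cmod (lam v))\<^sup>2) * (\<integral>\<^sup>+s. 1 / ennreal (s ^ Suc k) \<partial>\<mu> v)"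
  have "mass (- int k) v = ?f v * indicator (Chi E \<omega>) v + (path_weight k - inv_sum (Suc k)) * indicator {\<omega>} v" for v
  proof (cases "v \<in> Chi E \<omega>")
    case True
    have "mass (- int k) v = (\<integral>\<^sup>+s. ennreal ((cmod (lam v))\<^sup>2) * (1 / ennreal (s ^ Suc k)) \<partial>\<mu> v)"
      unfolding mass_def
      by (subst nn_integral_kappa(1)[OF _ True]) (simp_all add: level_weight_def nat_add_distrib)
    also have "\<dots> = ?f v"
      by (intro nn_integral_cmult represents_measurable[OF child_represents[OF True]]) measurable
    finally show ?thesis using True omega_no_child by (auto simp: indicator_def)
  next
    case False
    then show ?thesis unfolding mass_def
      using k by (subst nn_integral_kappa(2)) (auto simp: defect_def indicator_def)
  qed
  then have "(\<integral>\<^sup>+v. mass (- int k) v \<partial>count_space UNIV)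
    = (\<integral>\<^sup>+v. ?f v \<partial>count_space (Chi E \<omega>)) + (path_weight k - inv_sum (Suc k))"
    by (simp add: nn_integral_add nn_integral_count_space_indicator nn_integral_cmult)
  also have "(\<integral>\<^sup>+v. ?f v \<partial>count_space (Chi E \<omega>)) = inv_sum (Suc k)"
    by (simp add: inverse_moment_sum_def infsum_ennreal_eq_nn_integral)
  also have "inv_sum (Suc k) + (path_weight k - inv_sum (Suc k)) = path_weight k"
    using inv_sum_le[OF k] by (simp add: add.commute diff_add_cancel_ennreal)
  finally show ?thesis .
qed

text \<open>The value of the embedded function on a level and a branch, constant in
  \<open>s\<close>. Its factors make squared modulus times mass return the squared modulus of
  \<open>f\<close>, and make \<open>S\<close> move the values down one level. On levels
  \<open>n \<le> 0\<close> all branches share one vertex, so \<open>v\<close> does not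
  enter.\<close>

definition G :: "('v \<Rightarrow> complex) \<Rightarrow> int \<times> 'v \<Rightarrow> complex" where
  "G f = (\<lambda>(n, v). if n \<le> 0
    then if has_up (nat (- n)) then f (up (nat (- n))) * (\<Prod>j<nat (- n). lam (up j)) else 0
    else if v \<in> Chi E \<omega> then f (desc (nat (n - 1)) v) / wt (nat (n - 1)) v else 0)"

lemma G_linear: "G (\<lambda>v. f v + g v) i = G f i + G g i" "G (\<lambda>v. c * f v) i = c * G f i"
  by (auto simp: G_def split_beta algebra_simps add_divide_distrib)

text \<open>One label per vertex; on the trunk \<omega> is a mere placeholder for the
  branch.\<close>

definition occupied :: "(int \<times> 'v) set" where
  "occupied = {(n, v). n \<le> 0 \<and> v = \<omega> \<and> has_up (nat (- n)) \<or> 1 \<le> n \<and> v \<in> Chi E \<omega>}"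

definition vertex :: "int \<times> 'v \<Rightarrow> 'v" where
  "vertex = (\<lambda>(n, v). if n \<le> 0 then up (nat (- n)) else desc (nat (n - 1)) v)"

lemma vertex_bij: "bij_betw vertex occupied V"
  unfolding bij_betw_def
proof
  have "i = j" if "i \<in> occupied" "j \<in> occupied" "vertex i = vertex j" for i j
  proof -
    obtain n v m w where ij: "i = (n, v)" "j = (m, w)" by (cases i, cases j)
    note oc = that(1,2)[unfolded ij occupied_def mem_Collect_eq prod.case]
    note eq = that(3)[unfolded ij vertex_def prod.case]
    show ?thesis
    proof (cases "n \<le> 0"; cases "m \<le> 0")
      assume nm: "n \<le> 0" "m \<le> 0"
      then have "nat (- n) = nat (- m)" using oc eq by (intro up_inj) simp_all
      then show ?thesis using nm oc ij by auto
    next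
      assume nm: "n \<le> 0" "\<not> m \<le> 0"
      then show ?thesis using oc eq up_ne_desc[of "nat (- n)" w "nat (m - 1)"] by simp
    next
      assume nm: "\<not> n \<le> 0" "m \<le> 0"
      then show ?thesis using oc eq up_ne_desc[of "nat (- m)" v "nat (n - 1)"] by simp
    next
      assume nm: "\<not> n \<le> 0" "\<not> m \<le> 0"
      then have "nat (n - 1) = nat (m - 1) \<and> v = w" using oc eq by (intro desc_inj) simp_all
      then show ?thesis using nm ij by auto
    qed
  qed
  then show "inj_on vertex occupied" by (rule inj_onI)
  show "vertex ` occupied = V"
  proof
    show "vertex ` occupied \<subseteq> V"
      by (auto simp: occupied_def vertex_def up_in_V desc_in_V)
    show "V \<subseteq> vertex ` occupied"
    proof
      fix w assume "w \<in> V"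
      from vertex_cases[OF this] show "w \<in> vertex ` occupied"
      proof (elim disjE exE conjE bexE)
        fix k assume "has_up k" "w = up k"
        then show ?thesis by (intro image_eqI[of _ _ "(- int k, \<omega>)"]) (auto simp: vertex_def occupied_def)
      next
        fix m v assume "v \<in> Chi E \<omega>" "w = desc m v"
        then show ?thesis by (intro image_eqI[of _ _ "(int (Suc m), v)"]) (auto simp: vertex_def occupied_def)
      qed
    qed
  qed
qed

text \<open>On the trunk the two sides agree only after summation over \<open>v\<close>: on the left
  the vertex is spread over all branches, on the right it sits at the label \<omega>.\<close>

lemma level_norm:
  "(\<integral>\<^sup>+v. ennreal ((cmod (G f (n, v)))\<^sup>2) * mass n v \<partial>count_space UNIV)
    = (\<integral>\<^sup>+v. ennreal ((cmod (f (vertex (n, v))))\<^sup>2) * indicator occupied (n, v) \<partial>count_space UNIV)"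
proof (cases "n \<le> 0")
  case True
  define k where "k = nat (- n)"
  have n: "n = - int k" using True by (simp add: k_def)
  show ?thesis
  proof (cases "has_up k")
    case hk: True
    let ?P = "\<Prod>j<k. lam (up j)"
    have P: "?P \<noteq> 0" using hk nonzero by (auto simp: has_up_def)
    have "(\<integral>\<^sup>+v. ennreal ((cmod (G f (n, v)))\<^sup>2) * mass n v \<partial>count_space UNIV)
      = (\<integral>\<^sup>+v. ennreal ((cmod (f (up k) * ?P))\<^sup>2) * mass (- int k) v \<partial>count_space UNIV)"
      using hk by (simp add: G_def n)
    also have "\<dots> = ennreal ((cmod (f (up k) * ?P))\<^sup>2) * path_weight k"
      by (simp add: nn_integral_cmult mass_trunk[OF hk])
    also have "\<dots> = ennreal ((cmod (f (up k)))\<^sup>2)"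
      using P by (simp add: path_weight_def norm_mult power_mult_distrib flip: ennreal_mult)
    also have "\<dots> = (\<integral>\<^sup>+v. ennreal ((cmod (f (up k)))\<^sup>2) * indicator {\<omega>} v \<partial>count_space UNIV)"
      by (simp add: nn_integral_cmult)
    also have "\<dots> = (\<integral>\<^sup>+v. ennreal ((cmod (f (vertex (n, v))))\<^sup>2) * indicator occupied (n, v) \<partial>count_space UNIV)"
      using hk by (intro nn_integral_cong) (simp add: vertex_def occupied_def n indicator_def)
    finally show ?thesis .
  next
    case False
    then show ?thesis by (simp add: G_def occupied_def n)
  qed
next
  case False
  define m where "m = nat (n - 1)"
  have n: "n = int (Suc m)" using False by (simp add: m_def)
  have "ennreal ((cmod (G f (n, v)))\<^sup>2) * mass n v
    = ennreal ((cmod (f (vertex (n, v))))\<^sup>2) * indicator occupied (n, v)" for v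
  proof (cases "v \<in> Chi E \<omega>")
    case True
    have "ennreal ((cmod (f (desc m v) / wt m v))\<^sup>2) * ennreal ((cmod (wt m v))\<^sup>2) = ennreal ((cmod (f (desc m v)))\<^sup>2)"
      using wt_nonzero[OF True, of m] by (simp add: norm_divide power_divide flip: ennreal_mult)
    then show ?thesis using True unfolding n mass_ray[OF True]
      by (simp add: G_def vertex_def occupied_def)
  qed (simp add: G_def occupied_def n)
  then show ?thesis by simp
qed

lemma G_norm:
  "(\<integral>\<^sup>+x. ennreal ((cmod (G f (fst x)))\<^sup>2) \<partial>direct_sum_measure halfline \<kappa>)
    = (\<integral>\<^sup>+v. ennreal ((cmod (f v))\<^sup>2) \<partial>count_space V)"
proof -
  have "(\<integral>\<^sup>+x. ennreal ((cmod (G f (fst x)))\<^sup>2) \<partial>direct_sum_measure halfline \<kappa>)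
    = (\<integral>\<^sup>+i. \<integral>\<^sup>+s. ennreal ((cmod (G f i))\<^sup>2) * 1 \<partial>\<kappa> i \<partial>count_space UNIV)"
    by (subst nn_integral_direct_sum_measure[OF sets_kappa])
      (auto intro!: measurable_direct_sum_measureI)
  also have "\<dots> = (\<integral>\<^sup>+i. ennreal ((cmod (G f i))\<^sup>2) * mass (fst i) (snd i) \<partial>count_space UNIV)"
    unfolding mass_def prod.collapse by (intro nn_integral_cong nn_integral_cmult) simp
  also have "\<dots> = (\<integral>\<^sup>+n. \<integral>\<^sup>+v. ennreal ((cmod (G f (n, v)))\<^sup>2) * mass n v \<partial>count_space UNIV \<partial>count_space UNIV)"
    by (subst nn_integral_fst_count_space[symmetric]) simp
  also have "\<dots> = (\<integral>\<^sup>+i. ennreal ((cmod (f (vertex i)))\<^sup>2) * indicator occupied i \<partial>count_space UNIV)"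
    unfolding level_norm by (rule nn_integral_fst_count_space)
  also have "\<dots> = (\<integral>\<^sup>+i. ennreal ((cmod (f (vertex i)))\<^sup>2) \<partial>count_space occupied)"
    by (simp add: nn_integral_count_space_indicator)
  also have "\<dots> = (\<integral>\<^sup>+v. ennreal ((cmod (f v))\<^sup>2) \<partial>count_space V)"
    by (rule nn_integral_bij_count_space[OF vertex_bij])
  finally show ?thesis .
qed

text \<open>On the branch of a child, \<open>0 < s\<close> almost everywhere and the coefficients of
  \<open>G\<close> match. The branch \<omega> is concentrated at \<open>s = 0\<close>, where the
  left side is 0; so \<open>G (S f)\<close> has to vanish on each level with an atom, and such a
  level belongs to the root.\<close>

lemma G_S:
  "AE s in \<kappa> i. (if 0 < s then G f (fst i - 1, snd i) else 0) = G (S f) i"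
proof (cases i)
  case (Pair n v)
  show ?thesis
  proof (cases "v \<in> Chi E \<omega>")
    case True
    have "G f (n - 1, v) = G (S f) (n, v)"
    proof -
      consider k where "n = - int k" | "n = 1" | m where "n = int (Suc (Suc m))"
      proof -
        assume a: "\<And>k. n = - int k \<Longrightarrow> thesis" "n = 1 \<Longrightarrow> thesis" "\<And>m. n = int (Suc (Suc m)) \<Longrightarrow> thesis"
        consider "n \<le> 0" | "n = 1" | "n \<ge> 2" by linarith
        then show thesis
          using a(1)[of "nat (- n)"] a(2) a(3)[of "nat (n - 2)"] by cases auto
      qed
      then show ?thesis
      proof cases
        case (1 k)
        have "nat (1 + int k) = Suc k" by simp
        then show ?thesis using 1
          by (auto simp: G_def has_up_Suc wshift_def lessThan_Suc ac_simps)
      next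
        case 2
        then show ?thesis using True nonzero[of v] by (simp add: G_def Chi_iff wshift_def)
      next
        case (3 m)
        have "S f (desc (Suc m) v) = lam (desc (Suc m) v) * f (desc m v)"
          using par_desc_Suc[OF True, of m] desc_nonroot[OF True, of "Suc m"] by (simp add: wshift_def del: desc.simps)
        moreover have "lam (desc (Suc m) v) \<noteq> 0" using desc_nonroot[OF True] nonzero by blast
        moreover have "nat (int (Suc (Suc m)) - 1 - 1) = m" "nat (int (Suc (Suc m)) - 1) = Suc m" by simp_all
        ultimately show ?thesis using 3 True by (simp add: G_def del: desc.simps)
      qed
    qed
    moreover have "AE s in \<kappa> (n, v). 0 < s"
      by (rule AE_kappa_child[OF True child_pos[OF True]])
    ultimately show ?thesis unfolding Pair fst_conv snd_conv by (elim eventually_mono) simp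
  next
    case False
    show ?thesis
    proof (cases "defect n v = 0")
      case True
      then have "\<kappa> i = density (return halfline 0) (\<lambda>_. 0)" using False by (simp add: Pair \<kappa>_def)
      then show ?thesis by (simp only: AE_density[OF borel_measurable_const]) simp
    next
      case d: False
      then have d: "v = \<omega>" "n \<le> 0" "has_up (nat (- n))" "path_weight (nat (- n)) - inv_sum (Suc (nat (- n))) \<noteq> 0"
        by (auto simp: defect_def split: if_splits)
      \<comment> \<open>If \<open>up (nat (- n))\<close> had a parent, equality would leave no
        defect.\<close>
      have "\<not> has_up (Suc (nat (- n)))" using inv_sum_eq[of "nat (- n)"] d(4) by (auto simp: path_weight_def)
      then have "up (nat (- n)) \<notin> nonroots V E" using d(3) by (simp add: has_up_Suc)
      then have z: "G (S f) (n, v) = 0" using d by (simp add: G_def wshift_def)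
      have "Measurable.pred halfline (\<lambda>s. \<not> 0 < s)" by (intro measurable_restrict_space1) measurable
      then have "AE s in \<kappa> (n, v). \<not> 0 < s" by (rule AE_kappa_atom[OF False]) simp
      then show ?thesis unfolding Pair by eventually_elim (simp add: z)
    qed
  qed
qed

theorem subnormal_shift: "subnormal (ell2 V) S"
proof -
  obtain c where "bilateral_shift \<kappa> c" using bilateral_shift_kappa by blast
  then interpret B: bilateral_shift \<kappa> c .
  define J0 where "J0 f = (\<lambda>x :: (int \<times> 'v) \<times> real. G f (fst x))" for f
  have J0m: "J0 f \<in> borel_measurable B.M" for f unfolding B.measurable_M by (simp add: J0_def)
  have J0_norm: "(\<integral>\<^sup>+x. ennreal ((cmod (J0 f x))\<^sup>2) \<partial>B.M) = (\<integral>\<^sup>+v. ennreal ((cmod (f v))\<^sup>2) \<partial>count_space V)" for f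
    unfolding J0_def B.M_def by (rule G_norm)
  have si: "square_integrable B.M (J0 f)" if "f \<in> hset (ell2 V)" for f
    using ell2_square_integrable[OF that] J0m by (simp add: square_integrable_iff J0_norm)
  have J0_int: "(\<integral>x. (cmod (J0 f x))\<^sup>2 \<partial>B.M) = (\<integral>v. (cmod (f v))\<^sup>2 \<partial>count_space V)" if "f \<in> hset (ell2 V)" for f
    using J0m by (simp add: integral_eq_nn_integral J0_norm)
  have J0_lin: "J0 (\<lambda>v. f v + g v) = (\<lambda>x. J0 f x + J0 g x)" "J0 (\<lambda>v. c * f v) = (\<lambda>x. c * J0 f x)" for f g c
    by (simp_all add: J0_def G_linear)
  define J where "J f = L2_rep B.M (J0 f)" for f
  have AEJ: "AE x in B.M. J f x = J0 f x" for f unfolding J_def by (rule L2_rep_AE[OF J0m])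
  have Jm: "J f \<in> borel_measurable B.M" for f unfolding J_def by (rule L2_rep_measurable[OF J0m])
  have "normal_extension (ell2 V) S (L2 B.M) B.N J"
    unfolding normal_extension_def
  proof (intro conjI ballI)
    show "complex_hilbert_space (L2 B.M)" by (rule L2_hilbert)
    show "normal_operator (L2 B.M) B.N" by (rule B.N_normal)
    show "isometric_embedding (ell2 V) (L2 B.M) J"
      unfolding isometric_embedding_def linear_map_def
    proof (intro conjI ballI allI)
      fix f assume f: "f \<in> hset (ell2 V)"
      show "J f \<in> hset (L2 B.M)" unfolding J_def by (rule hset_L2I[OF si[OF f]])
      show "J (hscale (ell2 V) d f) = hscale (L2 B.M) d (J f)" for d
      proof -
        have "AE x in B.M. J0 (\<lambda>v. d * f v) x = d * J f x"
          unfolding J0_lin using AEJ[of f] by eventually_elim simp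
        then show ?thesis unfolding ell2_simps L2_simps J_def[of "\<lambda>v. d * f v"] by (rule L2_rep_cong)
      qed
      fix g assume g: "g \<in> hset (ell2 V)"
      show "J (hadd (ell2 V) f g) = hadd (L2 B.M) (J f) (J g)"
      proof -
        have "AE x in B.M. J0 (\<lambda>v. f v + g v) x = J f x + J g x"
          unfolding J0_lin using AEJ[of f] AEJ[of g] by eventually_elim simp
        then show ?thesis unfolding ell2_simps L2_simps J_def[of "\<lambda>v. f v + g v"] by (rule L2_rep_cong)
      qed
      show "hinner (L2 B.M) (J f) (J g) = hinner (ell2 V) f g"
      proof -
        have "hinner (L2 B.M) (J f) (J g) = (\<integral>x. J0 f x * cnj (J0 g x) \<partial>B.M)"
          unfolding L2_simps
        proof (rule integral_cong_AE)
          show "AE x in B.M. J f x * cnj (J g x) = J0 f x * cnj (J0 g x)"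
            using AEJ[of f] AEJ[of g] by eventually_elim simp
          show "(\<lambda>x. J0 f x * cnj (J0 g x)) \<in> borel_measurable B.M"
            by (intro borel_measurable_integrable square_integrable_mult square_integrable_cnj si f g)
          show "(\<lambda>x. J f x * cnj (J g x)) \<in> borel_measurable B.M"
            unfolding J_def
            by (intro borel_measurable_integrable square_integrable_mult square_integrable_cnj
              square_integrable_L2_rep si f g)
        qed
        moreover have "4 * (\<integral>x. J0 f x * cnj (J0 g x) \<partial>B.M) = 4 * (\<integral>v. f v * cnj (g v) \<partial>count_space V)"
        proof -
          have "J0 f x + d * J0 g x = J0 (\<lambda>v. f v + d * g v) x" for x d by (simp add: J0_lin)
          then show ?thesis
            unfolding L2_polarization[OF si[OF f] si[OF g]]
              L2_polarization[OF ell2_square_integrable[OF f] ell2_square_integrable[OF g]]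
            by (simp only: J0_int ell2_add_scale[OF f g])
        qed
        ultimately show ?thesis using hinner_ell2[OF f g] by simp
      qed
    qed
    fix f assume f: "f \<in> hset (ell2 V)"
    have "AE x in B.M. B.T (J0 f) x = J0 (S f) x"
      unfolding B.M_def
    proof (rule AE_direct_sum_measureI[OF sets_kappa])
      fix i
      show "AE s in \<kappa> i. B.T (J0 f) (i, s) = J0 (S f) (i, s)"
        using G_S[of f i] by (simp only: B.T_eq J0_def fst_conv snd_conv)
    qed
    then have "L2_rep B.M (B.T (J0 f)) = L2_rep B.M (J0 (S f))" by (rule L2_rep_cong)
    then show "B.N (J f) = J (S f)" unfolding J_def B.N_rep(1)[OF J0m] .
  qed
  then show ?thesis by (rule subnormalI[OF bounded])
qed

end


section \<open>The shift on the descendants of a vertex\<close>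

section \<open>Restriction to descendants\<close>

lemma (in bounded_tree_shift) Des_childI:
  assumes "x \<in> nonroots V E" "par E x \<in> Des V E u"
  shows "x \<in> Des V E u"
proof -
  obtain n where n: "par_power V E n (par E x) u" using assms by (auto simp: Des_def)
  have "par_power V E (Suc n) x u"
    unfolding par_power_def
  proof (intro conjI allI impI)
    fix j assume "j < Suc n"
    then show "(par E ^^ j) x \<in> nonroots V E"
      using n assms(1) by (cases j) (auto simp: par_power_def funpow_swap1)
  qed (use n in \<open>simp add: par_power_def funpow_swap1\<close>)
  then show ?thesis using assms(1) nonrootsD by (auto simp: Des_def)
qed

lemma (in bounded_tree_shift) Des_parent:
  assumes "x \<in> Des V E u" "x \<noteq> u"
  shows "x \<in> nonroots V E \<and> par E x \<in> Des V E u"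
proof -
  obtain n where n: "par_power V E n x u" using assms by (auto simp: Des_def)
  then obtain m where m: "n = Suc m" using assms(2) by (cases n) (auto simp: par_power_def)
  have x: "x \<in> nonroots V E" using n m by (auto simp: par_power_def)
  have "(par E ^^ j) (par E x) \<in> nonroots V E" if "j < m" for j
    using n that unfolding par_power_def m by (metis Suc_less_eq funpow_Suc_right comp_apply)
  moreover have "(par E ^^ m) (par E x) = u"
    using n unfolding par_power_def m by (metis funpow_Suc_right comp_apply)
  ultimately show ?thesis using x par_in_V by (auto simp: Des_def par_power_def)
qed

lemma (in bounded_tree_shift) Des_self: "u \<in> V \<Longrightarrow> u \<in> Des V E u"
  by (auto simp: Des_def par_power_def intro!: exI[of _ 0])

lemma (in bounded_tree_shift) no_Des_above:
  assumes "u \<in> nonroots V E"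
  shows "par E u \<notin> Des V E u"
proof
  assume "par E u \<in> Des V E u"
  then obtain n where n: "par_power V E n (par E u) u" by (auto simp: Des_def)
  have "(par E ^^ j) u \<in> nonroots V E" if "j < Suc n" for j
    using n assms that by (cases j) (auto simp: par_power_def funpow_swap1)
  moreover have "(par E ^^ Suc n) u = u" using n by (simp add: par_power_def funpow_swap1)
  ultimately show False using par_no_cycle[of "Suc n" u] by auto
qed

text \<open>\<open>u\<close> becomes a root because by acyclicity its parent is not a descendant of
  it; the parents of all other descendants stay inside.\<close>

lemma (in bounded_tree_shift)
  assumes u: "u \<in> V"
  defines "V' \<equiv> Des V E u" and "E' \<equiv> Des_edges V E u"
  shows Des_nonroots: "nonroots V' E' = V' - {u}"
    and Des_par: "x \<in> V' - {u} \<Longrightarrow> par E' x = par E x"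
proof -
  have E': "(y, x) \<in> E' \<longleftrightarrow> x \<in> V' - {u} \<and> y = par E x" for x y
  proof
    assume e: "(y, x) \<in> E'"
    then have "x \<in> V'" "y \<in> V'" "x \<in> nonroots V E" "par E x = y"
      using edge_iff by (auto simp: E'_def V'_def Des_edges_def)
    then show "x \<in> V' - {u} \<and> y = par E x" using no_Des_above by (auto simp: V'_def)
  next
    assume x: "x \<in> V' - {u} \<and> y = par E x"
    then show "(y, x) \<in> E'"
      using Des_parent[of x u] edge_iff by (auto simp: E'_def V'_def Des_edges_def)
  qed
  show "nonroots V' E' = V' - {u}"
    unfolding nonroots_def is_root_def E' by auto
  show "par E' x = par E x" if "x \<in> V' - {u}"
    unfolding par_def[of E'] E' using that by auto
qed

text \<open>A vertex off \<open>Des V E u\<close>, and also \<open>u\<close> itself, has its parent,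
  if any, off \<open>Des V E u\<close>, where \<open>f\<close> vanishes.\<close>

lemma (in bounded_tree_shift) wshift_Des:
  assumes u: "u \<in> V" and f: "f \<in> hset (ell2 (Des V E u))"
  shows "wshift (Des V E u) (Des_edges V E u) lam f = S f"
proof
  fix x
  show "wshift (Des V E u) (Des_edges V E u) lam f x = S f x"
  proof (cases "x \<in> Des V E u - {u}")
    case True
    then have "x \<in> nonroots V E" using Des_parent by auto
    then show ?thesis using True Des_nonroots[OF u] Des_par[OF u True] by (simp add: wshift_def)
  next
    case False
    have "x \<in> nonroots V E \<Longrightarrow> f (par E x) = 0"
      using False no_Des_above[of u] Des_childI[of x u] f by (cases "x = u") (auto simp: hset_ell2)
    moreover have "x \<notin> nonroots (Des V E u) (Des_edges V E u)" using False Des_nonroots[OF u] by simp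
    ultimately show ?thesis by (simp add: wshift_def)
  qed
qed

lemma ell2_mono:
  assumes "W \<subseteq> V" "f \<in> hset (ell2 W)"
  shows "f \<in> hset (ell2 V)" "hinner (ell2 W) f g = hinner (ell2 V) f g"
    "hnorm (ell2 W) f = hnorm (ell2 V) f"
proof -
  have f0: "f v = 0" if "v \<notin> W" for v using assms that by (simp add: hset_ell2)
  have s: "(\<lambda>v. (cmod (f v))\<^sup>2) summable_on W" using assms by (simp add: hset_ell2)
  have "(\<lambda>v. (cmod (f v))\<^sup>2) summable_on V \<longleftrightarrow> (\<lambda>v. (cmod (f v))\<^sup>2) summable_on W"
    using f0 assms(1) by (intro summable_on_cong_neutral) auto
  then show "f \<in> hset (ell2 V)" using s f0 assms(1) by (auto simp: hset_ell2)
  have "hinner (ell2 W) f g = hinner (ell2 V) f g" for g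
    unfolding ell2_simps using f0 assms(1) by (intro infsum_cong_neutral) auto
  then show "hinner (ell2 W) f g = hinner (ell2 V) f g" "hnorm (ell2 W) f = hnorm (ell2 V) f"
    by (auto simp: hnorm_def)
qed

lemma (in bounded_tree_shift)
  assumes u: "u \<in> V"
  defines "V' \<equiv> Des V E u" and "S' \<equiv> wshift (Des V E u) (Des_edges V E u) lam"
  shows Des_S_closed: "f \<in> hset (ell2 V') \<Longrightarrow> S' f \<in> hset (ell2 V')"
    and Des_bounded: "bounded_operator (ell2 V') S'"
    and Des_subset: "V' \<subseteq> V"
proof -
  show V': "V' \<subseteq> V" by (auto simp: V'_def Des_def)
  have cl: "S' f \<in> hset (ell2 V')" if f: "f \<in> hset (ell2 V')" for f
  proof -
    have eq: "S' f = S f" unfolding S'_def using u f by (intro wshift_Des) (simp_all add: V'_def)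
    have "S f \<in> hset (ell2 V)" by (intro S_closed ell2_mono(1)[OF V' f])
    then have "(\<lambda>v. (cmod (S f v))\<^sup>2) summable_on V'"
      using V' by (auto simp: hset_ell2 intro: summable_on_subset_banach)
    moreover have "S' f v = 0" if "v \<notin> V'" for v
      using that Des_nonroots[OF u] by (simp add: S'_def wshift_def V'_def)
    ultimately show ?thesis unfolding hset_ell2 eq by auto
  qed
  then show "f \<in> hset (ell2 V') \<Longrightarrow> S' f \<in> hset (ell2 V')" .
  obtain C where C: "\<And>f. f \<in> hset (ell2 V) \<Longrightarrow> hnorm (ell2 V) (S f) \<le> C * hnorm (ell2 V) f"
    using bounded by (auto simp: bounded_operator_def)
  show "bounded_operator (ell2 V') S'"
    unfolding bounded_operator_def linear_map_def
  proof (intro conjI ballI allI exI[of _ C])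
    fix f assume f: "f \<in> hset (ell2 V')"
    show "S' f \<in> hset (ell2 V')" using f by (rule cl)
    have "S' f = S f" unfolding S'_def using u f by (intro wshift_Des) (simp_all add: V'_def)
    then show "hnorm (ell2 V') (S' f) \<le> C * hnorm (ell2 V') f"
      using C[OF ell2_mono(1)[OF V' f]] ell2_mono(3)[OF V' f] ell2_mono(3)[OF V' cl[OF f]] by simp
  qed (auto simp: S'_def wshift_def ell2_simps algebra_simps)
qed

text \<open>Functions on the descendants are literally functions on \<open>V\<close> vanishing
  elsewhere, so the same normal extension serves unchanged.\<close>

lemma (in bounded_tree_shift) Des_subnormal:
  assumes u: "u \<in> V" and sub: "subnormal (ell2 V) S"
  shows "subnormal (ell2 (Des V E u)) (wshift (Des V E u) (Des_edges V E u) lam)"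
proof -
  let ?V = "Des V E u" and ?S = "wshift (Des V E u) (Des_edges V E u) lam"
  note V' = Des_subset[OF u]
  obtain K :: "(('v \<Rightarrow> complex) \<times> nat \<Rightarrow> complex) hilb" and N J
    where ext: "normal_extension (ell2 V) S K N J" using sub by (auto simp: subnormal_def)
  have "normal_extension (ell2 ?V) ?S K N J"
    unfolding normal_extension_def isometric_embedding_def linear_map_def
  proof (intro conjI ballI allI)
    show "complex_hilbert_space K" "normal_operator K N" using ext by (auto simp: normal_extension_def)
    note J = ext[unfolded normal_extension_def isometric_embedding_def linear_map_def]
    fix f assume f: "f \<in> hset (ell2 ?V)"
    note f' = ell2_mono(1)[OF V' f]
    show "J f \<in> hset K" "\<And>c. J (hscale (ell2 ?V) c f) = hscale K c (J f)"
      using J f' by (auto simp: ell2_simps)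
    show "N (J f) = J (?S f)" using J f' wshift_Des[OF u f] by auto
    fix g assume g: "g \<in> hset (ell2 ?V)"
    note g' = ell2_mono(1)[OF V' g]
    show "J (hadd (ell2 ?V) f g) = hadd K (J f) (J g)" using J f' g' by (auto simp: ell2_simps)
    show "hinner K (J f) (J g) = hinner (ell2 ?V) f g"
      using J f' g' ell2_mono(2)[OF V' f] by auto
  qed
  then show ?thesis using Des_bounded[OF u] by (auto simp: subnormal_def)
qed

text \<open>What (ii-a) and (iii-a) draw from the subnormality of the shift at \<omega>: a
  descendant has the same moments in both shifts, so the children of \<omega> have moment
  sequences.\<close>

lemma (in bounded_tree_shift) Des_stieltjes:
  assumes u: "u \<in> V" and sub: "subnormal (ell2 (Des V E u)) (wshift (Des V E u) (Des_edges V E u) lam)"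
    and v: "v \<in> Des V E u"
  shows "stieltjes_at v"
proof -
  let ?V = "Des V E u" and ?S = "wshift (Des V E u) (Des_edges V E u) lam"
  have pow: "(?S ^^ n) (unit_vec v) = (S ^^ n) (unit_vec v) \<and> (?S ^^ n) (unit_vec v) \<in> hset (ell2 ?V)" for n
  proof (induction n)
    case (Suc n)
    note e = Suc[THEN conjunct1] and h = Suc[THEN conjunct2]
    have "(?S ^^ Suc n) (unit_vec v) = S ((?S ^^ n) (unit_vec v))"
      by (simp only: funpow.simps comp_apply wshift_Des[OF u h])
    also have "\<dots> = (S ^^ Suc n) (unit_vec v)" by (simp only: funpow.simps comp_apply e)
    finally show ?case
      using Des_S_closed[OF u h] by (simp only: funpow.simps comp_apply simp_thms)
  qed (use v in \<open>simp add: unit_vec_ell2\<close>)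
  have "mom v n = (hnorm (ell2 ?V) ((?S ^^ n) (unit_vec v)))\<^sup>2" for n
    unfolding shift_moments_def ell2_mono(3)[OF Des_subset[OF u] pow[THEN conjunct2]]
    by (simp only: pow[THEN conjunct1])
  then have "mom v = (\<lambda>n. (hnorm (ell2 ?V) ((?S ^^ n) (unit_vec v)))\<^sup>2)" by (rule ext)
  then show ?thesis
    using subnormal_moment_sequence[OF sub unit_vec_ell2(1)[OF v]] by simp
qed

section \<open>The three cases of the theorem\<close>

context one_branching_shift
begin

lemma Chi_Des: "v \<in> Chi E \<omega> \<Longrightarrow> v \<in> Des V E \<omega>"
  using Des_childI[of v \<omega>] Des_self[OF omega] by (auto simp: Chi_iff)

lemma subnormal_imp_path_weight:
  assumes sub: "subnormal (ell2 V) S"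
  shows "has_up (Suc k) \<Longrightarrow> inv_sum (Suc k) = path_weight k"
    and "has_up k \<Longrightarrow> inv_sum (Suc k) \<le> path_weight k"
proof -
  have st: "stieltjes_at v" if "v \<in> V" for v using subnormal_imp_stieltjes[OF sub that] .
  then have sc: "stieltjes_at v" if "v \<in> Chi E \<omega>" for v using ChiD[OF that] by blast
  show "has_up (Suc k) \<Longrightarrow> inv_sum (Suc k) = path_weight k"
    using inv_sum_path_weight(1)[OF _ st[OF up_in_V] sc, of "Suc k" k] by simp
  show "has_up k \<Longrightarrow> inv_sum (Suc k) \<le> path_weight k"
    using inv_sum_path_weight(2)[OF _ st[OF up_in_V] sc, of k] by simp
qed

lemma subnormal_shiftI:
  assumes "\<And>v. v \<in> Chi E \<omega> \<Longrightarrow> stieltjes_at v"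
    and "\<And>k. has_up k \<Longrightarrow> inv_sum (Suc k) \<le> path_weight k"
    and "\<And>k. has_up (Suc k) \<Longrightarrow> inv_sum (Suc k) = path_weight k"
  shows "subnormal (ell2 V) S"
proof -
  interpret extendible_shift V E lam \<omega> using assms by unfold_locales auto
  show ?thesis by (rule subnormal_shift)
qed

text \<open>Every vertex below \<omega> has a parent, so a root must be some \<open>up k\<close>; as
  \<open>has_up\<close> cannot pass beyond a root, there is only one.\<close>

lemma is_root_facts:
  assumes "is_root V E r"
  shows "root_of V E = r" "\<exists>k. has_up k \<and> up k = r" "r \<notin> nonroots V E"
proof -
  have ex: "\<exists>k. has_up k \<and> up k = r" if r: "is_root V E r" for r
  proof -
    have "r \<in> V" "r \<notin> nonroots V E" using r by (auto simp: is_root_def nonroots_def)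
    then show ?thesis using vertex_cases[of r] desc_nonroot by blast
  qed
  have eq: "r = r'" if r: "is_root V E r" and r': "is_root V E r'" for r r'
  proof -
    obtain k where k: "has_up k" "up k = r" using ex[OF r] by blast
    obtain k' where k': "has_up k'" "up k' = r'" using ex[OF r'] by blast
    have "r \<notin> nonroots V E" "r' \<notin> nonroots V E" using r r' by (auto simp: nonroots_def)
    then have "\<not> k < k'" "\<not> k' < k" using k k' by (auto simp: has_up_def)
    then have "k = k'" by simp
    then show ?thesis using k k' by simp
  qed
  show "root_of V E = r" unfolding root_of_def using assms eq by (intro the_equality) auto
  show "\<exists>k. has_up k \<and> up k = r" using ex[OF assms] .
  show "r \<notin> nonroots V E" using assms by (simp add: nonroots_def)
qed

lemma path_weight_0: "path_weight 0 = 1"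
  by (simp add: path_weight_def)

lemma root_case:
  assumes "is_root V E \<omega>"
  shows "subnormal (ell2 V) S \<longleftrightarrow> (\<forall>v\<in>Chi E \<omega>. stieltjes_at v) \<and> inv_sum 1 \<le> 1"
proof
  assume sub: "subnormal (ell2 V) S"
  have "inv_sum 1 \<le> 1" using subnormal_imp_path_weight(2)[OF sub, of 0] by (simp add: path_weight_0)
  then show "(\<forall>v\<in>Chi E \<omega>. stieltjes_at v) \<and> inv_sum 1 \<le> 1"
    using subnormal_imp_stieltjes[OF sub] ChiD by blast
next
  assume r: "(\<forall>v\<in>Chi E \<omega>. stieltjes_at v) \<and> inv_sum 1 \<le> 1"
  have no: "has_up k \<longleftrightarrow> k = 0" for k
    using is_root_facts(3)[OF assms] by (auto simp: has_up_def intro: gr0I)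
  show "subnormal (ell2 V) S"
    by (rule subnormal_shiftI) (use r in \<open>auto simp: no path_weight_0\<close>)
qed

text \<open>Here \<open>has_up k\<close> holds exactly for \<open>k \<le> \<kappa>\<close>. Both
  conditions are compared with a third one: moment sequences at the children, equality for all
  \<open>k < \<kappa>\<close>, and the inequality for \<open>k = \<kappa>\<close>.\<close>

lemma rooted_case:
  assumes root: "\<not> rootless V E" and ne: "\<omega> \<noteq> root_of V E"
  defines "\<kappa> \<equiv> root_distance V E \<omega>"
  shows "subnormal (ell2 V) S \<longleftrightarrow>
      subnormal (ell2 (Des V E \<omega>)) (wshift (Des V E \<omega>) (Des_edges V E \<omega>) lam) \<and> inv_sum 1 = 1 \<and>
      (\<forall>k. 1 \<le> k \<and> k \<le> \<kappa> - 1 \<longrightarrow> path_weight k = inv_sum (k + 1)) \<and> path_weight \<kappa> \<ge> inv_sum (\<kappa> + 1)"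
      (is "?sub \<longleftrightarrow> ?a")
    and "subnormal (ell2 V) S \<longleftrightarrow> stieltjes_at (root_of V E) \<and> (\<forall>v\<in>Chi E \<omega>. stieltjes_at v)"
      (is "_ \<longleftrightarrow> ?b")
proof -
  obtain r where r: "is_root V E r" using root by (auto simp: rootless_def)
  note ru = is_root_facts[OF r]
  obtain K where K: "has_up K" "up K = r" using ru(2) by blast
  have K0: "0 < K" using K ne ru(1) by (cases K) auto
  have up_iff: "has_up k \<longleftrightarrow> k \<le> K" for k
    using K ru(3) has_up_mono[OF K(1)] unfolding has_up_def by (metis not_less)
  have "\<kappa> = K"
    unfolding \<kappa>_def root_distance_def ru(1)
  proof (rule the_equality)
    show "0 < K \<and> par_power V E K \<omega> r" using K K0 by (simp add: par_power_def has_up_def)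
    fix k assume "0 < k \<and> par_power V E k \<omega> r"
    then have "has_up k" "up k = r" by (auto simp: par_power_def has_up_def)
    then show "k = K" using up_inj[OF _ K(1)] K(2) by simp
  qed
  then have \<kappa>: "\<kappa> = K" .
  have rV: "root_of V E \<in> V" using r ru(1) by (simp add: is_root_def)
  have iff: "?sub \<longleftrightarrow> (\<forall>v\<in>Chi E \<omega>. stieltjes_at v) \<and>
    (\<forall>k<K. inv_sum (Suc k) = path_weight k) \<and> inv_sum (Suc K) \<le> path_weight K"
  proof
    assume sub: ?sub
    then show "(\<forall>v\<in>Chi E \<omega>. stieltjes_at v) \<and>
      (\<forall>k<K. inv_sum (Suc k) = path_weight k) \<and> inv_sum (Suc K) \<le> path_weight K"
      using subnormal_imp_stieltjes[OF sub] ChiD subnormal_imp_path_weight[OF sub]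
      by (simp add: up_iff)
  next
    assume c: "(\<forall>v\<in>Chi E \<omega>. stieltjes_at v) \<and>
      (\<forall>k<K. inv_sum (Suc k) = path_weight k) \<and> inv_sum (Suc K) \<le> path_weight K"
    show ?sub
    proof (rule subnormal_shiftI)
      show "inv_sum (Suc k) \<le> path_weight k" if "has_up k" for k
        using that c by (cases "k = K") (auto simp: up_iff)
    qed (use c in \<open>auto simp: up_iff\<close>)
  qed
  have eqs: "(\<forall>k<K. inv_sum (Suc k) = path_weight k) \<longleftrightarrow>
    inv_sum 1 = 1 \<and> (\<forall>k. 1 \<le> k \<and> k \<le> K - 1 \<longrightarrow> path_weight k = inv_sum (k + 1))"
  proof (intro iffI conjI allI impI)
    assume L: "\<forall>k<K. inv_sum (Suc k) = path_weight k"
    show "inv_sum 1 = 1" using L[rule_format, OF K0] by (simp add: path_weight_0)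
    fix k assume "1 \<le> k \<and> k \<le> K - 1"
    then have "k < K" using K0 by linarith
    then show "path_weight k = inv_sum (k + 1)" using L by simp
  next
    fix k assume R: "inv_sum 1 = 1 \<and> (\<forall>k. 1 \<le> k \<and> k \<le> K - 1 \<longrightarrow> path_weight k = inv_sum (k + 1))"
      and k: "k < K"
    show "inv_sum (Suc k) = path_weight k"
    proof (cases "k = 0")
      case False
      then have "1 \<le> k \<and> k \<le> K - 1" using k by linarith
      then show ?thesis using R by simp
    qed (use R in \<open>simp add: path_weight_0\<close>)
  qed
  show "?sub \<longleftrightarrow> ?a"
    unfolding \<kappa> using iff eqs Des_subnormal[OF omega] Des_stieltjes[OF omega] Chi_Des by auto
  show "?sub \<longleftrightarrow> ?b"
  proof
    show "?sub \<Longrightarrow> ?b" using subnormal_imp_stieltjes rV ChiD by blast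
    \<comment> \<open>The moment sequence at the root passes down to every ancestor of \<omega>, and
      with it come all the equalities and the final inequality.\<close>
    assume b: ?b
    then have "stieltjes_at (up K)" using K ru(1) by simp
    from inv_sum_path_weight[OF K(1) this] show ?sub unfolding iff using b by blast
  qed
qed

text \<open>Every ancestor exists and has a parent, so only equalities occur.\<close>

lemma rootless_case:
  assumes rootless: "rootless V E"
  shows "subnormal (ell2 V) S \<longleftrightarrow>
      subnormal (ell2 (Des V E \<omega>)) (wshift (Des V E \<omega>) (Des_edges V E \<omega>) lam) \<and> inv_sum 1 = 1 \<and>
      (\<forall>k\<ge>1. path_weight k = inv_sum (k + 1))"
      (is "?sub \<longleftrightarrow> ?a")
    and "subnormal (ell2 V) S \<longleftrightarrow>
      infinite {k. 1 \<le> k \<and> stieltjes_at (up k)} \<and> (\<forall>v\<in>Chi E \<omega>. stieltjes_at v)"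
      (is "_ \<longleftrightarrow> ?b")
proof -
  have nr: "nonroots V E = V" using rootless by (auto simp: rootless_def nonroots_def)
  have up: "has_up k" for k
  proof (induction k)
    case (Suc k)
    then show ?case using up_in_V[of k] nr by (simp add: has_up_Suc)
  qed simp
  have iff: "?sub \<longleftrightarrow> (\<forall>v\<in>Chi E \<omega>. stieltjes_at v) \<and> (\<forall>k. inv_sum (Suc k) = path_weight k)"
  proof
    assume sub: ?sub
    then show "(\<forall>v\<in>Chi E \<omega>. stieltjes_at v) \<and> (\<forall>k. inv_sum (Suc k) = path_weight k)"
      using subnormal_imp_stieltjes[OF sub] ChiD subnormal_imp_path_weight(1)[OF sub up] by blast
  next
    assume c: "(\<forall>v\<in>Chi E \<omega>. stieltjes_at v) \<and> (\<forall>k. inv_sum (Suc k) = path_weight k)"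
    show ?sub by (rule subnormal_shiftI) (use c in auto)
  qed
  have eqs: "(\<forall>k. inv_sum (Suc k) = path_weight k) \<longleftrightarrow>
    inv_sum 1 = 1 \<and> (\<forall>k\<ge>1. path_weight k = inv_sum (k + 1))"
  proof (intro iffI conjI allI impI)
    assume L: "\<forall>k. inv_sum (Suc k) = path_weight k"
    show "inv_sum 1 = 1" using L[rule_format, of 0] by (simp add: path_weight_0)
    show "path_weight k = inv_sum (k + 1)" for k using L by simp
  next
    fix k assume R: "inv_sum 1 = 1 \<and> (\<forall>k\<ge>1. path_weight k = inv_sum (k + 1))"
    show "inv_sum (Suc k) = path_weight k"
    proof (cases "k = 0")
      case False
      then show ?thesis using R by simp
    qed (use R in \<open>simp add: path_weight_0\<close>)
  qed
  show "?sub \<longleftrightarrow> ?a"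
    using iff eqs Des_subnormal[OF omega] Des_stieltjes[OF omega] Chi_Des by auto
  show "?sub \<longleftrightarrow> ?b"
  proof
    assume sub: ?sub
    have "{k. 1 \<le> k \<and> stieltjes_at (up k)} = {1..}"
      using subnormal_imp_stieltjes[OF sub up_in_V[OF up]] by auto
    then show ?b using subnormal_imp_stieltjes[OF sub] ChiD by (simp add: infinite_Ici)
  next
    assume b: ?b
    have "inv_sum (Suc k) = path_weight k" for k
    proof -
      \<comment> \<open>Equality at \<open>k\<close> needs a moment sequence strictly above
        \<open>up k\<close>; infinitely many such ancestors reach beyond every
        \<open>k\<close>.\<close>
      obtain K where "K \<in> {k. 1 \<le> k \<and> stieltjes_at (up k)}" "k < K"
        using b infinite_nat_iff_unbounded by blast
      then show ?thesis using inv_sum_path_weight(1)[OF up[of K]] b by blast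
    qed
    then show ?sub unfolding iff using b by blast
  qed
qed

end

theorem theorem6p2p1:
  fixes V :: "'v set" and E :: "('v \<times> 'v) set" and \<omega> :: 'v and lam :: "'v \<Rightarrow> complex"
  assumes tree: "directed_tree V E"
    and omega: "\<omega> \<in> V"
    and branching: "infinite (Chi E \<omega>) \<or> 2 \<le> card (Chi E \<omega>)"
    and non_branching: "\<And>v. v \<in> V - {\<omega>} \<Longrightarrow> card (Chi E v) = 1"
    and everywhere_defined: "wshift_domain V E lam = hset (ell2 V)"
    and bounded: "bounded_operator (ell2 V) (wshift V E lam)"
    and nonzero: "\<And>v. v \<in> nonroots V E \<Longrightarrow> lam v \<noteq> 0"
  defines "subnormal_shift \<equiv> subnormal (ell2 V) (wshift V E lam)"
    and "subnormal_omega \<equiv>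
      subnormal (ell2 (Des V E \<omega>)) (wshift (Des V E \<omega>) (Des_edges V E \<omega>) lam)"
    and "stieltjes_at \<equiv> \<lambda>v. stieltjes_moment_sequence (shift_moments V E lam v)"
    and "path_weight \<equiv>
      \<lambda>k. ennreal (1 / (cmod (\<Prod>j<k. lam ((par E ^^ j) \<omega>)))\<^sup>2)"
    and "inv_sum \<equiv> inverse_moment_sum V E lam \<omega>"
    and "\<kappa> \<equiv> root_distance V E \<omega>"
  shows
    \<comment> \<open>(i)\<close>
    "(is_root V E \<omega> \<longrightarrow>
        (subnormal_shift \<longleftrightarrow> (\<forall>v\<in>Chi E \<omega>. stieltjes_at v) \<and> inv_sum 1 \<le> 1))
    \<and>
    \<comment> \<open>(ii)\<close>
    (\<not> rootless V E \<and> \<omega> \<noteq> root_of V E \<longrightarrow>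
        (subnormal_shift \<longleftrightarrow>
          subnormal_omega \<and> inv_sum 1 = 1 \<and>
          (\<forall>k. 1 \<le> k \<and> k \<le> \<kappa> - 1 \<longrightarrow> path_weight k = inv_sum (k + 1)) \<and>
          path_weight \<kappa> \<ge> inv_sum (\<kappa> + 1)) \<and>
        (subnormal_shift \<longleftrightarrow>
          stieltjes_at (root_of V E) \<and> (\<forall>v\<in>Chi E \<omega>. stieltjes_at v)))
    \<and>
    \<comment> \<open>(iii)\<close>
    (rootless V E \<longrightarrow>
        (subnormal_shift \<longleftrightarrow>
          subnormal_omega \<and> inv_sum 1 = 1 \<and>
          (\<forall>k\<ge>1. path_weight k = inv_sum (k + 1))) \<and>
        (subnormal_shift \<longleftrightarrow>
          infinite {k. 1 \<le> k \<and> stieltjes_at ((par E ^^ k) \<omega>)} \<and>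
          (\<forall>v\<in>Chi E \<omega>. stieltjes_at v)))"
proof -
  interpret B: one_branching_shift V E lam \<omega>
    using tree bounded omega non_branching nonzero by unfold_locales
  have pw: "path_weight = B.path_weight" by (simp add: path_weight_def B.path_weight_def fun_eq_iff)
  show ?thesis
    unfolding subnormal_shift_def subnormal_omega_def stieltjes_at_def pw inv_sum_def \<kappa>_def
    by (intro conjI impI; (elim conjE)?; (rule B.root_case B.rooted_case B.rootless_case; assumption))
qed

end
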